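(* Let $d\ge2$, $1\le p<\infty$, and let $M=\{\mu_L\}_{L\ge1}$ be a family of (nonnegative Borel) measures on $\mathbb{S}^d$. Then $M$ is $L^p$-Carleson for $\Pi_L$ if and only if there exists $C>0$ such that for all $L\ge 1$ $$\sup_{z\in\mathbb{S}^d}\mu_L(B(z,L^{-1}))\le\frac{C}{\pi_L}.$$
   Context: $\mathbb{S}^d$ is the unit sphere in $\mathbb{R}^{d+1}$, $\sigma$ its Lebesgue surface measure, and $B(z,\theta)\subset\mathbb{S}^d$ is the geodesic ball (spherical cap) with center $z$ and radius $\theta$ for the distance $d(u,v)=\arccos\langle u,v\rangle$. $\Pi_L$ is the linear span of the spaces $\mathcal{H}_\ell$, $0\le\ell\le L$, of (complex-valued) spherical harmonics of degree $\ell$ on $\mathbb{S}^d$, and $\pi_L=\dim\Pi_L$. The family $M=\{\mu_L\}$ is called $L^p$-Carleson for $\Pi_L$ if there is a constant $C>0$, independent of $L$, such that for every $L$ and every $Q\in\Pi_L$ $$\int_{\mathbb{S}^d}|Q(z)|^p\,d\mu_L(z)\le C\int_{\mathbb{S}^d}|Q(z)|^p\,d\sigma(z).$$ *)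

theory Defs
  imports "HOL-Analysis.Analysis" "HOL-Library.Function_Algebras"
begin

text \<open>
  The sphere of dimension \<open>d\<close> is the unit sphere \<open>sphere 0 1\<close> of a Euclidean space
  with \<open>DIM('a) = d + 1\<close>.
\<close>

abbreviation unit_sphere :: "'a::euclidean_space set"
  where "unit_sphere \<equiv> sphere 0 1"

abbreviation sphere_borel :: "'a::euclidean_space measure"
  where "sphere_borel \<equiv> restrict_space borel unit_sphere"

text \<open>
  Surface measure, through polar coordinates: since
  \<open>\<integral>\<^sub>0\<^sup>1 r ^ d dr = 1 / (d + 1)\<close>, the surface measure of \<open>A\<close>
  is \<open>d + 1\<close> times the volume of the cone over \<open>A\<close> inside the unit ball; see
  \<open>emeasure_surface_measure\<close>.
\<close>

definition surface_measure :: "'a::euclidean_space measure"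
  where "surface_measure =
    scale_measure (of_nat DIM('a))
      (distr (restrict_space lborel (ball 0 1 - {0})) sphere_borel (\<lambda>x. x /\<^sub>R norm x))"

lemma sets_surface_measure: "sets surface_measure = sets sphere_borel"
  by (simp add: surface_measure_def)

lemma emeasure_surface_measure:
  fixes A :: "'a::euclidean_space set"
  assumes "A \<in> sets sphere_borel"
  shows "emeasure surface_measure A =
    of_nat DIM('a) * emeasure lborel {x \<in> ball 0 1 - {0}. x /\<^sub>R norm x \<in> A}"
proof -
  have meas: "(\<lambda>x::'a. x /\<^sub>R norm x) \<in> restrict_space lborel (ball 0 1 - {0}) \<rightarrow>\<^sub>M sphere_borel"
  proof (rule measurable_restrict_space2)
    show "(\<lambda>x::'a. x /\<^sub>R norm x) \<in> space (restrict_space lborel (ball 0 1 - {0})) \<rightarrow> unit_sphere"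
      by (auto simp: space_restrict_space)
    show "(\<lambda>x::'a. x /\<^sub>R norm x) \<in> borel_measurable (restrict_space lborel (ball 0 1 - {0}))"
      by (intro measurable_restrict_space1) measurable
  qed
  have "(\<lambda>x::'a. x /\<^sub>R norm x) -` A \<inter> space (restrict_space lborel (ball 0 1 - {0}))
      = {x \<in> ball 0 1 - {0}. x /\<^sub>R norm x \<in> A}"
    by (auto simp: space_restrict_space)
  moreover have "emeasure (restrict_space lborel (ball 0 1 - {0}))
      {x \<in> ball 0 1 - {0}. x /\<^sub>R norm x \<in> A} =
      emeasure lborel {x \<in> ball 0 1 - {0::'a}. x /\<^sub>R norm x \<in> A}"
    by (rule emeasure_restrict_space) auto
  ultimately show ?thesis
    unfolding surface_measure_def by (simp only: emeasure_scale_measure emeasure_distr[OF meas assms])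
qed

text \<open>Geodesic (open) ball of the sphere for the distance \<open>arccos (u \<bullet> v)\<close>.\<close>

definition geodesic_ball :: "'a::euclidean_space \<Rightarrow> real \<Rightarrow> 'a set"
  where "geodesic_ball z \<theta> = {u \<in> unit_sphere. arccos (z \<bullet> u) < \<theta>}"

text \<open>
  Functions on the sphere are represented by functions on the ambient space that vanish
  off the sphere, so that they form a complex vector space.
\<close>

definition cfun_scale :: "complex \<Rightarrow> ('a \<Rightarrow> complex) \<Rightarrow> 'a \<Rightarrow> complex"
  where "cfun_scale c f = (\<lambda>x. c * f x)"

global_interpretation cfun: vector_space "cfun_scale :: complex \<Rightarrow> ('a \<Rightarrow> complex) \<Rightarrow> 'a \<Rightarrow> complex"
  by unfold_locales (auto simp: cfun_scale_def fun_eq_iff algebra_simps)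

definition laplacian :: "('a::euclidean_space \<Rightarrow> complex) \<Rightarrow> 'a \<Rightarrow> complex"
  where "laplacian f x =
    (\<Sum>b\<in>Basis. vector_derivative
       (\<lambda>s. vector_derivative (\<lambda>t. f (x + t *\<^sub>R b)) (at s)) (at 0))"

definition homogeneous_harmonic_polynomial :: "nat \<Rightarrow> ('a::euclidean_space \<Rightarrow> complex) \<Rightarrow> bool"
  where "homogeneous_harmonic_polynomial l f \<longleftrightarrow>
    polynomial_function f \<and>
    (\<forall>t::real. \<forall>x. f (t *\<^sub>R x) = of_real (t ^ l) * f x) \<and>
    (\<forall>x. laplacian f x = 0)"

definition spherical_harmonics :: "nat \<Rightarrow> ('a::euclidean_space \<Rightarrow> complex) set"
  where "spherical_harmonics l =
    {(\<lambda>x. if x \<in> unit_sphere then f x else 0) | f. homogeneous_harmonic_polynomial l f}"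

definition Pi_space :: "nat \<Rightarrow> ('a::euclidean_space \<Rightarrow> complex) set"
  where "Pi_space L = cfun.span (\<Union>l\<le>L. spherical_harmonics l)"

definition pi_dim :: "'a::euclidean_space itself \<Rightarrow> nat \<Rightarrow> nat"
  where "pi_dim _ L = cfun.dim (Pi_space L :: ('a \<Rightarrow> complex) set)"

text \<open>
  The integrals are taken in \<open>[0, \<infinity>]\<close>, the measures being arbitrary. The family
  \<open>\<mu> L\<close> is indexed by \<open>L \<ge> 1\<close>; \<open>\<mu> 0\<close> plays no role.
\<close>

definition Lp_Carleson :: "real \<Rightarrow> (nat \<Rightarrow> 'a::euclidean_space measure) \<Rightarrow> bool"
  where "Lp_Carleson p \<mu> \<longleftrightarrow>
    (\<exists>C::real. C > 0 \<and> (\<forall>L\<ge>1. \<forall>Q\<in>Pi_space L.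
      (\<integral>\<^sup>+z. ennreal (norm (Q z) powr p) \<partial>\<mu> L)
        \<le> ennreal C * (\<integral>\<^sup>+z. ennreal (norm (Q z) powr p) \<partial>surface_measure)))"

end

theory Submission
  imports Defs
begin

text \<open>
  Sufficiency: along the rotation in a coordinate plane, \<open>Q \<in> \<Pi>\<^sub>L\<close> is a trigonometric polynomial of
  degree at most \<open>L\<close>, and a discrete kernel reproducing such polynomials bounds
  \<open>\<bar>Q\<bar>\<^sup>p\<close> at every angle of size \<open>O(1/L)\<close> by one weighted average of
  \<open>\<bar>Q\<bar>\<^sup>p\<close> over \<open>4 L + 1\<close> rotations, with total weight at most \<open>9\<close>. Iterating over
  the coordinate planes, every point near \<open>y\<close> is reached, so \<open>\<bar>Q(z)\<bar>\<^sup>p \<le> C G(y)\<close> whenever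
  \<open>\<bar>y - z\<bar> \<le> c/L\<close>, where by rotation invariance the integral of \<open>G\<close> is at most a constant times that of
  \<open>\<bar>Q\<bar>\<^sup>p\<close>. Averaging over \<open>y\<close> and exchanging the integrals gives the Carleson inequality.

  Necessity: test on a power of the normalised Dirichlet kernel in the geodesic distance to \<open>z\<close>; it is
  bounded below on \<open>B(z, 1/L)\<close> and its integral is \<open>O(L\<^sup>-\<^sup>d)\<close>.

  Both directions use that \<open>\<pi>\<^sub>L\<close> is comparable to \<open>L\<^sup>d\<close>, and that \<open>\<Pi>\<^sub>L\<close> consists of all
  restrictions of polynomials of degree at most \<open>L\<close>: if \<open>\<Delta> f = \<Sum> \<bar>x\<bar>\<^sup>2\<^sup>j u\<^sub>j\<close> with
  harmonic \<open>u\<^sub>j\<close>, then \<open>f\<close> differs from a suitable \<open>\<Sum> c\<^sub>j \<bar>x\<bar>\<^sup>2\<^sup>j\<^sup>+\<^sup>2 u\<^sub>j\<close>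
  by a harmonic polynomial.
\<close>

section \<open>Surface measure\<close>

text \<open>The case p = 1 and arbitrary measures leave no room for duality, so the bound is a
  pointwise majorant with positive weights: their total is bounded independently of L, and Jensen's
  inequality passes from |Q| to |Q|^p for every p >= 1 at once. The majorant depends on the base
  point and on the planes of rotation, but not on the angles. Hence one function of y controls Q at
  all points near y, and this is what a double integral can exploit. Why d rotations reach a
  neighbourhood: each corrects one coordinate at the expense of a fixed coordinate k, and the unit
  norm then determines coordinate k up to sign. This requires |y . k| to be bounded below. With n =
  d + 1 some coordinate satisfies (y . k)^2 >= 1/n; the choices a = 1/(2n) for the bound kept
  throughout and eta = 1/(4nL) for the angles lead to the radius a eta / 4 = 1/(32 n^2 L). It is
  smaller than the chord of 1/L, so the hypothesis on caps applies without covering one cap by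
  others. In the necessity part the power of the kernel is d + 1, because its decay has to beat the
  growth r^d of the measure of caps.\<close>

lemma borel_measurable_orthogonal_transformation:
  fixes f :: "'a::euclidean_space \<Rightarrow> 'a"
  assumes "orthogonal_transformation f" shows "f \<in> borel_measurable borel"
  using assms
  by (simp add: borel_measurable_continuous_onI linear_continuous_on linear_linear orthogonal_transformation_linear)

text \<open>By Vitali an open set is a disjoint union of balls up to a null set, and preimages of balls are balls of the same radius.\<close>

lemma emeasure_lborel_open_le_vimage_orthogonal:
  fixes f :: "'a::euclidean_space \<Rightarrow> 'a"
  assumes f: "orthogonal_transformation f" and U: "open U"
  shows "emeasure lborel U \<le> emeasure lborel (f -` U)"
proof -
  define K where "K = {(x, r). 0 < r \<and> ball x r \<subseteq> U}"
  obtain C where C: "countable C" "C \<subseteq> K"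
    and dj: "pairwise (\<lambda>i j. disjnt (ball (fst i) (snd i)) (ball (fst j) (snd j))) C"
    and neg: "negligible (U - (\<Union>i\<in>C. ball (fst i) (snd i)))"
  proof (rule Vitali_covering_theorem_balls[of U K fst snd])
    fix x and e :: real assume "x \<in> U" "0 < e"
    obtain k where k: "k > 0" "ball x k \<subseteq> U" using U \<open>x \<in> U\<close> by (meson openE)
    have "ball x (min k (e/2)) \<subseteq> U" using k(2) by auto
    then show "\<exists>i. i \<in> K \<and> x \<in> ball (fst i) (snd i) \<and> snd i < e"
      using k \<open>0 < e\<close> by (intro exI[of _ "(x, min k (e/2))"]) (auto simp: K_def min_def)
  qed blast
  let ?B = "\<lambda>i. ball (fst i) (snd i)"
  have inv: "orthogonal_transformation (inv f)" "bij f"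
    using f orthogonal_transformation_inv orthogonal_transformation_bij by auto
  have vim: "f -` ball x r = ball (inv f x) r" for x r
    using inv image_orthogonal_transformation_ball[OF inv(1), of x r]
    by (simp add: bij_vimage_eq_inv_image)
  have contf: "f \<in> borel_measurable borel"
    by (rule borel_measurable_orthogonal_transformation[OF f])
  have sub: "(\<Union>i\<in>C. ?B i) \<subseteq> U"
  proof (rule UN_least)
    fix i assume "i \<in> C"
    then have "i \<in> K" using C(2) by blast
    then show "?B i \<subseteq> U" by (cases i) (simp add: K_def)
  qed
  have [measurable]: "U \<in> sets borel" using U by simp
  have [measurable]: "(\<Union>i\<in>C. ?B i) \<in> sets borel" by (intro borel_open) auto
  have "emeasure lborel U \<le> emeasure lborel ((\<Union>i\<in>C. ?B i) \<union> (U - (\<Union>i\<in>C. ?B i)))"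
    using U by (intro emeasure_mono) auto
  also have "\<dots> = emeasure lborel (\<Union>i\<in>C. ?B i)"
  proof (rule emeasure_Un_null_set)
    show "(\<Union>i\<in>C. ?B i) \<in> sets lborel" by auto
    have "U - (\<Union>i\<in>C. ?B i) \<in> sets lborel" using U by (auto intro!: sets.Diff borel_open)
    then show "U - (\<Union>i\<in>C. ?B i) \<in> null_sets lborel"
      using neg by (simp add: negligible_iff_null_sets null_sets_def)
  qed
  also have "\<dots> = (\<integral>\<^sup>+i. emeasure lborel (?B i) \<partial>count_space C)"
    using dj C(1)
    by (intro emeasure_UN_countable) (auto simp: disjoint_family_on_def pairwise_def disjnt_def)
  also have "\<dots> = (\<integral>\<^sup>+i. emeasure lborel (f -` ?B i) \<partial>count_space C)"
    using C(2) by (intro nn_integral_cong) (auto simp: vim K_def emeasure_ball)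
  also have "\<dots> = emeasure lborel (\<Union>i\<in>C. f -` ?B i)"
    using dj C(1)
    by (intro emeasure_UN_countable[symmetric])
       (auto simp: vim disjoint_family_on_def pairwise_def disjnt_def vimage_Int[symmetric]
             measurable_sets_borel[OF contf] simp flip: vim simp del: mem_ball vimage_Int)
  also have "\<dots> \<le> emeasure lborel (f -` U)"
    using sub contf U by (intro emeasure_mono) (auto simp: measurable_sets_borel[OF contf])
  finally show ?thesis .
qed

text \<open>The inequality for open sets, applied to \<open>f\<close> and to its inverse, becomes an
  equality; boxes are open and determine \<open>lborel\<close>.\<close>

lemma distr_lborel_orthogonal:
  fixes f :: "'a::euclidean_space \<Rightarrow> 'a"
  assumes f: "orthogonal_transformation f"
  shows "distr lborel borel f = lborel"
proof -
  have contf: "continuous_on UNIV f"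
    using f by (simp add: linear_continuous_on linear_linear orthogonal_transformation_linear)
  then have meas: "f \<in> borel_measurable borel"
    by (simp add: borel_measurable_continuous_onI)
  have inv: "orthogonal_transformation (inv f)" "bij f"
    using f orthogonal_transformation_inv orthogonal_transformation_bij by auto
  have "emeasure lborel (f -` U) = emeasure lborel U" if U: "open U" for U
  proof (rule antisym)
    have "open (f -` U)" using contf U by (simp add: continuous_on_open_vimage)
    then have "emeasure lborel (f -` U) \<le> emeasure lborel (inv f -` (f -` U))"
      by (rule emeasure_lborel_open_le_vimage_orthogonal[OF inv(1)])
    also have "inv f -` (f -` U) = U"
      using inv(2) by (auto simp: bij_is_surj surj_f_inv_f)
    finally show "emeasure lborel (f -` U) \<le> emeasure lborel U" .
  qed (rule emeasure_lborel_open_le_vimage_orthogonal[OF f U])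
  then show ?thesis
    using meas by (intro lborel_eqI[symmetric]) (simp_all add: emeasure_distr open_box emeasure_lborel_box)
qed

lemma space_surface_measure: "space (surface_measure :: 'a::euclidean_space measure) = unit_sphere"
  using sets_eq_imp_space_eq[OF sets_surface_measure[where 'a='a]] by (simp add: space_restrict_space)

lemma sets_sphere_borel: "A \<in> sets sphere_borel \<longleftrightarrow> A \<in> sets borel \<and> A \<subseteq> unit_sphere"
  by (subst sets_restrict_space_iff) auto

lemma emeasure_surface_measure_le:
  fixes A :: "'a::euclidean_space set"
  shows "emeasure surface_measure A \<le> ennreal (DIM('a) * unit_ball_vol DIM('a))"
proof (cases "A \<in> sets sphere_borel")
  case True
  have "emeasure lborel {x \<in> ball 0 1 - {0}. x /\<^sub>R norm x \<in> A} \<le> emeasure lborel (ball (0::'a) 1)"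
    by (intro emeasure_mono) auto
  then show ?thesis
    using True by (simp add: emeasure_surface_measure emeasure_ball ennreal_mult ennreal_of_nat_eq_real_of_nat mult_left_mono)
qed (simp add: emeasure_notin_sets sets_surface_measure)

lemma finite_measure_surface_measure: "finite_measure (surface_measure :: 'a::euclidean_space measure)"
  using emeasure_surface_measure_le[of "space surface_measure :: 'a set"]
  by (intro finite_measureI) (auto simp: top_unique)

lemma cone_measurable:
  fixes A :: "'a::euclidean_space set"
  assumes "A \<in> sets borel"
  shows "{x \<in> ball 0 1 - {0}. x /\<^sub>R norm x \<in> A} \<in> sets borel"
proof -
  have [measurable]: "A \<in> sets borel" by fact
  have "Measurable.pred borel (\<lambda>x::'a. x \<in> ball 0 1 - {0} \<and> x /\<^sub>R norm x \<in> A)"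
    unfolding mem_ball dist_norm Diff_iff singleton_iff by measurable
  then show ?thesis by simp
qed

lemma measurable_surface_measure_orthogonal:
  fixes f :: "'a::euclidean_space \<Rightarrow> 'a"
  assumes f: "orthogonal_transformation f"
  shows "f \<in> surface_measure \<rightarrow>\<^sub>M surface_measure"
proof -
  have "f \<in> borel_measurable borel"
    by (rule borel_measurable_orthogonal_transformation[OF f])
  then show ?thesis
    unfolding measurable_cong_sets[OF sets_surface_measure sets_surface_measure]
    using f by (intro measurable_restrict_space2)
      (auto simp: orthogonal_transformation_norm space_restrict_space intro: measurable_restrict_space1)
qed

text \<open>An orthogonal map preserves norms and commutes with scaling, so the cone over a preimage
  is the preimage of the cone, and the invariance of \<open>lborel\<close> passes to the
  sphere.\<close>

lemma distr_surface_measure_orthogonal: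
  fixes f :: "'a::euclidean_space \<Rightarrow> 'a"
  assumes f: "orthogonal_transformation f"
  shows "distr surface_measure surface_measure f = surface_measure"
proof (rule measure_eqI)
  have lin: "linear f" and nrm: "norm (f x) = norm x" for x
    using f by (auto simp: orthogonal_transformation_norm orthogonal_transformation_linear)
  have [measurable]: "f \<in> borel_measurable borel"
    by (rule borel_measurable_orthogonal_transformation[OF f])
  note meas = measurable_surface_measure_orthogonal[OF f]
  fix A assume "A \<in> sets (distr surface_measure surface_measure f)"
  then have A: "A \<in> sets sphere_borel" by (simp add: sets_surface_measure)
  then have A': "A \<in> sets borel" "A \<subseteq> unit_sphere" by (auto simp: sets_sphere_borel)
  have fA: "f -` A \<in> sets sphere_borel"
    using A' nrm measurable_sets_borel[of f borel A] by (auto simp: sets_sphere_borel)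
  have "emeasure (distr surface_measure surface_measure f) A = emeasure surface_measure (f -` A)"
    using A A'(2) nrm meas by (subst emeasure_distr) (auto simp: sets_surface_measure space_surface_measure intro!: arg_cong[where f="emeasure _"])
  also have "\<dots> = of_nat DIM('a) * emeasure lborel {x \<in> ball 0 1 - {0}. x /\<^sub>R norm x \<in> f -` A}"
    by (rule emeasure_surface_measure[OF fA])
  also have "{x \<in> ball 0 1 - {0}. x /\<^sub>R norm x \<in> f -` A} = f -` {x \<in> ball 0 1 - {0}. x /\<^sub>R norm x \<in> A}"
    using nrm linear_0[OF lin] by (auto simp: linear_scale[OF lin]) (metis norm_eq_zero)+
  also have "emeasure lborel \<dots> = emeasure (distr lborel borel f) {x \<in> ball 0 1 - {0}. x /\<^sub>R norm x \<in> A}"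
    by (subst emeasure_distr) (use cone_measurable[OF A'(1)] in auto)
  also have "\<dots> = emeasure lborel {x \<in> ball 0 1 - {0}. x /\<^sub>R norm x \<in> A}"
    by (simp add: distr_lborel_orthogonal[OF f])
  also have "of_nat DIM('a) * \<dots> = emeasure surface_measure A"
    by (rule emeasure_surface_measure[OF A, symmetric])
  finally show "emeasure (distr surface_measure surface_measure f) A = emeasure surface_measure A" .
qed simp

lemma nn_integral_surface_measure_orthogonal:
  fixes f :: "'a::euclidean_space \<Rightarrow> 'a"
  assumes f: "orthogonal_transformation f" and g: "g \<in> borel_measurable surface_measure"
  shows "(\<integral>\<^sup>+x. g (f x) \<partial>surface_measure) = (\<integral>\<^sup>+x. g x \<partial>surface_measure)"
proof -
  note meas = measurable_surface_measure_orthogonal[OF f]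
  have "(\<integral>\<^sup>+x. g (f x) \<partial>surface_measure) = (\<integral>\<^sup>+x. g x \<partial>distr surface_measure surface_measure f)"
    using meas g by (subst nn_integral_distr) auto
  then show ?thesis by (simp add: distr_surface_measure_orthogonal[OF f])
qed

section \<open>Caps of radius r have measure of order r^d\<close>

text \<open>About 1/r disjoint balls of radius r/8, strung along the ray through \<open>z\<close>,
  fit into the cone over the cap. Each has volume of order r^n, where n is the dimension of the
  space, which leaves r^(n-1) in total.\<close>

lemma emeasure_surface_measure_cap_ge:
  fixes z :: "'a::euclidean_space"
  assumes z: "z \<in> unit_sphere" and r: "0 < r" "r \<le> 1"
  shows "ennreal (DIM('a) * unit_ball_vol DIM('a) / (2 * 8 ^ DIM('a)) * r ^ (DIM('a) - 1))
    \<le> emeasure surface_measure (unit_sphere \<inter> ball z r)"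
proof -
  let ?n = "DIM('a)" and ?V = "unit_ball_vol (real DIM('a))"
  define J where "J = nat \<lfloor>1 / r\<rfloor>"
  \<comment> \<open>Centres at spacing r/4 make the balls disjoint. Starting at 1/2 keeps all norms
    above 3/8, so that normalising a point enlarges its deviation from the ray, which is below r/4,
    by a factor of at most 8/3 and keeps it below r.\<close>
  define s where "s j = 1 / 2 + real j * r / 4" for j
  let ?B = "\<lambda>j. ball (s j *\<^sub>R z) (r / 8)"
  let ?cone = "{x \<in> ball 0 1 - {0}. x /\<^sub>R norm x \<in> unit_sphere \<inter> ball z r}"
  have nz: "norm z = 1" using z by simp
  \<comment> \<open>Rounding 1/r down costs at most a factor 2, the source of the 2 in the
    denominator of the bound.\<close>
  have J: "real J \<le> 1 / r" "1 / (2 * r) \<le> real J"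
  proof -
    have "1 \<le> 1 / r" using r by simp
    then have f1: "1 \<le> \<lfloor>1 / r\<rfloor>" by (simp add: le_floor_iff)
    then have "(1::real) \<le> of_int \<lfloor>1 / r\<rfloor>" by simp
    moreover from f1 have "real J = of_int \<lfloor>1 / r\<rfloor>" unfolding J_def by (intro of_nat_nat) linarith
    ultimately have "real J \<le> 1 / r" "1 / r \<le> 2 * real J"
      using real_of_int_floor_add_one_gt[of "1 / r"] of_int_floor_le[of "1 / r"] by linarith+
    then show "real J \<le> 1 / r" "1 / (2 * r) \<le> real J" by (simp_all add: field_simps)
  qed
  have "(\<Union>j<J. ?B j) \<subseteq> ?cone"
  proof (rule UN_least)
    fix j assume "j \<in> {..<J}"
    then have "real j + 1 \<le> 1 / r" using J(1) by simp
    then have "(real j + 1) * r \<le> 1" using r by (simp add: field_simps)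
    then have sj: "1 / 2 \<le> s j" "s j \<le> 3 / 4 - r / 4" using r by (auto simp: s_def field_simps)
    show "?B j \<subseteq> ?cone"
    proof
      fix x assume "x \<in> ?B j"
      then have x: "norm (x - s j *\<^sub>R z) < r / 8" by (simp add: dist_norm norm_minus_commute)
      have "\<bar>norm x - norm (s j *\<^sub>R z)\<bar> < r / 8" using x norm_triangle_ineq3[of x "s j *\<^sub>R z"] by linarith
      then have ns: "\<bar>norm x - s j\<bar> < r / 8" using nz sj by simp
      then have xb: "3 / 8 < norm x" "norm x < 1" using ns sj r by linarith+
      have "norm (x - norm x *\<^sub>R z) \<le> norm (x - s j *\<^sub>R z) + norm ((s j - norm x) *\<^sub>R z)"
        using norm_triangle_ineq[of "x - s j *\<^sub>R z" "(s j - norm x) *\<^sub>R z"] by (simp add: algebra_simps)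
      also have "\<dots> = norm (x - s j *\<^sub>R z) + \<bar>norm x - s j\<bar>" by (simp add: nz abs_minus_commute)
      also have "\<dots> < r / 4" using x ns by linarith
      also have "r / 4 \<le> 3 / 8 * r" using r by simp
      also have "3 / 8 * r \<le> norm x * r" using xb r by (intro mult_right_mono) auto
      finally have "norm (x - norm x *\<^sub>R z) < norm x * r" .
      moreover have "x - norm x *\<^sub>R z = norm x *\<^sub>R (x /\<^sub>R norm x - z)"
        using xb(1) by (cases "x = 0") (auto simp: scaleR_diff_right)
      moreover have "0 < norm x" using xb by linarith
      ultimately have "norm (x /\<^sub>R norm x - z) < r"
        by (simp only: norm_scaleR abs_norm_cancel mult_less_cancel_left_pos)
      moreover have "x \<noteq> 0" using xb by auto
      ultimately show "x \<in> ?cone" using xb by (auto simp: dist_norm norm_minus_commute)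
    qed
  qed
  moreover have "disjoint_family_on ?B {..<J}"
  proof (unfold disjoint_family_on_def, safe)
    fix i j x assume ij: "i \<noteq> j" and x: "x \<in> ?B i" "x \<in> ?B j"
    have "dist (s i *\<^sub>R z) (s j *\<^sub>R z) = \<bar>s i - s j\<bar>"
      using nz by (simp add: dist_norm flip: scaleR_left_diff_distrib)
    also have "\<dots> = \<bar>real i - real j\<bar> * (r / 4)"
      using r by (simp add: s_def abs_mult flip: left_diff_distrib diff_divide_distrib)
    also have "\<dots> \<ge> 1 * (r / 4)" using ij r by (intro mult_right_mono) linarith+
    finally show "x \<in> {}" using x dist_triangle2[of "s i *\<^sub>R z" "s j *\<^sub>R z" x] r by (simp add: dist_commute)
  qed
  ultimately have "(\<Sum>j<J. emeasure lborel (?B j)) \<le> emeasure lborel ?cone"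
    using cone_measurable[of "unit_sphere \<inter> ball z r"] by (subst sum_emeasure) (auto intro!: emeasure_mono)
  also have "(\<Sum>j<J. emeasure lborel (?B j)) = ennreal (real J * (?V * (r / 8) ^ ?n))"
    using r by (simp add: emeasure_ball ennreal_of_nat_eq_real_of_nat ennreal_mult)
  finally have "of_nat ?n * ennreal (real J * (?V * (r / 8) ^ ?n)) \<le> of_nat ?n * emeasure lborel ?cone"
    by (intro mult_left_mono) auto
  also have "\<dots> = emeasure surface_measure (unit_sphere \<inter> ball z r)"
    by (rule emeasure_surface_measure[symmetric]) (auto simp: sets_sphere_borel)
  finally have "ennreal (?n * (real J * (?V * (r / 8) ^ ?n))) \<le> emeasure surface_measure (unit_sphere \<inter> ball z r)"
    using r by (simp add: ennreal_of_nat_eq_real_of_nat ennreal_mult)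
  moreover have "?n * ?V / (2 * 8 ^ ?n) * r ^ (?n - 1) \<le> ?n * (real J * (?V * (r / 8) ^ ?n))"
  proof -
    have "?n * ?V / (2 * 8 ^ ?n) * r ^ (?n - 1) = ?n * (1 / (2 * r) * (?V * (r / 8) ^ ?n))"
      using r power_minus_mult[of ?n r] by (simp add: field_simps power_divide)
    also have "\<dots> \<le> ?n * (real J * (?V * (r / 8) ^ ?n))"
      using J r by (intro mult_left_mono mult_right_mono) auto
    finally show ?thesis .
  qed
  ultimately show ?thesis by (meson ennreal_leI order_trans)
qed

text \<open>The cone over the cap is covered by at most 1/r + 1 balls of radius 2r centred at
  multiples of r on the ray: a point x of the cone is within r of |x| z, and |x| is within r of such
  a multiple.\<close>

lemma emeasure_surface_measure_cap_le:
  fixes z :: "'a::euclidean_space"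
  assumes z: "z \<in> unit_sphere" and r: "0 < r"
  shows "emeasure surface_measure (unit_sphere \<inter> ball z r)
    \<le> ennreal (DIM('a) * unit_ball_vol DIM('a) * 2 ^ (DIM('a) + 1) * r ^ (DIM('a) - 1))"
\<comment> \<open>The number of covering balls is below 2/r only for small r; for r >= 1 the measure
  of the whole sphere is already small enough.\<close>
proof (cases "r < 1")
  case False
  have "1 * 1 \<le> 2 ^ (DIM('a) + 1) * r ^ (DIM('a) - 1)"
    using False by (intro mult_mono one_le_power) auto
  then have "DIM('a) * unit_ball_vol DIM('a) * 1 \<le> DIM('a) * unit_ball_vol DIM('a) * (2 ^ (DIM('a) + 1) * r ^ (DIM('a) - 1))"
    by (intro mult_left_mono) auto
  then show ?thesis
    by (intro order_trans[OF emeasure_surface_measure_le ennreal_leI]) (simp add: mult.assoc)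
next
  case True
  let ?n = "DIM('a)" and ?V = "unit_ball_vol (real DIM('a))"
  define J where "J = nat \<lfloor>1 / r\<rfloor>"
  let ?B = "\<lambda>j. ball ((real j * r) *\<^sub>R z) (2 * r)"
  let ?cone = "{x \<in> ball 0 1 - {0}. x /\<^sub>R norm x \<in> unit_sphere \<inter> ball z r}"
  have nz: "norm z = 1" using z by simp
  have "?cone \<subseteq> (\<Union>j\<le>J. ?B j)"
  proof
    fix x assume "x \<in> ?cone"
    then have x: "x \<noteq> 0" "norm x < 1" "norm (x /\<^sub>R norm x - z) < r"
      by (auto simp: dist_norm norm_minus_commute)
    define j where "j = nat \<lfloor>norm x / r\<rfloor>"
    have j: "real j \<le> norm x / r" "norm x / r < real j + 1" using r by (auto simp: j_def)
    have "norm x / r \<le> 1 / r" using x r by (simp add: divide_right_mono)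
    then have jJ: "j \<le> J" by (simp add: j_def J_def nat_mono floor_mono)
    have "x - norm x *\<^sub>R z = norm x *\<^sub>R (x /\<^sub>R norm x - z)"
      using x(1) by (simp add: scaleR_diff_right)
    then have "norm (x - norm x *\<^sub>R z) = norm x * norm (x /\<^sub>R norm x - z)" by simp
    also have "\<dots> \<le> 1 * norm (x /\<^sub>R norm x - z)" using x by (intro mult_right_mono) auto
    finally have 1: "norm (x - norm x *\<^sub>R z) < r" using x by simp
    have "\<bar>norm x - real j * r\<bar> \<le> r" using j r by (simp add: field_simps abs_le_iff)
    then have "norm ((norm x - real j * r) *\<^sub>R z) \<le> r" using nz by simp
    then have "norm (x - (real j * r) *\<^sub>R z) < 2 * r"
      using 1 norm_triangle_ineq[of "x - norm x *\<^sub>R z" "(norm x - real j * r) *\<^sub>R z"]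
      by (simp add: algebra_simps)
    then show "x \<in> (\<Union>j\<le>J. ?B j)" using jJ by (auto simp: dist_norm norm_minus_commute)
  qed
  then have "emeasure lborel ?cone \<le> emeasure lborel (\<Union>j\<le>J. ?B j)"
    by (intro emeasure_mono) (auto intro!: sets.finite_UN)
  also have "\<dots> \<le> (\<Sum>j\<le>J. emeasure lborel (?B j))"
    by (rule emeasure_subadditive_finite) auto
  also have "\<dots> = ennreal ((real J + 1) * (?V * (2 * r) ^ ?n))"
    using r by (simp add: emeasure_ball ennreal_of_nat_eq_real_of_nat ennreal_mult ennreal_1[symmetric] add.commute del: ennreal_1)
  finally have "of_nat ?n * emeasure lborel ?cone \<le> of_nat ?n * ennreal ((real J + 1) * (?V * (2 * r) ^ ?n))"
    by (intro mult_left_mono) auto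
  then have "emeasure surface_measure (unit_sphere \<inter> ball z r) \<le> of_nat ?n * ennreal ((real J + 1) * (?V * (2 * r) ^ ?n))"
    by (subst emeasure_surface_measure) (auto simp: sets_sphere_borel)
  also have "\<dots> = ennreal (?n * ((real J + 1) * (?V * (2 * r) ^ ?n)))"
    using r by (simp add: ennreal_of_nat_eq_real_of_nat ennreal_mult)
  also have "\<dots> \<le> ennreal (?n * ?V * 2 ^ (?n + 1) * r ^ (?n - 1))"
  proof (rule ennreal_leI)
    have "real J \<le> 1 / r" using r by (simp add: J_def)
    then have "real J + 1 \<le> 2 / r" using r True by (simp add: field_simps)
    then have "?n * ((real J + 1) * (?V * (2 * r) ^ ?n)) \<le> ?n * (2 / r * (?V * (2 * r) ^ ?n))"
      using r by (intro mult_left_mono mult_right_mono) auto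
    also have "\<dots> = ?n * ?V * 2 ^ (?n + 1) * r ^ (?n - 1)"
      using r power_minus_mult[of ?n r] by (simp add: field_simps power_mult_distrib)
    finally show "?n * ((real J + 1) * (?V * (2 * r) ^ ?n)) \<le> ?n * ?V * 2 ^ (?n + 1) * r ^ (?n - 1)" .
  qed
  finally show ?thesis .
qed

section \<open>Trigonometric polynomials\<close>

lemma one_minus_cos_le: "1 - cos t \<le> t\<^sup>2 / 2" for t :: real
  using cos_double_sin[of "t / 2"] abs_sin_x_le_abs_x[of "t / 2"] abs_le_square_iff[of "2 * sin (t / 2)" t]
  by (simp add: power_mult_distrib abs_mult)

definition dirichlet :: "nat \<Rightarrow> real \<Rightarrow> complex" where
  "dirichlet N u = (\<Sum>k\<in>{-int N..int N}. cis (of_int k * u))"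

lemma symmetric_int_interval_Suc:
  "{-int (Suc N)..int (Suc N)} = insert (int (Suc N)) (insert (-int (Suc N)) {-int N..int N})"
  by auto

text \<open>The geometric sum with its denominator multiplied out, so that nothing has to be
  excluded at multiples of 2 pi.\<close>

lemma dirichlet_telescope:
  "(cis u - 1) * dirichlet N u = cis ((real N + 1) * u) - cis (- real N * u)"
proof (induction N)
  case (Suc N)
  have "dirichlet (Suc N) u = cis ((real N + 1) * u) + (cis (- (real N + 1) * u) + dirichlet N u)"
    unfolding dirichlet_def symmetric_int_interval_Suc by (simp add: algebra_simps)
  then have "(cis u - 1) * dirichlet (Suc N) u =
      cis u * cis ((real N + 1) * u) - cis ((real N + 1) * u) +
      (cis u * cis (- (real N + 1) * u) - cis (- (real N + 1) * u)) + (cis u - 1) * dirichlet N u"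
    by (simp add: algebra_simps)
  also have "\<dots> = cis ((real (Suc N) + 1) * u) - cis (- real (Suc N) * u)"
    unfolding Suc.IH cis_mult by (simp add: algebra_simps)
  finally show ?case .
qed (simp add: dirichlet_def algebra_simps)

lemma norm_dirichlet_le: "norm (dirichlet N u) \<le> 2 * real N + 1"
proof -
  have "norm (dirichlet N u) \<le> (\<Sum>k\<in>{-int N..int N}. 1)"
    unfolding dirichlet_def by (rule sum_norm_le) simp
  then show ?thesis by simp
qed

lemma norm_dirichlet_sin_le: "norm (dirichlet N u) * \<bar>sin (u / 2)\<bar> \<le> 1"
proof -
  have "2 * (norm (dirichlet N u) * \<bar>sin (u / 2)\<bar>) = norm ((cis u - 1) * dirichlet N u)"
    using dist_exp_i_1[of u] by (simp add: norm_mult cis_conv_exp mult.commute)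
  also have "\<dots> \<le> 2"
    unfolding dirichlet_telescope by (rule order_trans[OF norm_triangle_ineq4]) simp
  finally show ?thesis by simp
qed

definition trig_polynomial :: "nat \<Rightarrow> (real \<Rightarrow> complex) \<Rightarrow> bool" where
  "trig_polynomial m q \<longleftrightarrow> (\<exists>c. \<forall>t. q t = (\<Sum>k\<in>{-int m..int m}. c k * cis (of_int k * t)))"

text \<open>Orthogonality of characters: the sum runs over the k-th powers of all (2M+1)-th roots of
  unity. The telescoped form vanishes at this angle, and the bound on k excludes nonzero multiples
  of 2M + 1.\<close>

lemma dirichlet_roots_of_unity:
  assumes "\<bar>k\<bar> \<le> 2 * int M"
  shows "dirichlet M (of_int k * (2 * pi / (2 * real M + 1))) = (if k = 0 then of_nat (2 * M + 1) else 0)"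
proof (cases "k = 0")
  case False
  define u where "u = of_int k * (2 * pi / (2 * real M + 1))"
  have "(real M + 1) * u = - real M * u + (2 * real M + 1) * u" by (simp add: algebra_simps)
  also have "(2 * real M + 1) * u = 2 * pi * of_int k" by (simp add: u_def)
  finally have e: "(real M + 1) * u = - real M * u + 2 * pi * of_int k" .
  have "cis ((real M + 1) * u) = cis (- real M * u)"
    unfolding e cis_mult[symmetric] by (simp add: cis_multiple_2pi)
  then have "(cis u - 1) * dirichlet M u = 0" by (simp add: dirichlet_telescope)
  moreover have "cis u \<noteq> 1"
  proof
    assume "cis u = 1"
    then obtain n :: int where "u = 2 * pi * of_int n"
      by (auto simp: complex_eq_iff cos_one_2pi_int)
    then have "2 * pi * of_int k = 2 * pi * (of_int n * (2 * real M + 1))"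
      by (simp add: u_def field_simps)
    then have "of_int k = of_int n * (2 * real M + 1)" by simp
    then have "k = n * (2 * int M + 1)"
      by (metis (mono_tags, opaque_lifting) of_int_1 of_int_add of_int_eq_iff of_int_mult of_int_numeral of_int_of_nat_eq)
    moreover from this have "n \<noteq> 0" using False by auto
    ultimately have "\<bar>k\<bar> \<ge> 1 * (2 * int M + 1)"
      by (simp only: abs_mult) (intro mult_mono, auto)
    then show False using assms by simp
  qed
  ultimately show ?thesis using False by (simp add: u_def)
qed (simp add: dirichlet_def)

text \<open>
  Interpolation of \<open>q(t) e\<^sup>-\<^sup>i\<^sup>a\<^sup>t\<close> at \<open>4 * L + 1\<close> nodes, averaged over
  \<open>\<bar>a\<bar> \<le> L\<close>; averaging makes the kernel decay quadratically.
\<close>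

lemma trig_polynomial_reproducing:
  assumes q: "trig_polynomial L q"
  defines "\<tau> \<equiv> \<lambda>j::int. of_int j * (2 * pi / (4 * real L + 1))"
  shows "(\<Sum>j\<in>{-int (2*L)..int (2*L)}. q (\<tau> j) * (dirichlet L (t - \<tau> j) * dirichlet (2*L) (t - \<tau> j)))
    = (2 * of_nat L + 1) * (4 * of_nat L + 1) * q t"
proof -
  let ?J = "{-int (2*L)..int (2*L)}" and ?I = "{-int L..int L}"
  define h where "h = 2 * pi / (4 * real L + 1)"
  have h_eq: "2 * pi / (4 * real L + 1) = h" by (simp add: h_def)
  have base: "(\<Sum>j\<in>?J. cis (of_int k * \<tau> j) * (dirichlet L (t - \<tau> j) * dirichlet (2*L) (t - \<tau> j)))
    = (2 * of_nat L + 1) * (4 * of_nat L + 1) * cis (of_int k * t)" if k: "k \<in> ?I" for k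
  proof -
    have "(\<Sum>j\<in>?J. cis (of_int k * \<tau> j) * (dirichlet L (t - \<tau> j) * dirichlet (2*L) (t - \<tau> j)))
      = (\<Sum>j\<in>?J. \<Sum>a\<in>?I. \<Sum>b\<in>?J. cis (of_int (a + b) * t) * cis (of_int j * (of_int (k - a - b) * (2 * pi / (4 * real L + 1)))))"
      unfolding dirichlet_def sum_product
      unfolding sum_distrib_left cis_mult
      by (intro sum.cong refl arg_cong[where f=cis]) (simp add: \<tau>_def h_eq del: times_divide_eq_right, simp add: algebra_simps)
    also have "\<dots> = (\<Sum>a\<in>?I. \<Sum>b\<in>?J. \<Sum>j\<in>?J. cis (of_int (a + b) * t) * cis (of_int j * (of_int (k - a - b) * (2 * pi / (4 * real L + 1)))))"
      by (subst sum.swap, intro sum.cong refl sum.swap)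
    also have "\<dots> = (\<Sum>a\<in>?I. \<Sum>b\<in>?J. if b = k - a then (4 * of_nat L + 1) * cis (of_int k * t) else 0)"
    proof (intro sum.cong refl)
      fix a b assume "a \<in> ?I" "b \<in> ?J"
      \<comment> \<open>The frequencies k, a, b have sizes at most L, L, 2L, so their combination is
        at most 4L: this is why 4L + 1 nodes are used.\<close>
      then have "\<bar>k - a - b\<bar> \<le> 2 * int (2 * L)" using k by auto
      note root = dirichlet_roots_of_unity[OF this]
      show "(\<Sum>j\<in>?J. cis (of_int (a + b) * t) * cis (of_int j * (of_int (k - a - b) * (2 * pi / (4 * real L + 1)))))
        = (if b = k - a then (4 * of_nat L + 1) * cis (of_int k * t) else 0)"
        using root unfolding dirichlet_def sum_distrib_left[symmetric] by (auto simp: algebra_simps)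
    qed
    \<comment> \<open>For every \<open>a\<close> the index \<open>k - a\<close> is at most 2L in
      absolute value and so does occur among the \<open>b\<close>; this is why the second kernel has
      degree 2L.\<close>
    also have "\<dots> = (\<Sum>a\<in>?I. (4 * of_nat L + 1) * cis (of_int k * t))"
      using k by (intro sum.cong refl) (auto simp: sum.delta)
    also have "\<dots> = (2 * of_nat L + 1) * (4 * of_nat L + 1) * cis (of_int k * t)"
      by (simp add: algebra_simps)
    finally show ?thesis .
  qed
  from q obtain c where c: "\<And>t. q t = (\<Sum>k\<in>?I. c k * cis (of_int k * t))"
    by (auto simp: trig_polynomial_def)
  have "(\<Sum>j\<in>?J. q (\<tau> j) * (dirichlet L (t - \<tau> j) * dirichlet (2*L) (t - \<tau> j)))
    = (\<Sum>k\<in>?I. c k * (\<Sum>j\<in>?J. cis (of_int k * \<tau> j) * (dirichlet L (t - \<tau> j) * dirichlet (2*L) (t - \<tau> j))))"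
    unfolding c sum_distrib_right sum_distrib_left by (subst sum.swap) (simp add: mult.assoc)
  also have "\<dots> = (\<Sum>k\<in>?I. c k * ((2 * of_nat L + 1) * (4 * of_nat L + 1) * cis (of_int k * t)))"
    by (rule sum.cong[OF refl]) (simp only: base)
  also have "\<dots> = (2 * of_nat L + 1) * (4 * of_nat L + 1) * q t"
    unfolding c sum_distrib_left by (simp add: mult_ac)
  finally show ?thesis .
qed

section \<open>Pointwise bounds by weighted sums over the nodes\<close>

definition node :: "nat \<Rightarrow> int \<Rightarrow> real" where
  "node L j = of_int j * (2 * pi / (4 * real L + 1))"

text \<open>Majorant of the product of the two kernels at the j-th node, after division by the peak
  value (2L+1)(4L+1). It is free of L and summable.\<close>

definition weight :: "int \<Rightarrow> real" where
  "weight j = (if j = 0 then 1 else 2 / (of_int j)\<^sup>2)"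

lemma weight_nonneg: "0 \<le> weight j"
  by (simp add: weight_def)

text \<open>The term 8/(M+1) makes the bound inductive: two new weights add 4/(M+1)^2, which is at
  most 8/(M+1) - 8/(M+2). For M = 0 there is equality.\<close>

lemma sum_weight_le: "(\<Sum>j\<in>{-int M..int M}. weight j) \<le> 9 - 8 / (real M + 1)"
proof (induction M)
  case (Suc M)
  have "(\<Sum>j\<in>{-int (Suc M)..int (Suc M)}. weight j) = 4 / (real M + 1)\<^sup>2 + (\<Sum>j\<in>{-int M..int M}. weight j)"
    unfolding symmetric_int_interval_Suc
    by (simp add: weight_def power2_eq_square algebra_simps)
  also have "\<dots> \<le> 4 / (real M + 1)\<^sup>2 + (9 - 8 / (real M + 1))"
    using Suc.IH by simp
  also have "4 / (real M + 1)\<^sup>2 = 4 / (real M + 1) * (1 / (real M + 1))"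
    by (simp add: power2_eq_square)
  also have "\<dots> \<le> 4 / (real M + 1) * (2 / (real M + 2))"
    by (intro mult_left_mono) (auto simp: field_simps)
  also have "\<dots> = 8 / (real M + 1) - 8 / (real M + 2)"
    by (simp add: field_simps)
  finally show ?case by (simp add: algebra_simps)
qed (simp add: weight_def)

lemma sum_weight_ge: "1 \<le> (\<Sum>j\<in>{-int M..int M}. weight j)"
proof -
  have "weight 0 \<le> (\<Sum>j\<in>{-int M..int M}. weight j)"
    by (rule member_le_sum) (auto simp: weight_nonneg)
  then show ?thesis by (simp add: weight_def)
qed

text \<open>Jordan's inequality: the concave sine lies above its chord on [0, pi/2].\<close>

lemma abs_sin_half_ge:
  assumes "\<bar>u\<bar> \<le> pi" shows "\<bar>u\<bar> / pi \<le> \<bar>sin (u / 2)\<bar>"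
proof -
  have "(2 / pi) * (\<bar>u\<bar> / 2) \<le> sin (\<bar>u\<bar> / 2)"
  proof -
    have cc: "concave_on {0..pi/2} sin"
      by (rule f''_le0_imp_concave[where f'="cos" and f''="\<lambda>x. - sin x"])
         (auto intro!: derivative_eq_intros sin_ge_zero)
    have "(1 - \<bar>u\<bar> / pi) * sin 0 + (\<bar>u\<bar> / pi) * sin (pi / 2) \<le> sin ((1 - \<bar>u\<bar> / pi) *\<^sub>R 0 + (\<bar>u\<bar> / pi) *\<^sub>R (pi / 2))"
      using assms by (intro concave_onD[OF cc]) (auto simp: field_simps)
    then show ?thesis by simp
  qed
  moreover have "sin (\<bar>u\<bar> / 2) \<le> \<bar>sin (u / 2)\<bar>"
    by (cases "u \<ge> 0") (auto simp: abs_if)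
  ultimately show ?thesis by simp
qed

text \<open>The angle \<open>t\<close> lies within half a node spacing of node 0. Hence the distance
  to node j is between |j| pi/(4L+1) and pi, there is no wrap-around, and Jordan's inequality bounds
  each of the two kernels by (4L+1)/|j|.\<close>

lemma norm_dirichlet_node_le:
  assumes t: "\<bar>t\<bar> \<le> pi / (4 * real L + 1)" and j: "j \<in> {-int (2*L)..int (2*L)}"
  shows "norm (dirichlet L (t - node L j) * dirichlet (2*L) (t - node L j))
    \<le> (2 * real L + 1) * (4 * real L + 1) * weight j"
proof (cases "j = 0")
  case True
  have "norm (dirichlet L (t - node L j)) * norm (dirichlet (2*L) (t - node L j)) \<le> (2 * real L + 1) * (4 * real L + 1)"
    using norm_dirichlet_le[of "2*L"] norm_dirichlet_le[of L] by (intro mult_mono) auto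
  then show ?thesis using True by (simp add: norm_mult weight_def)
next
  case False
  let ?N = "4 * real L + 1" and ?u = "t - node L j"
  have j1: "1 \<le> \<bar>of_int j :: real\<bar>" "\<bar>of_int j :: real\<bar> \<le> 2 * real L"
    using False j of_int_le_iff[of 1 "\<bar>j\<bar>", where 'a=real] of_int_le_iff[of "\<bar>j\<bar>" "2 * int L", where 'a=real]
    by auto
  have nn: "\<bar>node L j\<bar> = 2 * \<bar>of_int j\<bar> * pi / ?N" by (simp add: node_def abs_mult)
  have tri: "\<bar>node L j\<bar> - \<bar>t\<bar> \<le> \<bar>?u\<bar>" "\<bar>?u\<bar> \<le> \<bar>node L j\<bar> + \<bar>t\<bar>" by linarith+
  have "\<bar>?u\<bar> \<ge> 2 * \<bar>of_int j\<bar> * pi / ?N - pi / ?N" using t tri unfolding nn by (intro order_trans[OF diff_left_mono tri(1)[unfolded nn]])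
  also have "2 * \<bar>of_int j\<bar> * pi / ?N - pi / ?N = (2 * \<bar>of_int j\<bar> - 1) * (pi / ?N)" by (simp add: left_diff_distrib diff_divide_distrib)
  also have "\<dots> \<ge> \<bar>of_int j\<bar> * (pi / ?N)" using j1 by (intro mult_right_mono) auto
  finally have 1: "\<bar>of_int j\<bar> * (pi / ?N) \<le> \<bar>?u\<bar>" .
  have "\<bar>?u\<bar> \<le> 2 * \<bar>of_int j\<bar> * pi / ?N + pi / ?N" using t tri unfolding nn by (intro order_trans[OF tri(2)[unfolded nn]] add_left_mono)
  also have "\<dots> = (2 * \<bar>of_int j\<bar> + 1) * (pi / ?N)" by (simp add: distrib_right add_divide_distrib)
  also have "\<dots> \<le> ?N * (pi / ?N)" using j1 by (intro mult_right_mono) auto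
  finally have 2: "\<bar>?u\<bar> \<le> pi" by simp
  have "\<bar>of_int j\<bar> / ?N = \<bar>of_int j\<bar> * (pi / ?N) / pi" by simp
  also have "\<dots> \<le> \<bar>?u\<bar> / pi" using 1 by (intro divide_right_mono) auto
  also have "\<dots> \<le> \<bar>sin (?u / 2)\<bar>" by (rule abs_sin_half_ge[OF 2])
  finally have s: "\<bar>of_int j\<bar> / ?N \<le> \<bar>sin (?u / 2)\<bar>" .
  have bd: "norm (dirichlet M ?u) \<le> ?N / \<bar>of_int j\<bar>" for M
  proof -
    have "norm (dirichlet M ?u) * (\<bar>of_int j\<bar> / ?N) \<le> norm (dirichlet M ?u) * \<bar>sin (?u / 2)\<bar>"
      using s by (intro mult_left_mono) auto
    also have "\<dots> \<le> 1" by (rule norm_dirichlet_sin_le)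
    finally show ?thesis using j1 by (simp add: field_simps)
  qed
  have "norm (dirichlet L ?u) * norm (dirichlet (2*L) ?u) \<le> (?N / \<bar>of_int j\<bar>) * (?N / \<bar>of_int j\<bar>)"
    by (intro mult_mono bd) auto
  also have "\<dots> = ?N * ?N / (of_int j)\<^sup>2" by (simp add: power2_eq_square)
  \<comment> \<open>One factor 4L + 1 is enlarged to 2 (2L + 1) to match the normalisation; this
    produces the 2 in \<open>weight\<close>.\<close>
  also have "\<dots> \<le> ((4 * real L + 2) * ?N) / (of_int j)\<^sup>2" by (intro divide_right_mono mult_right_mono) auto
  also have "\<dots> = (2 * real L + 1) * ?N * weight j" using False by (simp add: weight_def algebra_simps add_divide_distrib)
  finally show ?thesis by (simp add: norm_mult)
qed

lemma norm_trig_polynomial_le: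
  assumes q: "trig_polynomial L q" and t: "\<bar>t\<bar> \<le> pi / (4 * real L + 1)"
  shows "norm (q t) \<le> (\<Sum>j\<in>{-int (2*L)..int (2*L)}. weight j * norm (q (node L j)))"
proof -
  let ?K = "(2 * real L + 1) * (4 * real L + 1)" and ?J = "{-int (2*L)..int (2*L)}"
  have "norm ((2 * of_nat L + 1) * (4 * of_nat L + 1) * q t) = ?K * norm (q t)"
  proof -
    have "(2 * of_nat L + 1) * (4 * of_nat L + 1) = (of_real ?K :: complex)" by simp
    then show ?thesis by (simp add: norm_mult del: of_real_mult of_real_add)
  qed
  then have "?K * norm (q t) = norm (\<Sum>j\<in>?J. q (node L j) * (dirichlet L (t - node L j) * dirichlet (2*L) (t - node L j)))"
    using trig_polynomial_reproducing[OF q, of t] by (simp add: node_def)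
  also have "\<dots> \<le> (\<Sum>j\<in>?J. norm (q (node L j)) * (?K * weight j))"
    using norm_dirichlet_node_le[OF t]
    by (intro sum_norm_le) (subst norm_mult, intro mult_left_mono, auto)
  also have "\<dots> = ?K * (\<Sum>j\<in>?J. weight j * norm (q (node L j)))"
    by (simp add: sum_distrib_left mult_ac)
  finally show ?thesis by simp
qed

text \<open>Moduli of polynomials may vanish, so 0 has to belong to the domain. There convexity
  reduces to \<open>v powr p \<le> v\<close> for v in [0, 1].\<close>

lemma convex_on_powr_nonneg:
  assumes "1 \<le> p" shows "convex_on {0::real..} (\<lambda>x. x powr p)"
proof (rule convex_onI)
  have le: "(v * y) powr p \<le> v * y powr p" if "0 \<le> v" "v \<le> 1" "0 \<le> y" for v y :: real
  proof -
    have "v powr p \<le> v"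
      using that assms powr_mono'[of 1 p v] by (cases "v = 0") auto
    then show ?thesis using that by (simp add: powr_mult mult_right_mono)
  qed
  fix t x y :: real assume h: "0 < t" "t < 1" "x \<in> {0..}" "y \<in> {0..}"
  consider "x = 0" | "y = 0" | "0 < x" "0 < y" using h by fastforce
  then show "((1 - t) *\<^sub>R x + t *\<^sub>R y) powr p \<le> (1 - t) * x powr p + t * y powr p"
  proof cases
    case 3
    then show ?thesis using convex_onD[OF powr_convex[OF assms], of t x y] h by simp
  qed (use h le[of t y] le[of "1 - t" x] in auto)
qed simp

text \<open>Jensen's inequality for the weights divided by their sum W. The bound W <= 9 controls
  the factor in front, and W >= 1 allows the division to be dropped afterwards.\<close>

lemma norm_trig_polynomial_powr_le:
  assumes p: "1 \<le> p" and q: "trig_polynomial L q" and t: "\<bar>t\<bar> \<le> pi / (4 * real L + 1)"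
  shows "norm (q t) powr p \<le> 9 powr p * (\<Sum>j\<in>{-int (2*L)..int (2*L)}. weight j * norm (q (node L j)) powr p)"
proof -
  let ?J = "{-int (2*L)..int (2*L)}"
  define W where "W = (\<Sum>j\<in>?J. weight j)"
  have W: "1 \<le> W" "W \<le> 9"
    using sum_weight_ge[of "2*L"] sum_weight_le[of "2*L"] unfolding W_def by (auto intro: order_trans)
  have "norm (q t) \<le> W * (\<Sum>j\<in>?J. (weight j / W) * norm (q (node L j)))"
    using norm_trig_polynomial_le[OF q t] W by (simp add: sum_distrib_left)
  then have "norm (q t) powr p \<le> (W * (\<Sum>j\<in>?J. (weight j / W) * norm (q (node L j)))) powr p"
    using p by (intro powr_mono2) auto
  also have "\<dots> = W powr p * (\<Sum>j\<in>?J. (weight j / W) *\<^sub>R norm (q (node L j))) powr p"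
    using W by (simp add: powr_mult sum_nonneg weight_nonneg)
  also have "\<dots> \<le> W powr p * (\<Sum>j\<in>?J. (weight j / W) * norm (q (node L j)) powr p)"
  proof (intro mult_left_mono)
    show "(\<Sum>j\<in>?J. (weight j / W) *\<^sub>R norm (q (node L j))) powr p \<le> (\<Sum>j\<in>?J. (weight j / W) * norm (q (node L j)) powr p)"
    proof (rule convex_on_sum[where C = "{0..}" and f = "\<lambda>x. x powr p"])
      show "convex_on {0..} (\<lambda>x. x powr p)" using p by (rule convex_on_powr_nonneg)
      show "(\<Sum>j\<in>?J. weight j / W) = 1" using W by (simp add: W_def flip: sum_divide_distrib)
    qed (use W weight_nonneg in auto)
  qed auto
  also have "\<dots> \<le> 9 powr p * (\<Sum>j\<in>?J. weight j * norm (q (node L j)) powr p)"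
  proof (intro mult_mono sum_mono mult_right_mono)
    show "W powr p \<le> 9 powr p" using W p by (intro powr_mono2) auto
    show "weight j / W \<le> weight j" for j
      using W weight_nonneg[of j] mult_left_mono[of 1 W "weight j"] by (simp add: divide_le_eq)
  qed (use W weight_nonneg in \<open>auto intro!: sum_nonneg\<close>)
  finally show ?thesis .
qed

section \<open>Polynomials and spherical harmonics\<close>

text \<open>Polynomials are generated by linear forms instead of monomials: no coordinates are
  singled out, and composition with linear maps, directional derivatives and restriction to
  rotations are inductions over three rules. The zero function has every degree.\<close>

inductive hpoly :: "nat \<Rightarrow> ('a::euclidean_space \<Rightarrow> complex) \<Rightarrow> bool" where
  hpoly_const: "hpoly 0 (\<lambda>x. c)"
| hpoly_inner: "hpoly m f \<Longrightarrow> hpoly (Suc m) (\<lambda>x. of_real (x \<bullet> v) * f x)"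
| hpoly_add: "hpoly m f \<Longrightarrow> hpoly m g \<Longrightarrow> hpoly m (\<lambda>x. f x + g x)"

inductive poly_le :: "nat \<Rightarrow> ('a::euclidean_space \<Rightarrow> complex) \<Rightarrow> bool" where
  poly_le_const: "poly_le m (\<lambda>x. c)"
| poly_le_inner: "poly_le m f \<Longrightarrow> poly_le (Suc m) (\<lambda>x. of_real (x \<bullet> v) * f x)"
| poly_le_add: "poly_le m f \<Longrightarrow> poly_le m g \<Longrightarrow> poly_le m (\<lambda>x. f x + g x)"

lemma hpoly_cmult: "hpoly m f \<Longrightarrow> hpoly m (\<lambda>x. c * f x)"
proof (induction rule: hpoly.induct)
  case (hpoly_inner m f v)
  then show ?case using hpoly.hpoly_inner[of m "\<lambda>x. c * f x" v] by (simp add: mult.left_commute)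
qed (auto simp: distrib_left intro: hpoly.intros)

lemma hpoly_zero: "hpoly m (\<lambda>x. 0)"
proof (induction m)
  case (Suc m)
  then show ?case using hpoly_inner[of m "\<lambda>x. 0" 0] by simp
qed (rule hpoly_const)

lemma hpoly_sum: "(\<And>i. i \<in> I \<Longrightarrow> hpoly m (f i)) \<Longrightarrow> hpoly m (\<lambda>x. \<Sum>i\<in>I. f i x)"
  by (induction I rule: infinite_finite_induct) (auto intro: hpoly_zero hpoly_add)

lemma hpoly_scaleR: "hpoly m f \<Longrightarrow> f (t *\<^sub>R x) = of_real (t ^ m) * f x"
  by (induction rule: hpoly.induct) (auto simp: algebra_simps)

lemma poly_le_cmult: "poly_le m f \<Longrightarrow> poly_le m (\<lambda>x. c * f x)"
proof (induction rule: poly_le.induct)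
  case (poly_le_inner m f v)
  then show ?case using poly_le.poly_le_inner[of m "\<lambda>x. c * f x" v] by (simp add: mult.left_commute)
qed (auto simp: distrib_left intro: poly_le.intros)

lemma poly_le_Suc: "poly_le m f \<Longrightarrow> poly_le (Suc m) f"
  by (induction rule: poly_le.induct) (auto intro: poly_le.intros)

lemma poly_le_mono: "poly_le m f \<Longrightarrow> m \<le> k \<Longrightarrow> poly_le k f"
  by (induction k) (auto simp: le_Suc_eq intro: poly_le_Suc)

lemma poly_le_mult: "poly_le m f \<Longrightarrow> poly_le k g \<Longrightarrow> poly_le (m + k) (\<lambda>x. f x * g x)"
proof (induction arbitrary: g rule: poly_le.induct)
  case (poly_le_const m c)
  then show ?case by (intro poly_le_cmult) (auto intro: poly_le_mono)
next
  case (poly_le_inner m f v)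
  then show ?case using poly_le.poly_le_inner[of "m + k" "\<lambda>x. f x * g x" v] by (simp add: mult.assoc)
qed (auto simp: distrib_right intro: poly_le_add)

lemma poly_le_prod: "(\<And>i. i \<in> I \<Longrightarrow> poly_le (m i) (f i)) \<Longrightarrow> poly_le (\<Sum>i\<in>I. m i) (\<lambda>x. \<Prod>i\<in>I. f i x)"
  by (induction I rule: infinite_finite_induct) (auto intro: poly_le_mult poly_le_const)

lemma poly_le_power: "poly_le m f \<Longrightarrow> poly_le (k * m) (\<lambda>x. f x ^ k)"
  by (induction k) (auto intro: poly_le_mult poly_le_const)

lemma poly_le_inner_const: "poly_le 1 (\<lambda>x. of_real (x \<bullet> v))"
  using poly_le_inner[OF poly_le_const[of 0 1], of v] by simp

text \<open>The adjoint moves \<open>R\<close> onto the vector of each linear factor, so the degree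
  does not change.\<close>

lemma poly_le_linear:
  assumes "linear R" shows "poly_le m f \<Longrightarrow> poly_le m (\<lambda>x. f (R x))"
proof (induction rule: poly_le.induct)
  case (poly_le_inner m f v)
  then show ?case
    using poly_le.poly_le_inner[of m "\<lambda>x. f (R x)" "adjoint R v"] by (simp add: adjoint_works[OF assms])
qed (auto intro: poly_le.intros)

lemma poly_le_continuous: "poly_le m f \<Longrightarrow> continuous_on UNIV f"
  by (induction rule: poly_le.induct) (auto intro!: continuous_intros)

lemma hpoly_imp_poly_le: "hpoly m f \<Longrightarrow> poly_le m f"
  by (induction rule: hpoly.induct) (auto intro: poly_le.intros)

lemma poly_le_decomposition:
  assumes "poly_le L f"
  shows "\<exists>h. (\<forall>l\<le>L. hpoly l (h l)) \<and> f = (\<lambda>x. \<Sum>l\<le>L. h l x)"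
  using assms
proof (induction rule: poly_le.induct)
  case (poly_le_const m c)
  show ?case
    by (rule exI[of _ "\<lambda>l x. if l = 0 then c else 0"]) (auto simp: hpoly_const hpoly_zero)
next
  case (poly_le_inner m f v)
  then obtain h where h: "\<And>l. l \<le> m \<Longrightarrow> hpoly l (h l)" "f = (\<lambda>x. \<Sum>l\<le>m. h l x)" by blast
  \<comment> \<open>Multiplication by a linear form raises the degree of each homogeneous component
    by one and leaves degree 0 empty.\<close>
  let ?h = "\<lambda>l. case l of 0 \<Rightarrow> (\<lambda>x. 0) | Suc k \<Rightarrow> (\<lambda>x. of_real (x \<bullet> v) * h k x)"
  show ?case
  proof (intro exI[of _ ?h] conjI allI impI)
    show "hpoly l (?h l)" if "l \<le> Suc m" for l
      using that by (cases l) (auto intro: hpoly_const hpoly_inner h(1))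
    show "(\<lambda>x. of_real (x \<bullet> v) * f x) = (\<lambda>x. \<Sum>l\<le>Suc m. ?h l x)"
      by (subst sum.atMost_Suc_shift) (simp add: h(2) sum_distrib_left)
  qed
next
  case (poly_le_add m f g)
  then obtain h k where "\<And>l. l \<le> m \<Longrightarrow> hpoly l (h l)" "f = (\<lambda>x. \<Sum>l\<le>m. h l x)"
    "\<And>l. l \<le> m \<Longrightarrow> hpoly l (k l)" "g = (\<lambda>x. \<Sum>l\<le>m. k l x)" by blast
  then show ?case
    by (intro exI[of _ "\<lambda>l x. h l x + k l x"]) (auto intro: hpoly_add simp: sum.distrib)
qed

lemma polynomial_function_hpoly: "hpoly m f \<Longrightarrow> polynomial_function f"
proof (induction rule: hpoly.induct)
  case (hpoly_inner m f v)
  have "polynomial_function (\<lambda>x::'a. x \<bullet> v)"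
    by (intro polynomial_function_bounded_linear bounded_linear_inner_left)
  then show ?case
    using polynomial_function_mult[OF _ hpoly_inner.IH] by (simp add: scaleR_conv_of_real)
qed auto

lemma real_polynomial_function_poly_le:
  fixes r :: "'a::euclidean_space \<Rightarrow> real"
  assumes "real_polynomial_function r" shows "\<exists>M. poly_le M (\<lambda>x. of_real (r x))"
  using assms
proof (induction rule: real_polynomial_function.induct)
  case (linear h)
  then have "h x = x \<bullet> adjoint h 1" for x
    by (simp add: adjoint_works bounded_linear.linear)
  then show ?case using poly_le_inner_const[of "adjoint h 1"] by auto
next
  case (add f g)
  then obtain M K where "poly_le M (\<lambda>x. of_real (f x))" "poly_le K (\<lambda>x. of_real (g x))" by blast
  then have "poly_le (max M K) (\<lambda>x. of_real (f x))" "poly_le (max M K) (\<lambda>x. of_real (g x))"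
    by (auto elim: poly_le_mono)
  then show ?case by (auto dest: poly_le_add)
next
  case (mult f g)
  then show ?case by (auto dest: poly_le_mult)
qed (auto intro: poly_le_const)

lemma polynomial_function_poly_le:
  fixes f :: "'a::euclidean_space \<Rightarrow> complex"
  assumes "polynomial_function f" shows "\<exists>M. poly_le M f"
proof -
  have "real_polynomial_function (Re \<circ> f)" "real_polynomial_function (Im \<circ> f)"
    using assms bounded_linear_Re bounded_linear_Im by (auto simp: polynomial_function_def)
  then obtain M K where "poly_le M (\<lambda>x. of_real (Re (f x)))" "poly_le K (\<lambda>x. of_real (Im (f x)))"
    using real_polynomial_function_poly_le[of "Re \<circ> f"] real_polynomial_function_poly_le[of "Im \<circ> f"] by auto
  then have "poly_le (max M K) (\<lambda>x. of_real (Re (f x)) + \<i> * of_real (Im (f x)))"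
    by (intro poly_le_add poly_le_cmult) (auto elim: poly_le_mono)
  then show ?thesis by (auto simp flip: complex_eq)
qed

text \<open>For fixed x both sides of the scaling law are polynomials in t. They agree for
  infinitely many t, so their coefficients agree, and only the component of degree \<open>l\<close>
  survives.\<close>

lemma homogeneous_polynomial_hpoly:
  fixes f :: "'a::euclidean_space \<Rightarrow> complex"
  assumes f: "polynomial_function f" and hom: "\<And>t x. f (t *\<^sub>R x) = of_real (t ^ l) * f x"
  shows "hpoly l f"
proof -
  obtain M where "poly_le M f" using polynomial_function_poly_le[OF f] by blast
  then have "poly_le (max M l) f" by (auto elim: poly_le_mono)
  then obtain h where h: "\<And>i. i \<le> max M l \<Longrightarrow> hpoly i (h i)" and fh: "f = (\<lambda>x. \<Sum>i\<le>max M l. h i x)"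
    using poly_le_decomposition by blast
  have "h l x = f x" for x
  proof -
    let ?c = "\<lambda>i. h i x - (if i = l then f x else 0)"
    have "(\<Sum>i\<le>max M l. ?c i * of_real t ^ i) = 0" for t
    proof -
      have "(\<Sum>i\<le>max M l. h i x * of_real t ^ i) = f (t *\<^sub>R x)"
        unfolding fh by (intro sum.cong refl, subst hpoly_scaleR[OF h]) auto
      moreover have "(\<Sum>i\<le>max M l. (if i = l then f x else 0) * of_real t ^ i) = f x * of_real t ^ l"
        by (subst sum.cong[OF refl, of _ _ "\<lambda>i. if i = l then f x * of_real t ^ l else 0"]) auto
      ultimately show ?thesis by (simp add: left_diff_distrib sum_subtractf hom)
    qed
    then have "range of_real \<subseteq> {z. (\<Sum>i\<le>max M l. ?c i * z ^ i) = 0}" by blast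
    moreover have "infinite (range (of_real :: real \<Rightarrow> complex))"
      using finite_imageD[of "of_real :: real \<Rightarrow> complex" UNIV] infinite_UNIV_char_0[where 'a=real]
      by (auto simp: inj_on_def)
    ultimately have "infinite {z. (\<Sum>i\<le>max M l. ?c i * z ^ i) = 0}"
      by (rule infinite_super)
    then have "\<forall>i\<le>max M l. ?c i = 0" using polyfun_finite_roots[of ?c "max M l"] by blast
    from this[rule_format, of l] show ?thesis by simp
  qed
  then have "f = h l" by auto
  then show ?thesis using h[of l] by simp
qed

section \<open>The Laplacian of homogeneous polynomials\<close>

text \<open>The derivative is required along whole lines, since \<open>laplacian\<close>
  differentiates the inner derivative once more as a function of the position.\<close>

definition has_directional_derivative ::
    "('a::euclidean_space \<Rightarrow> complex) \<Rightarrow> 'a \<Rightarrow> ('a \<Rightarrow> complex) \<Rightarrow> bool" where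
  "has_directional_derivative f v g \<longleftrightarrow>
    (\<forall>x t. ((\<lambda>t. f (x + t *\<^sub>R v)) has_vector_derivative g (x + t *\<^sub>R v)) (at t))"

lemma has_directional_derivative_add:
  "has_directional_derivative f v f' \<Longrightarrow> has_directional_derivative g v g' \<Longrightarrow>
    has_directional_derivative (\<lambda>x. f x + g x) v (\<lambda>x. f' x + g' x)"
  unfolding has_directional_derivative_def by (auto intro: has_vector_derivative_add)

lemma has_directional_derivative_mult:
  assumes "has_directional_derivative f v f'" "has_directional_derivative g v g'"
  shows "has_directional_derivative (\<lambda>x. f x * g x) v (\<lambda>x. f x * g' x + f' x * g x)"
  unfolding has_directional_derivative_def
  by (intro allI has_vector_derivative_mult) (use assms in \<open>auto simp: has_directional_derivative_def\<close>)

lemma has_directional_derivative_const: "has_directional_derivative (\<lambda>x. c) v (\<lambda>x. 0)"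
  unfolding has_directional_derivative_def by auto

lemma has_directional_derivative_inner:
  "has_directional_derivative (\<lambda>x. of_real (x \<bullet> w)) v (\<lambda>x. of_real (v \<bullet> w))"
  unfolding has_directional_derivative_def inner_add_left inner_scaleR_left
  by (auto intro!: derivative_eq_intros)

lemma has_directional_derivative_inner_self:
  "has_directional_derivative (\<lambda>x. of_real (x \<bullet> x)) v (\<lambda>x. 2 * of_real (x \<bullet> v))"
proof -
  have "((\<lambda>t. of_real ((x + t *\<^sub>R v) \<bullet> (x + t *\<^sub>R v)) :: complex) has_vector_derivative
    of_real (2 * ((x + t *\<^sub>R v) \<bullet> v))) (at t)" for x t
    by (rule has_vector_derivative_of_real)
       (auto intro!: derivative_eq_intros simp: has_real_derivative_iff_has_vector_derivative[symmetric] inner_commute algebra_simps)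
  then show ?thesis by (simp add: has_directional_derivative_def)
qed

lemma laplacian_eqI:
  assumes "\<And>b. b \<in> Basis \<Longrightarrow> has_directional_derivative f b (D b)"
    and "\<And>b. b \<in> Basis \<Longrightarrow> has_directional_derivative (D b) b (E b)"
  shows "laplacian f x = (\<Sum>b\<in>Basis. E b x)"
  unfolding laplacian_def
proof (intro sum.cong refl)
  fix b :: 'a assume b: "b \<in> Basis"
  have "vector_derivative (\<lambda>t. f (x + t *\<^sub>R b)) (at s) = D b (x + s *\<^sub>R b)" for s
    using assms(1)[OF b] by (intro vector_derivative_at) (simp add: has_directional_derivative_def)
  moreover have "vector_derivative (\<lambda>s. D b (x + s *\<^sub>R b)) (at 0) = E b (x + 0 *\<^sub>R b)"
    using assms(2)[OF b] by (intro vector_derivative_at) (simp only: has_directional_derivative_def)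
  ultimately show "vector_derivative (\<lambda>s. vector_derivative (\<lambda>t. f (x + t *\<^sub>R b)) (at s)) (at 0) = E b x"
    by simp
qed

text \<open>The last conjunct is Euler's identity.\<close>

lemma hpoly_derivative:
  fixes f :: "'a::euclidean_space \<Rightarrow> complex"
  assumes "hpoly m f"
  shows "\<exists>D. (\<forall>v. hpoly (m - 1) (D v)) \<and> (\<forall>v x. m = 0 \<longrightarrow> D v x = 0) \<and>
    (\<forall>v. has_directional_derivative f v (D v)) \<and>
    (\<forall>x. (\<Sum>b\<in>Basis. of_real (x \<bullet> b) * D b x) = of_nat m * f x)"
  using assms
proof (induction rule: hpoly.induct)
  case (hpoly_const c)
  show ?case
    by (intro exI[of _ "\<lambda>v x. 0"]) (auto simp: hpoly_zero has_directional_derivative_const)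
next
  case (hpoly_inner m f w)
  then obtain D where D: "\<And>v. hpoly (m - 1) (D v)" "\<And>v x. m = 0 \<Longrightarrow> D v x = 0"
    "\<And>v. has_directional_derivative f v (D v)"
    "\<And>x. (\<Sum>b\<in>Basis. of_real (x \<bullet> b) * D b x) = of_nat m * f x"
    by blast
  let ?D = "\<lambda>v x. of_real (x \<bullet> w) * D v x + of_real (v \<bullet> w) * f x"
  have "hpoly m (\<lambda>x. of_real (x \<bullet> w) * D v x)" for v
    using D(1,2) hpoly.hpoly_inner[of "m - 1" "D v" w] by (cases m) (auto simp: hpoly_zero)
  then have "hpoly m (?D v)" for v
    using hpoly_inner.hyps by (intro hpoly_add hpoly_cmult) auto
  moreover have "has_directional_derivative (\<lambda>x. of_real (x \<bullet> w) * f x) v (?D v)" for v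
    by (rule has_directional_derivative_mult[OF has_directional_derivative_inner D(3)])
  moreover have "(\<Sum>b\<in>Basis. of_real (x \<bullet> b) * ?D b x) = of_nat (Suc m) * (of_real (x \<bullet> w) * f x)" for x
  proof -
    have "(\<Sum>b\<in>Basis. of_real (x \<bullet> b) * ?D b x) =
      of_real (x \<bullet> w) * (\<Sum>b\<in>Basis. of_real (x \<bullet> b) * D b x) + of_real (\<Sum>b\<in>Basis. (x \<bullet> b) * (b \<bullet> w)) * f x"
      by (simp add: sum_distrib_left sum_distrib_right sum.distrib algebra_simps)
    also have "(\<Sum>b\<in>Basis. (x \<bullet> b) * (b \<bullet> w)) = x \<bullet> w"
      by (subst euclidean_inner) (simp add: inner_commute)
    finally show ?thesis unfolding D(4) by (simp add: algebra_simps)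
  qed
  ultimately show ?case by (intro exI[of _ ?D]) auto
next
  case (hpoly_add m f g)
  from hpoly_add.IH(1) obtain D where D: "\<And>v. hpoly (m - 1) (D v)" "\<And>v x. m = 0 \<Longrightarrow> D v x = 0"
    "\<And>v. has_directional_derivative f v (D v)"
    "\<And>x. (\<Sum>b\<in>Basis. of_real (x \<bullet> b) * D b x) = of_nat m * f x"
    by blast
  from hpoly_add.IH(2) obtain E where E: "\<And>v. hpoly (m - 1) (E v)" "\<And>v x. m = 0 \<Longrightarrow> E v x = 0"
    "\<And>v. has_directional_derivative g v (E v)"
    "\<And>x. (\<Sum>b\<in>Basis. of_real (x \<bullet> b) * E b x) = of_nat m * g x"
    by blast
  have "hpoly (m - 1) (\<lambda>x. D v x + E v x)" for v
    by (rule hpoly.hpoly_add[OF D(1) E(1)])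
  moreover have "has_directional_derivative (\<lambda>x. f x + g x) v (\<lambda>x. D v x + E v x)" for v
    by (rule has_directional_derivative_add[OF D(3) E(3)])
  moreover have "(\<Sum>b\<in>Basis. of_real (x \<bullet> b) * (D b x + E b x)) = of_nat m * (f x + g x)" for x
    using D(4) E(4) by (simp add: distrib_left sum.distrib)
  ultimately show ?case
    using D(2) E(2) by (intro exI[of _ "\<lambda>v x. D v x + E v x"]) auto
qed

text \<open>The degree \<open>m - 2\<close> is a truncated subtraction and would admit nonzero
  constants for \<open>m < 2\<close>; the last clause rules them out.\<close>

lemma hpoly_second_derivative:
  fixes f :: "'a::euclidean_space \<Rightarrow> complex"
  assumes "hpoly m f"
  obtains D E where "\<And>v. has_directional_derivative f v (D v)"
    "\<And>v. has_directional_derivative (D v) v (E v)"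
    "\<And>x. (\<Sum>b\<in>Basis. of_real (x \<bullet> b) * D b x) = of_nat m * f x"
    "\<And>v. hpoly (m - 2) (E v)" "\<And>v x. m < 2 \<Longrightarrow> E v x = 0"
proof -
  obtain D where D: "\<And>v. hpoly (m - 1) (D v)" "\<And>v x. m = 0 \<Longrightarrow> D v x = 0"
    "\<And>v. has_directional_derivative f v (D v)"
    "\<And>x. (\<Sum>b\<in>Basis. of_real (x \<bullet> b) * D b x) = of_nat m * f x"
    using hpoly_derivative[OF assms] by blast
  have "\<exists>E. has_directional_derivative (D v) v E \<and> hpoly (m - 1 - 1) E \<and> (\<forall>x. m - 1 = 0 \<longrightarrow> E x = 0)" for v
    using hpoly_derivative[OF D(1)[of v]] by metis
  then obtain E where "\<And>v. has_directional_derivative (D v) v (E v)"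
    "\<And>v. hpoly (m - 1 - 1) (E v)" "\<And>v x. m - 1 = 0 \<Longrightarrow> E v x = 0" by metis
  then show thesis using D by (intro that[of D E]) (auto simp: numeral_2_eq_2)
qed

lemma hpoly_laplacian:
  assumes "hpoly m f" shows "hpoly (m - 2) (laplacian f)"
proof -
  obtain D E where D1: "\<And>v. has_directional_derivative f v (D v)"
    and D2: "\<And>v. has_directional_derivative (D v) v (E v)"
    and D3: "\<And>x. (\<Sum>b\<in>Basis. of_real (x \<bullet> b) * D b x) = of_nat m * f x"
    and D4: "\<And>v. hpoly (m - 2) (E v)" and D5: "\<And>v x. m < 2 \<Longrightarrow> E v x = 0"
    using hpoly_second_derivative[OF assms] by blast
  have "laplacian f = (\<lambda>x. \<Sum>b\<in>Basis. E b x)"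
    by (rule ext, rule laplacian_eqI[OF D1 D2])
  then show ?thesis using hpoly_sum[OF D4] by simp
qed

lemma laplacian_hpoly_eq_0:
  assumes "hpoly m f" "m < 2" shows "laplacian f x = 0"
proof -
  obtain D E where D1: "\<And>v. has_directional_derivative f v (D v)"
    and D2: "\<And>v. has_directional_derivative (D v) v (E v)"
    and D3: "\<And>x. (\<Sum>b\<in>Basis. of_real (x \<bullet> b) * D b x) = of_nat m * f x"
    and D4: "\<And>v. hpoly (m - 2) (E v)" and D5: "\<And>v x. m < 2 \<Longrightarrow> E v x = 0"
    using hpoly_second_derivative[OF assms(1)] by blast
  show ?thesis unfolding laplacian_eqI[OF D1 D2] using D5[OF assms(2)] by simp
qed

lemma laplacian_add_cmult:
  assumes "hpoly m f" "hpoly k g"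
  shows "laplacian (\<lambda>x. f x + c * g x) x = laplacian f x + c * laplacian g x"
proof -
  obtain D E where f1: "\<And>v. has_directional_derivative f v (D v)"
    and f2: "\<And>v. has_directional_derivative (D v) v (E v)"
    and f3: "\<And>x. (\<Sum>b\<in>Basis. of_real (x \<bullet> b) * D b x) = of_nat m * f x"
    and f4: "\<And>v. hpoly (m - 2) (E v)" and f5: "\<And>v x. m < 2 \<Longrightarrow> E v x = 0"
    using hpoly_second_derivative[OF assms(1)] by blast
  obtain D' E' where g1: "\<And>v. has_directional_derivative g v (D' v)"
    and g2: "\<And>v. has_directional_derivative (D' v) v (E' v)"
    and g3: "\<And>x. (\<Sum>b\<in>Basis. of_real (x \<bullet> b) * D' b x) = of_nat k * g x"
    and g4: "\<And>v. hpoly (k - 2) (E' v)" and g5: "\<And>v x. k < 2 \<Longrightarrow> E' v x = 0"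
    using hpoly_second_derivative[OF assms(2)] by blast
  have cm: "has_directional_derivative (\<lambda>x. c * h x) v (\<lambda>x. c * h' x)" if "has_directional_derivative h v h'" for h h' v
    using has_directional_derivative_mult[OF has_directional_derivative_const[of c] that] by simp
  have "laplacian (\<lambda>x. f x + c * g x) x = (\<Sum>b\<in>Basis. E b x + c * E' b x)"
    using f1 f2 g1 g2 by (intro laplacian_eqI[where D = "\<lambda>b x. D b x + c * D' b x"] has_directional_derivative_add cm) auto
  also have "\<dots> = laplacian f x + c * laplacian g x"
    unfolding laplacian_eqI[OF f1 f2] laplacian_eqI[OF g1 g2] by (simp add: sum.distrib sum_distrib_left)
  finally show ?thesis .
qed

text \<open>The product rule gives 2n f + 4 (x . grad f) + |x|^2 Delta f, where n is the dimension,
  and Euler's identity turns the middle term into 4m f.\<close>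

lemma laplacian_inner_self_mult:
  fixes f :: "'a::euclidean_space \<Rightarrow> complex"
  assumes "hpoly m f"
  shows "laplacian (\<lambda>x. of_real (x \<bullet> x) * f x) x =
    of_nat (2 * DIM('a) + 4 * m) * f x + of_real (x \<bullet> x) * laplacian f x"
proof -
  obtain D E where D1: "\<And>v. has_directional_derivative f v (D v)"
    and D2: "\<And>v. has_directional_derivative (D v) v (E v)"
    and D3: "\<And>x. (\<Sum>b\<in>Basis. of_real (x \<bullet> b) * D b x) = of_nat m * f x"
    and D4: "\<And>v. hpoly (m - 2) (E v)" and D5: "\<And>v x. m < 2 \<Longrightarrow> E v x = 0"
    using hpoly_second_derivative[OF assms] by blast
  let ?D = "\<lambda>b x. of_real (x \<bullet> x) * D b x + 2 * of_real (x \<bullet> b) * f x"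
  let ?E = "\<lambda>b x. (of_real (x \<bullet> x) * E b x + 2 * of_real (x \<bullet> b) * D b x) +
    (2 * of_real (x \<bullet> b) * D b x + 2 * of_real (b \<bullet> b) * f x)"
  have "laplacian (\<lambda>x. of_real (x \<bullet> x) * f x) x = (\<Sum>b\<in>Basis. ?E b x)"
  proof (rule laplacian_eqI)
    fix b :: 'a
    show "has_directional_derivative (\<lambda>x. of_real (x \<bullet> x) * f x) b (?D b)"
      by (rule has_directional_derivative_mult[OF has_directional_derivative_inner_self D1])
    have "has_directional_derivative (\<lambda>x. 2 * of_real (x \<bullet> b)) b (\<lambda>x. 2 * of_real (b \<bullet> b))"
      using has_directional_derivative_mult[OF has_directional_derivative_const[of 2] has_directional_derivative_inner[of b b]]
      by simp
    from has_directional_derivative_add[OF has_directional_derivative_mult[OF has_directional_derivative_inner_self D2]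
        has_directional_derivative_mult[OF this D1]]
    show "has_directional_derivative (?D b) b (?E b)" .
  qed
  also have "\<dots> = of_real (x \<bullet> x) * (\<Sum>b\<in>Basis. E b x) + 4 * (\<Sum>b\<in>Basis. of_real (x \<bullet> b) * D b x) + 2 * of_nat DIM('a) * f x"
    by (simp add: sum.distrib sum_distrib_left inner_Basis algebra_simps)
  also have "(\<Sum>b\<in>Basis. E b x) = laplacian f x"
    by (rule laplacian_eqI[OF D1 D2, symmetric])
  finally show ?thesis unfolding D3 by (simp add: algebra_simps)
qed

lemma hpoly_inner_self: "hpoly m f \<Longrightarrow> hpoly (m + 2) (\<lambda>x. of_real (x \<bullet> x) * f x)"
proof -
  assume f: "hpoly m f"
  have "hpoly (Suc (Suc m)) (\<lambda>x. \<Sum>b\<in>Basis. of_real (x \<bullet> b) * (of_real (x \<bullet> b) * f x))"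
    by (intro hpoly_sum hpoly_inner f)
  moreover have "(\<Sum>b\<in>Basis. of_real (x \<bullet> b) * (of_real (x \<bullet> b) * f x)) = of_real (x \<bullet> x) * f x" for x
    by (subst (3) euclidean_inner) (simp add: sum_distrib_right mult.assoc)
  ultimately show ?thesis by simp
qed

lemma hpoly_inner_self_power: "hpoly m f \<Longrightarrow> hpoly (m + 2 * j) (\<lambda>x. of_real (x \<bullet> x) ^ j * f x)"
proof (induction j)
  case (Suc j)
  from hpoly_inner_self[OF Suc.IH[OF Suc.prems]] show ?case by (simp add: mult.assoc)
qed simp

text \<open>Each further factor |x|^2 adds a positive natural number to the eigenvalue-like
  constant, so it never becomes zero and can be divided out.\<close>

lemma laplacian_inner_self_power:
  fixes u :: "'a::euclidean_space \<Rightarrow> complex"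
  assumes u: "hpoly m u" "\<And>x. laplacian u x = 0"
  shows "\<exists>c. c \<noteq> 0 \<and> (\<forall>x. laplacian (\<lambda>x. of_real (x \<bullet> x) ^ Suc j * u x) x = of_nat c * (of_real (x \<bullet> x) ^ j * u x))"
proof (induction j)
  case 0
  show ?case using laplacian_inner_self_mult[OF u(1)] u(2) DIM_positive[where 'a='a]
    by (intro exI[of _ "2 * DIM('a) + 4 * m"]) simp
next
  case (Suc j)
  then obtain c where c: "c \<noteq> 0" "\<And>x. laplacian (\<lambda>x. of_real (x \<bullet> x) ^ Suc j * u x) x = of_nat c * (of_real (x \<bullet> x) ^ j * u x)"
    by blast
  have "laplacian (\<lambda>x. of_real (x \<bullet> x) * (of_real (x \<bullet> x) ^ Suc j * u x)) x =
      of_nat (2 * DIM('a) + 4 * (m + 2 * Suc j)) * (of_real (x \<bullet> x) ^ Suc j * u x) +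
      of_real (x \<bullet> x) * (of_nat c * (of_real (x \<bullet> x) ^ j * u x))" for x
    unfolding laplacian_inner_self_mult[OF hpoly_inner_self_power[OF u(1)]] c(2) ..
  then show ?case using c(1)
    by (intro exI[of _ "2 * DIM('a) + 4 * (m + 2 * Suc j) + c"]) (simp add: algebra_simps)
qed

section \<open>Decomposition of polynomials into harmonic ones\<close>

text \<open>Sums of |x|^(2j) u with u harmonic, all of one total degree. That every homogeneous
  polynomial is of this kind is the classical Gauss (or Fischer) decomposition,
  \<open>hpoly_harmonic_sum\<close>.\<close>

inductive harmonic_sum :: "nat \<Rightarrow> ('a::euclidean_space \<Rightarrow> complex) \<Rightarrow> bool" where
  harmonic_sum_power: "hpoly m u \<Longrightarrow> (\<And>x. laplacian u x = 0) \<Longrightarrow>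
    harmonic_sum (m + 2 * j) (\<lambda>x. of_real (x \<bullet> x) ^ j * u x)"
| harmonic_sum_add: "harmonic_sum l f \<Longrightarrow> harmonic_sum l g \<Longrightarrow> harmonic_sum l (\<lambda>x. f x + g x)"

lemma harmonic_sum_hpoly: "harmonic_sum l f \<Longrightarrow> hpoly l f"
  by (induction rule: harmonic_sum.induct) (auto intro: hpoly_inner_self_power hpoly_add)

lemma harmonic_sum_laplacian_preimage:
  "harmonic_sum l f \<Longrightarrow> \<exists>F. harmonic_sum (l + 2) F \<and> (\<forall>x. laplacian F x = f x)"
proof (induction rule: harmonic_sum.induct)
  case (harmonic_sum_power m u j)
  obtain c where c: "c \<noteq> 0" "\<And>x. laplacian (\<lambda>x. of_real (x \<bullet> x) ^ Suc j * u x) x = of_nat c * (of_real (x \<bullet> x) ^ j * u x)"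
    using laplacian_inner_self_power[OF harmonic_sum_power] by blast
  \<comment> \<open>Dividing by the constant \<open>c\<close> makes the Laplacian of |x|^(2j+2) v
    equal to |x|^(2j) u.\<close>
  let ?v = "\<lambda>x. inverse (of_nat c) * u x"
  \<comment> \<open>Homogeneity of the Laplacian is \<open>laplacian_add_cmult\<close> with zero as
    first summand.\<close>
  have "laplacian ?v x = 0" for x
    using laplacian_add_cmult[OF hpoly_zero harmonic_sum_power(1), of "inverse (of_nat c)" x]
      laplacian_hpoly_eq_0[OF hpoly_const[of 0], of x] harmonic_sum_power(2) by simp
  then have "harmonic_sum (m + 2 * Suc j) (\<lambda>x. of_real (x \<bullet> x) ^ Suc j * ?v x)"
    by (intro harmonic_sum.harmonic_sum_power hpoly_cmult harmonic_sum_power)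
  moreover have "laplacian (\<lambda>x. of_real (x \<bullet> x) ^ Suc j * ?v x) x = of_real (x \<bullet> x) ^ j * u x" for x
    using laplacian_add_cmult[OF hpoly_zero hpoly_inner_self_power[OF harmonic_sum_power(1), of "Suc j"], of "inverse (of_nat c)" x]
      laplacian_hpoly_eq_0[OF hpoly_const[of 0], of x] c by (simp add: mult_ac)
  ultimately show ?case by (intro exI[of _ "\<lambda>x. of_real (x \<bullet> x) ^ Suc j * ?v x"]) simp
next
  case (harmonic_sum_add l f g)
  then obtain F G where FG: "harmonic_sum (l + 2) F" "\<And>x. laplacian F x = f x" "harmonic_sum (l + 2) G" "\<And>x. laplacian G x = g x"
    by blast
  then show ?case
    using laplacian_add_cmult[OF harmonic_sum_hpoly[OF FG(1)] harmonic_sum_hpoly[OF FG(3)], of 1]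
    by (intro exI[of _ "\<lambda>x. F x + G x"]) (auto intro: harmonic_sum.harmonic_sum_add)
qed

lemma hpoly_harmonic_sum: "hpoly l f \<Longrightarrow> harmonic_sum l f"
proof (induction l arbitrary: f rule: less_induct)
  case (less l)
  have harm: "harmonic_sum l u" if "hpoly l u" "\<And>x. laplacian u x = 0" for u
    using harmonic_sum_power[OF that, of 0] by simp
  show ?case
  proof (cases "l < 2")
    case True
    then show ?thesis using less.prems by (intro harm laplacian_hpoly_eq_0)
  next
    case False
    then have "harmonic_sum (l - 2) (laplacian f)" using hpoly_laplacian[OF less.prems] by (intro less.IH) auto
    moreover have "l - 2 + 2 = l" using False by simp
    ultimately obtain F where F: "harmonic_sum l F" "\<And>x. laplacian F x = laplacian f x"
      using harmonic_sum_laplacian_preimage by metis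
    have "harmonic_sum l (\<lambda>x. f x + (-1) * F x)"
    proof (rule harm)
      show "hpoly l (\<lambda>x. f x + (-1) * F x)" by (intro hpoly_add hpoly_cmult harmonic_sum_hpoly F less.prems)
      show "laplacian (\<lambda>x. f x + (-1) * F x) x = 0" for x
        unfolding laplacian_add_cmult[OF less.prems harmonic_sum_hpoly[OF F(1)]] by (simp add: F)
    qed
    from harmonic_sum_add[OF this F(1)] show ?thesis by simp
  qed
qed

section \<open>\<open>Pi_space L\<close> as the space of restricted polynomials\<close>

definition sphere_restrict :: "('a::euclidean_space \<Rightarrow> complex) \<Rightarrow> 'a \<Rightarrow> complex" where
  "sphere_restrict f = (\<lambda>x. if x \<in> unit_sphere then f x else 0)"

lemma sphere_restrict_add: "sphere_restrict (\<lambda>x. f x + g x) = sphere_restrict f + sphere_restrict g"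
  by (auto simp: sphere_restrict_def fun_eq_iff)

lemma sphere_restrict_cmult: "sphere_restrict (\<lambda>x. c * f x) = cfun_scale c (sphere_restrict f)"
  by (auto simp: sphere_restrict_def cfun_scale_def fun_eq_iff)

lemma sphere_restrict_sum: "sphere_restrict (\<lambda>x. \<Sum>i\<in>I. f i x) = (\<Sum>i\<in>I. sphere_restrict (f i))"
proof -
  have "sphere_restrict (\<lambda>x. 0) = 0" by (auto simp: sphere_restrict_def fun_eq_iff)
  then show ?thesis
    by (induction I rule: infinite_finite_induct) (simp_all add: sphere_restrict_add)
qed

text \<open>On the sphere the powers of \<open>x \<bullet> x\<close> equal 1, which leaves the
  harmonic factors alone.\<close>

lemma harmonic_sum_in_Pi_space: "harmonic_sum l f \<Longrightarrow> l \<le> L \<Longrightarrow> sphere_restrict f \<in> Pi_space L"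
proof (induction rule: harmonic_sum.induct)
  case (harmonic_sum_power m u j)
  have "sphere_restrict (\<lambda>x. of_real (x \<bullet> x) ^ j * u x) = sphere_restrict u"
    by (auto simp: sphere_restrict_def fun_eq_iff dot_square_norm)
  also have "\<dots> \<in> spherical_harmonics m"
    using harmonic_sum_power
    by (auto simp: spherical_harmonics_def sphere_restrict_def homogeneous_harmonic_polynomial_def
        hpoly_scaleR[OF harmonic_sum_power(1)] intro!: exI[of _ u] polynomial_function_hpoly)
  finally show ?case
    using harmonic_sum_power.prems by (auto simp: Pi_space_def intro!: cfun.span_base bexI[of _ m])
next
  case (harmonic_sum_add l f g)
  then show ?case unfolding sphere_restrict_add Pi_space_def by (intro cfun.span_add) auto
qed

lemma poly_le_in_Pi_space:
  assumes "poly_le L f" shows "sphere_restrict f \<in> Pi_space L"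
proof -
  obtain h where h: "\<And>l. l \<le> L \<Longrightarrow> hpoly l (h l)" and f: "f = (\<lambda>x. \<Sum>l\<le>L. h l x)"
    using poly_le_decomposition[OF assms] by blast
  have "sphere_restrict f = (\<Sum>l\<le>L. sphere_restrict (h l))"
    unfolding f by (rule sphere_restrict_sum)
  also have "\<dots> \<in> Pi_space L"
    using harmonic_sum_in_Pi_space[OF hpoly_harmonic_sum[OF h]]
    unfolding Pi_space_def by (intro cfun.span_sum) auto
  finally show ?thesis .
qed

lemma Pi_space_poly_le:
  assumes "Q \<in> Pi_space L" shows "\<exists>f. poly_le L f \<and> Q = sphere_restrict f"
proof -
  have "cfun.subspace {Q. \<exists>f. poly_le L f \<and> Q = sphere_restrict f}"
    unfolding cfun.subspace_def
  proof (safe)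
    show "\<exists>f. poly_le L f \<and> 0 = sphere_restrict f"
      by (intro exI[of _ "\<lambda>x. 0"]) (auto simp: poly_le_const sphere_restrict_def fun_eq_iff)
  qed (metis sphere_restrict_add sphere_restrict_cmult poly_le_add poly_le_cmult)+
  moreover have "(\<Union>l\<le>L. spherical_harmonics l) \<subseteq> {Q. \<exists>f. poly_le L f \<and> Q = sphere_restrict f}"
  proof safe
    fix l Q assume "l \<le> L" "Q \<in> spherical_harmonics l"
    then obtain f where "homogeneous_harmonic_polynomial l f" "Q = sphere_restrict f"
      by (auto simp: spherical_harmonics_def sphere_restrict_def)
    moreover from this have "poly_le L f"
      using homogeneous_polynomial_hpoly[of f l] \<open>l \<le> L\<close>
      by (auto simp: homogeneous_harmonic_polynomial_def intro: poly_le_mono hpoly_imp_poly_le)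
    ultimately show "\<exists>f. poly_le L f \<and> Q = sphere_restrict f" by blast
  qed
  ultimately show ?thesis
    using assms cfun.span_minimal unfolding Pi_space_def by blast
qed

section \<open>The dimension of \<open>Pi_space L\<close>\<close>

lemma coordinate_power2_eq:
  fixes x :: "'a::euclidean_space"
  assumes k: "k \<in> Basis" and x: "norm x = 1"
  shows "(x \<bullet> k)\<^sup>2 = 1 - (\<Sum>c\<in>Basis - {k}. (x \<bullet> c)\<^sup>2)"
proof -
  have "1 = x \<bullet> x" using x by (simp add: dot_square_norm)
  also have "\<dots> = (\<Sum>c\<in>Basis. (x \<bullet> c)\<^sup>2)" by (subst euclidean_inner) (simp add: power2_eq_square)
  also have "\<dots> = (x \<bullet> k)\<^sup>2 + (\<Sum>c\<in>Basis - {k}. (x \<bullet> c)\<^sup>2)" using k by (simp add: sum.remove)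
  finally show ?thesis by simp
qed

lemma sum_fun_apply: "(\<Sum>i\<in>I. f i) x = (\<Sum>i\<in>I. f i x)"
  by (induction I rule: infinite_finite_induct) auto

lemma linear_image_span_subset:
  assumes "\<And>f g. T (f + g) = T f + T g" "\<And>c f. T (cfun_scale c f) = cfun_scale c (T f)" "T 0 = 0"
    and "\<And>f. f \<in> A \<Longrightarrow> T f \<in> cfun.span B" and "f \<in> cfun.span A"
  shows "T f \<in> cfun.span B"
  using assms(5)
proof (induction rule: cfun.span_induct_alt)
  case base
  show ?case unfolding assms(3) by (rule cfun.span_zero)
next
  case (step c x y)
  show ?case unfolding assms(1,2) by (rule cfun.span_add[OF cfun.span_scale[OF assms(4)[OF step(1)]] step(2)])
qed

definition sphere_monomial :: "'a::euclidean_space \<Rightarrow> ('a \<Rightarrow> nat) \<Rightarrow> nat \<Rightarrow> 'a \<Rightarrow> complex" where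
  "sphere_monomial k \<alpha> e = sphere_restrict (\<lambda>x. of_real ((x \<bullet> k) ^ e * (\<Prod>b\<in>Basis - {k}. (x \<bullet> b) ^ \<alpha> b)))"

text \<open>
  On the sphere the square of one coordinate is a polynomial in the others, so exponents at
  most one of the coordinate \<open>k\<close> are enough.
\<close>

definition sphere_monomials :: "'a::euclidean_space \<Rightarrow> nat \<Rightarrow> ('a \<Rightarrow> complex) set" where
  "sphere_monomials k L = {sphere_monomial k \<alpha> e | \<alpha> e. e \<le> 1 \<and> (\<Sum>b\<in>Basis - {k}. \<alpha> b) + e \<le> L}"

text \<open>Every exponent is at most L, and those off \<open>k\<close> matter only on d basis
  vectors, so restricted exponent functions together with e in {0, 1} parametrise the set. The count
  is generous, but only its order L^d matters.\<close>

lemma sphere_monomials_finite_card: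
  fixes k :: "'a::euclidean_space"
  assumes "DIM('a) = d + 1" "k \<in> Basis"
  shows "finite (sphere_monomials k L) \<and> card (sphere_monomials k L) \<le> 2 * (L + 1) ^ d"
proof -
  let ?B = "Basis - {k}"
  let ?X = "(?B \<rightarrow>\<^sub>E {..L}) \<times> {..1::nat}"
  have sub: "sphere_monomials k L \<subseteq> (\<lambda>(\<alpha>, e). sphere_monomial k \<alpha> e) ` ?X"
  proof
    fix f assume "f \<in> sphere_monomials k L"
    then obtain \<alpha> e where f: "f = sphere_monomial k \<alpha> e" "e \<le> 1" "(\<Sum>b\<in>?B. \<alpha> b) + e \<le> L"
      by (auto simp: sphere_monomials_def)
    have "\<alpha> b \<le> L" if "b \<in> ?B" for b
      using member_le_sum[of b ?B \<alpha>] that f(3) by auto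
    then have "restrict \<alpha> ?B \<in> ?B \<rightarrow>\<^sub>E {..L}" by auto
    moreover have "f = sphere_monomial k (restrict \<alpha> ?B) e"
      unfolding f(1) sphere_monomial_def by simp
    ultimately show "f \<in> (\<lambda>(\<alpha>, e). sphere_monomial k \<alpha> e) ` ?X"
      using f(2) by (intro image_eqI[of _ _ "(restrict \<alpha> ?B, e)"]) (simp_all add: PiE_def)
  qed
  moreover have fX: "finite ?X" by (intro finite_cartesian_product finite_PiE) auto
  moreover have cX: "card ?X = 2 * (L + 1) ^ d"
    using assms by (simp add: card_cartesian_product card_PiE)
  ultimately show ?thesis
    using surj_card_le[OF fX sub] finite_surj[OF fX sub] by simp
qed

text \<open>The product is again one of the monomials unless the coordinate \<open>k\<close> would
  get exponent 2; there the equation of the sphere replaces its square.\<close>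

lemma coordinate_mult_sphere_monomial:
  fixes k :: "'a::euclidean_space"
  assumes k: "k \<in> Basis" and b: "b \<in> Basis" and f: "f \<in> sphere_monomials k L"
  shows "(\<lambda>x. of_real (x \<bullet> b) * f x) \<in> cfun.span (sphere_monomials k (Suc L))"
proof -
  let ?B = "Basis - {k}"
  from f obtain \<alpha> e where f: "f = sphere_monomial k \<alpha> e" "e \<le> 1" "(\<Sum>b\<in>?B. \<alpha> b) + e \<le> L"
    by (auto simp: sphere_monomials_def)
  have prod_upd: "(\<Prod>c\<in>?B. (x \<bullet> c) ^ (\<alpha>(b := \<alpha> b + i)) c) = (x \<bullet> b) ^ i * (\<Prod>c\<in>?B. (x \<bullet> c) ^ \<alpha> c)"
    if "b \<in> ?B" for b i and x :: 'a
    using that by (simp add: prod.remove[of ?B b] power_add)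
  have sum_upd: "(\<Sum>c\<in>?B. (\<alpha>(b := \<alpha> b + i)) c) = (\<Sum>c\<in>?B. \<alpha> c) + i" if "b \<in> ?B" for b i
    using that by (simp add: sum.remove[of ?B b])
  show ?thesis
  proof (cases "b = k")
    case False
    then have bB: "b \<in> ?B" using b by simp
    have "(\<lambda>x. of_real (x \<bullet> b) * f x) = sphere_monomial k (\<alpha>(b := \<alpha> b + 1)) e"
      unfolding f(1) sphere_monomial_def prod_upd[OF bB] by (auto simp: sphere_restrict_def fun_eq_iff)
    also have "\<dots> \<in> sphere_monomials k (Suc L)"
      unfolding sphere_monomials_def using f(2,3) sum_upd[OF bB, of 1] by fastforce
    finally show ?thesis by (rule cfun.span_base)
  next
    case True
    show ?thesis
    proof (cases "e = 0")
      case e: True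
      have "(\<lambda>x. of_real (x \<bullet> b) * f x) = sphere_monomial k \<alpha> 1"
        unfolding f(1) sphere_monomial_def e True by (auto simp: sphere_restrict_def fun_eq_iff)
      also have "\<dots> \<in> sphere_monomials k (Suc L)"
        unfolding sphere_monomials_def using f(3) e by fastforce
      finally show ?thesis by (rule cfun.span_base)
    next
      case False
      then have e: "e = 1" using f(2) by simp
      \<comment> \<open>The exponents grow by 2 in total, but the exponent \<open>e = 1\<close> of
        coordinate \<open>k\<close> is given up, so the degree rises by one only.\<close>
      have "(\<lambda>x. of_real (x \<bullet> b) * f x) = sphere_monomial k \<alpha> 0 - (\<Sum>c\<in>?B. sphere_monomial k (\<alpha>(c := \<alpha> c + 2)) 0)"
      proof
        fix x :: 'a
        show "of_real (x \<bullet> b) * f x = (sphere_monomial k \<alpha> 0 - (\<Sum>c\<in>?B. sphere_monomial k (\<alpha>(c := \<alpha> c + 2)) 0)) x"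
        proof (cases "norm x = 1")
          case x: True
          let ?P = "\<Prod>c\<in>?B. (x \<bullet> c) ^ \<alpha> c"
          have "of_real (x \<bullet> b) * f x = of_real ((x \<bullet> k)\<^sup>2 * ?P)"
            using x by (simp add: f(1) sphere_monomial_def sphere_restrict_def e True power2_eq_square)
          also have "\<dots> = of_real (?P - (\<Sum>c\<in>?B. (x \<bullet> c)\<^sup>2 * ?P))"
            unfolding coordinate_power2_eq[OF k x] by (simp add: left_diff_distrib sum_distrib_right)
          also have "\<dots> = (sphere_monomial k \<alpha> 0 - (\<Sum>c\<in>?B. sphere_monomial k (\<alpha>(c := \<alpha> c + 2)) 0)) x"
          proof -
            have sm: "sphere_monomial k \<beta> 0 x = of_real (\<Prod>c\<in>?B. (x \<bullet> c) ^ \<beta> c)" for \<beta>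
              using x by (simp add: sphere_monomial_def sphere_restrict_def)
            have "(\<Sum>c\<in>?B. sphere_monomial k (\<alpha>(c := \<alpha> c + 2)) 0 x) = of_real (\<Sum>c\<in>?B. (x \<bullet> c)\<^sup>2 * ?P)"
              unfolding sm of_real_sum by (rule sum.cong[OF refl], subst prod_upd) (auto simp del: fun_upd_apply)
            then show ?thesis unfolding minus_apply sum_fun_apply sm by (simp only: of_real_diff)
          qed
          finally show ?thesis .
        qed (simp add: sum_fun_apply f(1) sphere_monomial_def sphere_restrict_def)
      qed
      also have "\<dots> \<in> cfun.span (sphere_monomials k (Suc L))"
      proof (intro cfun.span_diff cfun.span_sum cfun.span_base)
        show "sphere_monomial k \<alpha> 0 \<in> sphere_monomials k (Suc L)"
          unfolding sphere_monomials_def using f(3) by fastforce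
        show "sphere_monomial k (\<alpha>(c := \<alpha> c + 2)) 0 \<in> sphere_monomials k (Suc L)" if "c \<in> ?B" for c
          unfolding sphere_monomials_def using f(3) e sum_upd[OF that, of 2] by fastforce
      qed
      finally show ?thesis .
    qed
  qed
qed

lemma poly_le_in_span_sphere_monomials:
  fixes k :: "'a::euclidean_space"
  assumes k: "k \<in> Basis" and "poly_le L f"
  shows "sphere_restrict f \<in> cfun.span (sphere_monomials k L)"
  using assms(2)
proof (induction rule: poly_le.induct)
  case (poly_le_const m c)
  have "sphere_restrict (\<lambda>x. c) = cfun_scale c (sphere_monomial k (\<lambda>b. 0) 0)"
    by (auto simp: sphere_monomial_def sphere_restrict_def cfun_scale_def fun_eq_iff)
  moreover have "sphere_monomial k (\<lambda>b. 0) 0 \<in> sphere_monomials k m"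
    unfolding sphere_monomials_def by fastforce
  ultimately show ?case by (auto intro: cfun.span_scale cfun.span_base)
next
  case (poly_le_inner m f v)
  have "(\<lambda>x. of_real (x \<bullet> b) * sphere_restrict f x) \<in> cfun.span (sphere_monomials k (Suc m))" if "b \<in> Basis" for b
    by (rule linear_image_span_subset[where T = "\<lambda>f x. of_real (x \<bullet> b) * f x",
          OF _ _ _ coordinate_mult_sphere_monomial[OF k that] poly_le_inner.IH])
       (simp_all add: fun_eq_iff algebra_simps cfun_scale_def)
  then have "(\<Sum>b\<in>Basis. cfun_scale (of_real (v \<bullet> b)) (\<lambda>x. of_real (x \<bullet> b) * sphere_restrict f x))
      \<in> cfun.span (sphere_monomials k (Suc m))"
    by (intro cfun.span_sum cfun.span_scale)
  also have "(\<Sum>b\<in>Basis. cfun_scale (of_real (v \<bullet> b)) (\<lambda>x. of_real (x \<bullet> b) * sphere_restrict f x))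
      = sphere_restrict (\<lambda>x. of_real (x \<bullet> v) * f x)"
  proof
    fix x :: 'a
    have "of_real (x \<bullet> v) = (\<Sum>b\<in>Basis. of_real (x \<bullet> b) * (of_real (v \<bullet> b)) :: complex)"
      by (subst euclidean_inner) simp
    then show "(\<Sum>b\<in>Basis. cfun_scale (of_real (v \<bullet> b)) (\<lambda>x. of_real (x \<bullet> b) * sphere_restrict f x)) x
      = sphere_restrict (\<lambda>x. of_real (x \<bullet> v) * f x) x"
      by (simp add: sum_fun_apply cfun_scale_def sphere_restrict_def sum_distrib_left mult_ac)
  qed
  finally show ?case .
next
  case (poly_le_add m f g)
  then show ?case unfolding sphere_restrict_add by (intro cfun.span_add)
qed

lemma Pi_space_subset_span_monomials:
  fixes k :: "'a::euclidean_space"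
  assumes "k \<in> Basis" shows "Pi_space L \<subseteq> cfun.span (sphere_monomials k L)"
proof
  fix Q :: "'a \<Rightarrow> complex" assume "Q \<in> Pi_space L"
  then obtain f where "poly_le L f" "Q = sphere_restrict f" using Pi_space_poly_le by metis
  then show "Q \<in> cfun.span (sphere_monomials k L)"
    using poly_le_in_span_sphere_monomials[OF assms] by simp
qed

lemma pi_dim_le:
  assumes "DIM('a::euclidean_space) = d + 1"
  shows "pi_dim TYPE('a) L \<le> 2 * (L + 1) ^ d"
proof -
  obtain k :: 'a where k: "k \<in> Basis" using nonempty_Basis by blast
  note fc = sphere_monomials_finite_card[OF assms k, of L]
  have "pi_dim TYPE('a) L \<le> card (sphere_monomials k L)"
    unfolding pi_dim_def using fc Pi_space_subset_span_monomials[OF k] by (intro cfun.dim_le_card) auto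
  then show ?thesis using fc by simp
qed

text \<open>The finite spanning set of monomials makes a basis of \<open>Pi_space L\<close> finite;
  only then can it be compared in size with an independent set.\<close>

lemma card_independent_le_pi_dim:
  fixes S :: "('a::euclidean_space \<Rightarrow> complex) set"
  assumes "S \<subseteq> Pi_space L" "cfun.independent S"
  shows "card S \<le> pi_dim TYPE('a) L"
proof -
  obtain k :: 'a where k: "k \<in> Basis" using nonempty_Basis by blast
  have "DIM('a) = (DIM('a) - 1) + 1" using DIM_positive[where 'a='a] by linarith
  note fc = sphere_monomials_finite_card[OF this k, of L]
  obtain B :: "('a \<Rightarrow> complex) set" where B: "B \<subseteq> Pi_space L" "cfun.independent B" "Pi_space L \<subseteq> cfun.span B"
    "card B = cfun.dim (Pi_space L :: ('a \<Rightarrow> complex) set)"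
    by (rule cfun.basis_exists[of "Pi_space L :: ('a \<Rightarrow> complex) set"])
  have "finite B"
    by (rule conjunct1[OF cfun.independent_span_bound[OF conjunct1[OF fc] B(2)
          order_trans[OF B(1) Pi_space_subset_span_monomials[OF k]]]])
  then have "card S \<le> card B"
    by (rule conjunct2[OF cfun.independent_span_bound[OF _ assms(2) order_trans[OF assms(1) B(3)]]])
  then show ?thesis by (simp add: pi_dim_def B(4))
qed

text \<open>
  Lagrange functions of a product grid with \<open>L div d + 1\<close> points per coordinate, lifted to the sphere.
\<close>

lemma pi_dim_ge:
  assumes dim: "DIM('a::euclidean_space) = d + 1" and d: "d \<ge> 1"
  shows "(L div d + 1) ^ d \<le> pi_dim TYPE('a) L"
proof -
  obtain k :: 'a where k: "k \<in> Basis" using nonempty_Basis by blast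
  let ?B = "Basis - {k}"
  have cB: "card ?B = d" using dim k by simp
  define m where "m = L div d + 1"
  \<comment> \<open>Grid coordinates stay below 1/d, so the sum of d squares is at most 1 and the
    square root in \<open>pt\<close> is real.\<close>
  define s where "s i = real i / (real m * real d)" for i :: nat
  define J where "J = (?B \<rightarrow>\<^sub>E {..<m})"
  have fJ: "finite J" and cJ: "card J = m ^ d"
    by (auto simp: J_def card_PiE cB intro: finite_PiE)
  have m0: "m > 0" by (simp add: m_def)
  have inj: "s i = s i' \<longleftrightarrow> i = i'" for i i' using m0 d by (simp add: s_def)
  \<comment> \<open>The point of the upper hemisphere, with respect to \<open>k\<close>, above the
    grid point.\<close>
  define pt where "pt j = (\<Sum>b\<in>?B. s (j b) *\<^sub>R b) + sqrt (1 - (\<Sum>b\<in>?B. (s (j b))\<^sup>2)) *\<^sub>R k" for j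
  have pt_B: "pt j \<bullet> b = s (j b)" if "b \<in> ?B" for j b
  proof -
    have "(\<Sum>c\<in>?B. s (j c) * (c \<bullet> b)) = (\<Sum>c\<in>?B. if c = b then s (j c) else 0)"
      using that by (intro sum.cong) (auto simp: inner_Basis)
    moreover have "k \<bullet> b = 0" using that k by (auto simp: inner_Basis)
    ultimately have "pt j \<bullet> b = (\<Sum>c\<in>?B. if c = b then s (j c) else 0)"
      unfolding pt_def inner_add_left inner_sum_left by simp
    then show ?thesis using that by simp
  qed
  have pt_k: "pt j \<bullet> k = sqrt (1 - (\<Sum>b\<in>?B. (s (j b))\<^sup>2))" for j
    using k unfolding pt_def inner_add_left inner_sum_left by (simp add: inner_Basis)
  have pt_sphere: "pt j \<in> unit_sphere" if "j \<in> J" for j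
  proof -
    have "(\<Sum>b\<in>?B. (s (j b))\<^sup>2) \<le> (\<Sum>b\<in>?B. 1 / real d)"
    proof (rule sum_mono)
      fix b assume "b \<in> ?B"
      then have "j b < m" using that by (auto simp: J_def PiE_def)
      then have "0 \<le> s (j b)" "s (j b) \<le> 1 / real d" using m0 d by (auto simp: s_def field_simps)
      then have "(s (j b))\<^sup>2 \<le> (1 / real d)\<^sup>2" by (intro power_mono)
      also have "\<dots> \<le> 1 / real d" using d by (simp add: power2_eq_square field_simps)
      finally show "(s (j b))\<^sup>2 \<le> 1 / real d" .
    qed
    also have "\<dots> = 1" using d cB by simp
    finally have le: "(\<Sum>b\<in>?B. (s (j b))\<^sup>2) \<le> 1" .
    have "pt j \<bullet> pt j = (pt j \<bullet> k)\<^sup>2 + (\<Sum>b\<in>?B. (pt j \<bullet> b)\<^sup>2)"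
      by (subst euclidean_inner) (simp add: sum.remove[OF _ k] power2_eq_square)
    also have "\<dots> = 1" using le by (simp add: pt_B pt_k)
    finally show ?thesis by (simp add: norm_eq_sqrt_inner)
  qed
  define f where "f j x = (\<Prod>b\<in>?B. \<Prod>i\<in>{..<m} - {j b}. of_real (x \<bullet> b) + (- of_real (s i)) :: complex)" for j x
  define F where "F j = sphere_restrict (f j)" for j
  have "poly_le L (f j)" if "j \<in> J" for j
  proof -
    have "poly_le (\<Sum>b\<in>?B. \<Sum>i\<in>{..<m} - {j b}. 1) (f j)"
      unfolding f_def by (intro poly_le_prod poly_le_add poly_le_inner_const poly_le_const)
    moreover have "(\<Sum>b\<in>?B. \<Sum>i\<in>{..<m} - {j b}. 1) = (\<Sum>b\<in>?B. m - 1)"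
      using PiE_mem[OF that[unfolded J_def]] by (intro sum.cong refl) (simp add: card_Diff_singleton)
    moreover have "(\<Sum>b\<in>?B. m - 1) \<le> L" by (simp add: cB m_def)
    ultimately show ?thesis by (auto elim: poly_le_mono)
  qed
  then have FPi: "F ` J \<subseteq> Pi_space L" unfolding F_def using poly_le_in_Pi_space by blast
  have F_diag: "F j (pt j) \<noteq> 0" if "j \<in> J" for j
    using pt_sphere[OF that] by (auto simp: F_def sphere_restrict_def f_def pt_B inj)
  have F_off: "F j (pt j') = 0" if "j \<in> J" "j' \<in> J" "j \<noteq> j'" for j j'
  proof -
    note h = that
    obtain b where b: "b \<in> ?B" "j b \<noteq> j' b"
      using PiE_ext[OF h(1)[unfolded J_def] h(2)[unfolded J_def]] h(3) by blast
    then have "j' b \<in> {..<m} - {j b}" using that by (auto simp: J_def PiE_def)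
    then have "(\<Prod>i\<in>{..<m} - {j b}. of_real (pt j' \<bullet> b) + (- of_real (s i)) :: complex) = 0"
      unfolding pt_B[OF b(1)] by (intro prod_zero) auto
    then have "f j (pt j') = 0" unfolding f_def using b(1) by (intro prod_zero) auto
    then show ?thesis by (simp add: F_def sphere_restrict_def)
  qed
  have injF: "inj_on F J"
    using F_diag F_off by (intro inj_onI) metis
  have "cfun.independent (F ` J)"
  proof (rule cfun.independent_if_scalars_zero)
    fix c Q assume c: "(\<Sum>Q\<in>F ` J. cfun_scale (c Q) Q) = 0" and "Q \<in> F ` J"
    then obtain j where j: "j \<in> J" "Q = F j" by blast
    have "0 = (\<Sum>Q\<in>F ` J. cfun_scale (c Q) Q) (pt j)" by (simp add: c)
    also have "\<dots> = (\<Sum>i\<in>J. c (F i) * F i (pt j))"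
      by (simp add: sum_fun_apply cfun_scale_def sum.reindex[OF injF])
    also have "\<dots> = (\<Sum>i\<in>J. if i = j then c (F j) * F j (pt j) else 0)"
      using F_off j by (intro sum.cong) auto
    also have "\<dots> = c (F j) * F j (pt j)" using j fJ by simp
    finally show "c Q = 0" using F_diag j by simp
  qed (use fJ in simp)
  from card_independent_le_pi_dim[OF FPi this] show ?thesis
    by (simp add: card_image[OF injF] cJ m_def)
qed

section \<open>Averages over rotations\<close>

lemma trig_polynomial_add:
  assumes "trig_polynomial m q" "trig_polynomial m r" shows "trig_polynomial m (\<lambda>t. q t + r t)"
proof -
  from assms obtain c e where "\<And>t. q t = (\<Sum>k\<in>{-int m..int m}. c k * cis (of_int k * t))"
    "\<And>t. r t = (\<Sum>k\<in>{-int m..int m}. e k * cis (of_int k * t))"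
    by (auto simp: trig_polynomial_def)
  then show ?thesis
    unfolding trig_polynomial_def
    by (intro exI[of _ "\<lambda>k. c k + e k"]) (simp add: distrib_right sum.distrib)
qed

lemma trig_polynomial_cis:
  assumes "\<bar>k\<bar> \<le> int m" shows "trig_polynomial m (\<lambda>t. a * cis (of_int k * t))"
  unfolding trig_polynomial_def
proof (intro exI allI)
  fix t
  have "(\<Sum>i\<in>{-int m..int m}. (if i = k then a else 0) * cis (of_int i * t)) =
    (\<Sum>i\<in>{-int m..int m}. if i = k then a * cis (of_int k * t) else 0)"
    by (intro sum.cong) auto
  then show "a * cis (of_int k * t) = (\<Sum>i\<in>{-int m..int m}. (if i = k then a else 0) * cis (of_int i * t))"
    using assms by (auto simp: abs_le_iff)
qed

lemma trig_polynomial_sum_cis: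
  assumes "finite I" "\<And>i. i \<in> I \<Longrightarrow> \<bar>\<kappa> i\<bar> \<le> int m"
  shows "trig_polynomial m (\<lambda>t. \<Sum>i\<in>I. a i * cis (of_int (\<kappa> i) * t))"
  using assms
proof (induction I)
  case empty
  show ?case using trig_polynomial_cis[of 0 m 0] by simp
next
  case (insert i I)
  then show ?case by (simp add: trig_polynomial_add trig_polynomial_cis)
qed

text \<open>The cosine and the sine are combinations of \<open>cis t\<close> and
  \<open>cis (- t)\<close>, which shift every frequency by one.\<close>

lemma trig_polynomial_mult:
  assumes "trig_polynomial m q"
  shows "trig_polynomial (Suc m) (\<lambda>t. of_real (A + B * cos t + C * sin t) * q t)"
proof -
  from assms obtain c where c: "\<And>t. q t = (\<Sum>k\<in>{-int m..int m}. c k * cis (of_int k * t))"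
    by (auto simp: trig_polynomial_def)
  define P where "P = of_real B / 2 - \<i> * of_real C / 2"
  define P' where "P' = of_real B / 2 + \<i> * of_real C / 2"
  have e: "of_real (A + B * cos t + C * sin t) = of_real A + P * cis t + P' * cis (- t)" for t
    by (simp add: P_def P'_def complex_eq_iff)
  have "of_real (A + B * cos t + C * sin t) * (c k * cis (of_int k * t)) =
      (of_real A * c k) * cis (of_int k * t) + (P * c k) * cis (of_int (k + 1) * t) +
      (P' * c k) * cis (of_int (k - 1) * t)" for k t
  proof -
    have "cis (of_int (k + 1) * t) = cis t * cis (of_int k * t)"
      "cis (of_int (k - 1) * t) = cis (- t) * cis (of_int k * t)"
      unfolding cis_mult by (simp_all add: algebra_simps)
    then show ?thesis unfolding e by (simp only:) (simp add: algebra_simps)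
  qed
  then have "of_real (A + B * cos t + C * sin t) * q t =
      (\<Sum>k\<in>{-int m..int m}. (of_real A * c k) * cis (of_int k * t)) +
      (\<Sum>k\<in>{-int m..int m}. (P * c k) * cis (of_int (k + 1) * t)) +
      (\<Sum>k\<in>{-int m..int m}. (P' * c k) * cis (of_int (k - 1) * t))" for t
    unfolding c sum_distrib_left by (simp only: sum.distrib)
  then show ?thesis
    by (simp only:) (intro trig_polynomial_add trig_polynomial_sum_cis; auto)
qed

lemma sum_squares_rotation:
  fixes u v :: real
  shows "(cos t * u - sin t * v)\<^sup>2 + (cos t * v + sin t * u)\<^sup>2 = u\<^sup>2 + v\<^sup>2"
proof -
  have "(c * u - s * v)\<^sup>2 + (c * v + s * u)\<^sup>2 = (c\<^sup>2 + s\<^sup>2) * (u\<^sup>2 + v\<^sup>2)" for c s :: real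
    by (simp add: power2_eq_square algebra_simps)
  from this[of "cos t" "sin t"] show ?thesis by simp
qed

section \<open>Rotations in coordinate planes\<close>

text \<open>Rotation by \<open>t\<close> in the plane of \<open>k\<close> and \<open>b\<close>,
  written as a correction of the identity: every linear form of the image is then visibly affine in
  cos t and sin t.\<close>

definition givens :: "'a::euclidean_space \<Rightarrow> 'a \<Rightarrow> real \<Rightarrow> 'a \<Rightarrow> 'a" where
  "givens k b t x = x + ((cos t - 1) * (x \<bullet> k) - sin t * (x \<bullet> b)) *\<^sub>R k
    + ((cos t - 1) * (x \<bullet> b) + sin t * (x \<bullet> k)) *\<^sub>R b"

lemma linear_givens: "linear (givens k b t)"
  by (rule linearI) (simp_all add: givens_def algebra_simps)

lemma givens_inner:
  assumes "k \<in> Basis" "b \<in> Basis" "k \<noteq> b"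
  shows "givens k b t x \<bullet> k = cos t * (x \<bullet> k) - sin t * (x \<bullet> b)"
    and "givens k b t x \<bullet> b = cos t * (x \<bullet> b) + sin t * (x \<bullet> k)"
    and "c \<in> Basis \<Longrightarrow> c \<noteq> k \<Longrightarrow> c \<noteq> b \<Longrightarrow> givens k b t x \<bullet> c = x \<bullet> c"
  using assms by (auto simp: givens_def inner_Basis algebra_simps)

lemma orthogonal_transformation_givens:
  assumes "k \<in> Basis" "b \<in> Basis" "k \<noteq> b"
  shows "orthogonal_transformation (givens k b t)"
  unfolding orthogonal_transformation
proof (intro conjI allI linear_givens)
  fix x :: 'a
  let ?R = "Basis - {k} - {b}"
  have split: "y \<bullet> y = (y \<bullet> k)\<^sup>2 + ((y \<bullet> b)\<^sup>2 + (\<Sum>c\<in>?R. (y \<bullet> c)\<^sup>2))" for y :: 'a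
  proof -
    have "y \<bullet> y = (\<Sum>c\<in>Basis. (y \<bullet> c)\<^sup>2)" by (subst euclidean_inner) (simp add: power2_eq_square)
    also have "\<dots> = (y \<bullet> k)\<^sup>2 + (\<Sum>c\<in>Basis - {k}. (y \<bullet> c)\<^sup>2)"
      using assms by (simp add: sum.remove)
    also have "(\<Sum>c\<in>Basis - {k}. (y \<bullet> c)\<^sup>2) = (y \<bullet> b)\<^sup>2 + (\<Sum>c\<in>?R. (y \<bullet> c)\<^sup>2)"
      using assms by (intro sum.remove) auto
    finally show ?thesis .
  qed
  have "(\<Sum>c\<in>?R. (givens k b t x \<bullet> c)\<^sup>2) = (\<Sum>c\<in>?R. (x \<bullet> c)\<^sup>2)"
    using givens_inner(3)[OF assms] by (intro sum.cong) auto
  then have "givens k b t x \<bullet> givens k b t x = x \<bullet> x"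
    unfolding split[of "givens k b t x"] split[of x] givens_inner(1,2)[OF assms]
    by (simp add: add.assoc[symmetric] sum_squares_rotation)
  then show "norm (givens k b t x) = norm x" by (simp add: norm_eq_sqrt_inner)
qed

lemma trig_polynomial_givens:
  assumes "poly_le m f" shows "trig_polynomial m (\<lambda>t. f (givens k b t x))"
  using assms
proof (induction rule: poly_le.induct)
  case (poly_le_const m c)
  show ?case using trig_polynomial_cis[of 0 m c] by simp
next
  case (poly_le_inner m f v)
  have "givens k b t x \<bullet> v = (x \<bullet> v - (x \<bullet> k) * (k \<bullet> v) - (x \<bullet> b) * (b \<bullet> v)) +
      ((x \<bullet> k) * (k \<bullet> v) + (x \<bullet> b) * (b \<bullet> v)) * cos t + ((x \<bullet> k) * (b \<bullet> v) - (x \<bullet> b) * (k \<bullet> v)) * sin t" for t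
    by (simp add: givens_def algebra_simps)
  then show ?case by (simp only: trig_polynomial_mult[OF poly_le_inner.IH])
next
  case (poly_le_add m f g)
  then show ?case by (intro trig_polynomial_add)
qed

definition powr_norm :: "real \<Rightarrow> ('a \<Rightarrow> complex) \<Rightarrow> 'a \<Rightarrow> ennreal" where
  "powr_norm p f x = ennreal (norm (f x) powr p)"

definition average :: "nat \<Rightarrow> 'a::euclidean_space \<Rightarrow> 'a \<Rightarrow> ('a \<Rightarrow> ennreal) \<Rightarrow> 'a \<Rightarrow> ennreal" where
  "average L k b G y = (\<Sum>j\<in>{-int (2*L)..int (2*L)}. ennreal (weight j) * G (givens k b (node L j) y))"

primrec averages :: "nat \<Rightarrow> 'a::euclidean_space \<Rightarrow> 'a list \<Rightarrow> ('a \<Rightarrow> ennreal) \<Rightarrow> 'a \<Rightarrow> ennreal" where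
  "averages L k [] G = G"
| "averages L k (b # bs) G = average L k b (averages L k bs G)"

text \<open>The head of the list is the rotation applied first, in step with the recursion of
  \<open>averages\<close>. The angles are free within \<open>\<eta>\<close>, while
  \<open>averages\<close> depends on the planes only, so one average serves all these
  compositions.\<close>

inductive small_rotations :: "real \<Rightarrow> 'a::euclidean_space \<Rightarrow> 'a list \<Rightarrow> ('a \<Rightarrow> 'a) \<Rightarrow> bool"
  for \<eta> k where
  small_rotations_Nil: "small_rotations \<eta> k [] (\<lambda>x. x)"
| small_rotations_Cons: "small_rotations \<eta> k bs R \<Longrightarrow> \<bar>t\<bar> \<le> \<eta> \<Longrightarrow>
    small_rotations \<eta> k (b # bs) (\<lambda>x. R (givens k b t x))"

lemma small_rotations_linear: "small_rotations \<eta> k bs R \<Longrightarrow> linear R"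
proof (induction rule: small_rotations.induct)
  case (small_rotations_Cons bs R t b)
  then show ?case using linear_compose[OF linear_givens small_rotations_Cons.IH] by (simp add: o_def)
qed (simp add: linear_iff)

lemma powr_norm_le_average:
  assumes "1 \<le> p" "poly_le L f" "\<bar>t\<bar> \<le> pi / (4 * real L + 1)"
  shows "powr_norm p f (givens k b t y) \<le> ennreal (9 powr p) * average L k b (powr_norm p f) y"
proof -
  have "powr_norm p f (givens k b t y) \<le> ennreal (9 powr p *
      (\<Sum>j\<in>{-int (2*L)..int (2*L)}. weight j * norm (f (givens k b (node L j) y)) powr p))"
    unfolding powr_norm_def
    by (intro ennreal_leI norm_trig_polynomial_powr_le[OF assms(1) trig_polynomial_givens[OF assms(2)] assms(3)])
  also have "\<dots> = ennreal (9 powr p) * average L k b (powr_norm p f) y"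
    unfolding average_def powr_norm_def
    by (simp add: ennreal_mult sum_nonneg weight_nonneg flip: sum_ennreal)
  finally show ?thesis .
qed

text \<open>The later rotations \<open>R\<close> are linear, so f composed with \<open>R\<close> is
  still a polynomial of degree at most L. The bound for one rotation applies to it, and the
  induction hypothesis is then used at every rotated node.\<close>

lemma powr_norm_le_averages:
  assumes "small_rotations \<eta> k bs R" "1 \<le> p" "poly_le L f" "\<eta> \<le> pi / (4 * real L + 1)"
  shows "powr_norm p f (R y) \<le> ennreal (9 powr p) ^ length bs * averages L k bs (powr_norm p f) y"
  using assms(1)
proof (induction arbitrary: y rule: small_rotations.induct)
  case (small_rotations_Cons bs R t b)
  have "powr_norm p f (R (givens k b t y)) = powr_norm p (\<lambda>x. f (R x)) (givens k b t y)"
    by (simp add: powr_norm_def)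
  also have "\<dots> \<le> ennreal (9 powr p) * average L k b (powr_norm p (\<lambda>x. f (R x))) y"
    using small_rotations_Cons.hyps(2) assms(4)
    by (intro powr_norm_le_average[OF assms(2)
          poly_le_linear[OF small_rotations_linear[OF small_rotations_Cons.hyps(1)] assms(3)]]) simp
  also have "\<dots> \<le> ennreal (9 powr p) * average L k b (\<lambda>x. ennreal (9 powr p) ^ length bs * averages L k bs (powr_norm p f) x) y"
    unfolding average_def
    by (intro mult_left_mono sum_mono order_trans[OF _ small_rotations_Cons.IH]) (auto simp: powr_norm_def)
  also have "\<dots> = ennreal (9 powr p) ^ length (b # bs) * averages L k (b # bs) (powr_norm p f) y"
    by (simp add: average_def sum_distrib_left mult_ac)
  finally show ?case .
qed simp

lemma averages_measurable_nn_integral: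
  fixes k :: "'a::euclidean_space"
  assumes "k \<in> Basis" "set bs \<subseteq> Basis - {k}" "G \<in> borel_measurable surface_measure"
  shows "averages L k bs G \<in> borel_measurable surface_measure \<and>
    (\<integral>\<^sup>+x. averages L k bs G x \<partial>surface_measure) \<le> 9 ^ length bs * (\<integral>\<^sup>+x. G x \<partial>surface_measure)"
  using assms(2)
proof (induction bs)
  case (Cons b bs)
  let ?G = "averages L k bs G" and ?J = "{-int (2*L)..int (2*L)}"
  have IH: "?G \<in> borel_measurable surface_measure"
    "(\<integral>\<^sup>+x. ?G x \<partial>surface_measure) \<le> 9 ^ length bs * (\<integral>\<^sup>+x. G x \<partial>surface_measure)"
    using Cons by auto
  have orth: "orthogonal_transformation (givens k b t)" for t
    using Cons.prems assms(1) by (intro orthogonal_transformation_givens) auto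
  have [measurable]: "(\<lambda>x. ?G (givens k b t x)) \<in> borel_measurable surface_measure" for t
    by (rule measurable_compose[OF measurable_surface_measure_orthogonal[OF orth] IH(1)])
  have meas: "averages L k (b # bs) G \<in> borel_measurable surface_measure"
    unfolding averages.simps average_def[abs_def] by measurable
  have "(\<integral>\<^sup>+x. averages L k (b # bs) G x \<partial>surface_measure) =
      (\<Sum>j\<in>?J. ennreal (weight j) * (\<integral>\<^sup>+x. ?G x \<partial>surface_measure))"
    by (simp add: average_def nn_integral_sum nn_integral_cmult nn_integral_surface_measure_orthogonal[OF orth IH(1)])
  also have "\<dots> = ennreal (\<Sum>j\<in>?J. weight j) * (\<integral>\<^sup>+x. ?G x \<partial>surface_measure)"
    by (simp add: sum_distrib_right weight_nonneg flip: sum_ennreal)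
  also have "\<dots> \<le> ennreal 9 * (9 ^ length bs * (\<integral>\<^sup>+x. G x \<partial>surface_measure))"
    using sum_weight_le[of "2*L"] by (intro mult_mono IH ennreal_leI) (auto intro: order_trans)
  finally show ?case using meas by (simp add: mult.assoc)
qed (use assms in simp)

section \<open>Small rotations reach all nearby points\<close>

text \<open>Intermediate value theorem for the coordinate \<open>b\<close> as a function of the
  angle: between -eta and eta it covers an interval of half-width at least a eta / 4 around its
  start. Angles this small cannot change the sign of the coordinate \<open>k\<close>.\<close>

lemma givens_attains:
  fixes x :: "'a::euclidean_space"
  assumes kb: "k \<in> Basis" "b \<in> Basis" "k \<noteq> b" and x: "norm x = 1"
    and a: "0 < a" "a \<le> \<bar>x \<bullet> k\<bar>" and \<eta>: "0 \<le> \<eta>" "\<eta> \<le> a / 2" "a \<le> 1"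
    and v: "\<bar>v - x \<bullet> b\<bar> \<le> a * \<eta> / 4"
  shows "\<exists>t. \<bar>t\<bar> \<le> \<eta> \<and> givens k b t x \<bullet> b = v \<and> 0 < (x \<bullet> k) * (givens k b t x \<bullet> k)"
proof -
  let ?u = "x \<bullet> k" and ?w = "x \<bullet> b"
  have xb: "\<bar>?w\<bar> \<le> 1" "\<bar>?u\<bar> \<le> 1" using Basis_le_norm[OF kb(2), of x] Basis_le_norm[OF kb(1), of x] x by auto
  let ?g = "\<lambda>t. cos t * ?w + sin t * ?u"
  have sine: "\<eta> / 2 \<le> sin \<eta>"
  proof -
    have "\<bar>2 * \<eta>\<bar> \<le> pi" using \<eta> pi_gt3 by auto
    from abs_sin_half_ge[OF this] have "2 * \<eta> / pi \<le> \<bar>sin \<eta>\<bar>" using \<eta> by simp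
    moreover have "0 \<le> sin \<eta>" using \<eta> pi_gt3 by (intro sin_ge_zero) auto
    moreover have "\<eta> / 2 \<le> 2 * \<eta> / pi" using \<eta> pi_less_4 mult_right_mono[of pi 4 \<eta>] by (simp add: field_simps)
    ultimately show ?thesis by simp
  qed
  \<comment> \<open>The gain |x . k| sin eta is at least a eta / 2, and the loss 1 - cos eta is at
    most eta^2 / 2, hence at most a eta / 4.\<close>
  have key: "a * \<eta> / 4 \<le> \<bar>?u\<bar> * sin \<eta> - (1 - cos \<eta>)"
  proof -
    have "\<eta>\<^sup>2 / 2 \<le> a * \<eta> / 4" using \<eta> mult_right_mono[of \<eta> "a/2" \<eta>] by (simp add: power2_eq_square)
    moreover have "a * (\<eta> / 2) \<le> \<bar>?u\<bar> * sin \<eta>" using a \<eta> sine by (intro mult_mono) auto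
    ultimately show ?thesis using one_minus_cos_le[of \<eta>] by simp
  qed
  have wb: "\<bar>(1 - cos \<eta>) * ?w\<bar> \<le> 1 - cos \<eta>"
    using xb mult_left_mono[of "\<bar>?w\<bar>" 1 "1 - cos \<eta>"] by (simp add: abs_mult)
  have cont: "continuous_on {-\<eta>..\<eta>} ?g" by (intro continuous_intros)
  have g: "?g \<eta> = ?w - (1 - cos \<eta>) * ?w + sin \<eta> * ?u" "?g (-\<eta>) = ?w - (1 - cos \<eta>) * ?w - sin \<eta> * ?u"
    by (simp_all add: algebra_simps)
  have "\<exists>t. -\<eta> \<le> t \<and> t \<le> \<eta> \<and> ?g t = v"
  proof (cases "?u > 0")
    case True
    then have "\<bar>?u\<bar> * sin \<eta> = sin \<eta> * ?u" by simp
    then have "?g (-\<eta>) \<le> v" "v \<le> ?g \<eta>"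
      unfolding g using v key wb by linarith+
    then show ?thesis using IVT'[of ?g "-\<eta>" v \<eta>] cont \<eta> by auto
  next
    case False
    then have "\<bar>?u\<bar> * sin \<eta> = - (sin \<eta> * ?u)" by simp
    then have "?g \<eta> \<le> v" "v \<le> ?g (-\<eta>)"
      unfolding g using v key wb by linarith+
    then show ?thesis using IVT2'[of ?g \<eta> v "-\<eta>"] cont \<eta> by auto
  qed
  then obtain t where "- \<eta> \<le> t" "t \<le> \<eta>" and gt: "?g t = v" by blast
  then have t: "\<bar>t\<bar> \<le> \<eta>" by linarith
  have "0 < (x \<bullet> k) * (givens k b t x \<bullet> k)"
  proof -
    have "\<bar>t\<bar> \<le> 1 / 2" using t \<eta> by linarith
    then have "t\<^sup>2 \<le> 1 / 4" using power_mono[of "\<bar>t\<bar>" "1 / 2" 2] by (simp add: power2_eq_square)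
    then have c: "7 / 8 \<le> cos t" using one_minus_cos_le[of t] by linarith
    have "\<bar>sin t * ?w\<bar> \<le> \<bar>t\<bar> * 1"
      unfolding abs_mult using abs_sin_x_le_abs_x[of t] xb by (intro mult_mono) auto
    also have "\<dots> \<le> \<bar>?u\<bar> / 2" using t \<eta> a by simp
    finally have s: "\<bar>sin t * ?w\<bar> \<le> \<bar>?u\<bar> / 2" .
    have u0: "0 < \<bar>?u\<bar>" using a by linarith
    have "\<bar>?u * (sin t * ?w)\<bar> \<le> \<bar>?u\<bar> * (\<bar>?u\<bar> / 2)" unfolding abs_mult[of ?u] using s by (intro mult_left_mono) auto
    moreover have "7 / 8 * (\<bar>?u\<bar> * \<bar>?u\<bar>) \<le> cos t * (\<bar>?u\<bar> * \<bar>?u\<bar>)" using c by (intro mult_right_mono) auto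
    moreover have "0 < \<bar>?u\<bar> * \<bar>?u\<bar>" by (rule mult_pos_pos[OF u0 u0])
    ultimately have "0 < cos t * (\<bar>?u\<bar> * \<bar>?u\<bar>) - ?u * (sin t * ?w)" by linarith
    then show ?thesis unfolding givens_inner(1)[OF kb] by (simp add: algebra_simps)
  qed
  then show ?thesis using t gt unfolding givens_inner(2)[OF kb] by blast
qed

text \<open>Each rotation fixes up one coordinate and disturbs only coordinate \<open>k\<close>,
  whose square changes by at most 2 (a eta / 4). The last hypothesis is a budget for these changes:
  it keeps |x . k| >= a before every remaining rotation.\<close>

lemma small_rotations_match_coordinates:
  fixes x z :: "'a::euclidean_space"
  assumes k: "k \<in> Basis" and a: "0 < a" "a \<le> 1" and \<eta>: "0 \<le> \<eta>" "\<eta> \<le> a / 2" and z: "norm z = 1"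
    and "distinct bs" "set bs \<subseteq> Basis - {k}" "norm x = 1"
    and "\<And>b. b \<in> set bs \<Longrightarrow> \<bar>z \<bullet> b - x \<bullet> b\<bar> \<le> a * \<eta> / 4"
    and "a\<^sup>2 + 2 * (a * \<eta> / 4) * length bs \<le> (x \<bullet> k)\<^sup>2"
  shows "\<exists>R. small_rotations \<eta> k bs R \<and> norm (R x) = 1 \<and> (\<forall>b\<in>set bs. R x \<bullet> b = z \<bullet> b) \<and>
    (\<forall>c\<in>Basis - {k} - set bs. R x \<bullet> c = x \<bullet> c) \<and> 0 < (x \<bullet> k) * (R x \<bullet> k)"
  using assms(7-11)
proof (induction bs arbitrary: x)
  case Nil
  have "0 < (x \<bullet> k)\<^sup>2" using Nil a by (simp add: power2_eq_square) (metis less_le_trans mult_pos_pos)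
  then show ?case using Nil.prems
    by (intro exI[of _ "\<lambda>x. x"]) (auto intro: small_rotations_Nil simp: power2_eq_square)
next
  case (Cons b bs)
  let ?\<delta> = "a * \<eta> / 4"
  have b: "b \<in> Basis" "k \<noteq> b" using Cons.prems by auto
  have "0 \<le> 2 * ?\<delta> * length (b # bs)" using a \<eta> by (intro mult_nonneg_nonneg) auto
  then have "a\<^sup>2 \<le> (x \<bullet> k)\<^sup>2" using Cons.prems(5) by linarith
  then have "a \<le> \<bar>x \<bullet> k\<bar>" using a by (simp add: abs_le_square_iff[symmetric])
  from givens_attains[OF k b Cons.prems(3) a(1) this \<eta> a(2), of "z \<bullet> b"] Cons.prems(4)[of b]
  obtain t where t: "\<bar>t\<bar> \<le> \<eta>" "givens k b t x \<bullet> b = z \<bullet> b" "0 < (x \<bullet> k) * (givens k b t x \<bullet> k)" by auto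
  let ?x = "givens k b t x"
  have other: "?x \<bullet> c = x \<bullet> c" if "c \<in> Basis" "c \<noteq> k" "c \<noteq> b" for c
    using givens_inner(3)[OF k b that] .
  have nx: "norm ?x = 1"
    using orthogonal_transformation_givens[OF k b, of t] Cons.prems(3) by (simp add: orthogonal_transformation)
  have "(?x \<bullet> k)\<^sup>2 + (?x \<bullet> b)\<^sup>2 = (x \<bullet> k)\<^sup>2 + (x \<bullet> b)\<^sup>2"
    unfolding givens_inner(1,2)[OF k b] by (rule sum_squares_rotation)
  then have "(?x \<bullet> k)\<^sup>2 = (x \<bullet> k)\<^sup>2 + ((x \<bullet> b)\<^sup>2 - (z \<bullet> b)\<^sup>2)" using t(2) by simp
  have "\<bar>(x \<bullet> b)\<^sup>2 - (z \<bullet> b)\<^sup>2\<bar> \<le> 2 * ?\<delta>"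
  proof -
    have "\<bar>(x \<bullet> b)\<^sup>2 - (z \<bullet> b)\<^sup>2\<bar> = \<bar>x \<bullet> b + z \<bullet> b\<bar> * \<bar>z \<bullet> b - x \<bullet> b\<bar>"
      by (simp add: power2_eq_square algebra_simps flip: abs_mult)
    also have "\<dots> \<le> 2 * ?\<delta>"
      using Basis_le_norm[OF b(1), of x] Basis_le_norm[OF b(1), of z] z Cons.prems(3,4)
      by (intro mult_mono) auto
    finally show ?thesis .
  qed
  have "a\<^sup>2 + 2 * ?\<delta> * length bs \<le> (?x \<bullet> k)\<^sup>2"
  proof -
    have "2 * ?\<delta> * length (b # bs) = 2 * ?\<delta> * length bs + 2 * ?\<delta>" by (simp add: field_simps)
    moreover have "(?x \<bullet> k)\<^sup>2 = (x \<bullet> k)\<^sup>2 + ((x \<bullet> b)\<^sup>2 - (z \<bullet> b)\<^sup>2)" "\<bar>(x \<bullet> b)\<^sup>2 - (z \<bullet> b)\<^sup>2\<bar> \<le> 2 * ?\<delta>" by fact+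
    ultimately show ?thesis using Cons.prems(5) by linarith
  qed
  moreover have "\<bar>z \<bullet> c - ?x \<bullet> c\<bar> \<le> ?\<delta>" if "c \<in> set bs" for c
    using that Cons.prems(1,2,4) by (subst other) auto
  ultimately obtain R where R: "small_rotations \<eta> k bs R" "norm (R ?x) = 1" "\<forall>b\<in>set bs. R ?x \<bullet> b = z \<bullet> b"
    "\<forall>c\<in>Basis - {k} - set bs. R ?x \<bullet> c = ?x \<bullet> c" "0 < (?x \<bullet> k) * (R ?x \<bullet> k)"
    using Cons.IH[of ?x] Cons.prems(1,2) nx by auto
  show ?case
  proof (intro exI conjI)
    show "small_rotations \<eta> k (b # bs) (\<lambda>x. R (givens k b t x))"
      by (rule small_rotations_Cons[OF R(1) t(1)])
    show "\<forall>c\<in>set (b # bs). R ?x \<bullet> c = z \<bullet> c" using R(3,4) t(2) b Cons.prems(1) by auto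
    show "\<forall>c\<in>Basis - {k} - set (b # bs). R ?x \<bullet> c = x \<bullet> c" using R(4) other by auto
    show "0 < (x \<bullet> k) * (R ?x \<bullet> k)" using R(5) t(3) by (auto simp: zero_less_mult_iff)
  qed (rule R(2))
qed

lemma exists_large_coordinate:
  fixes x :: "'a::euclidean_space"
  assumes "norm x = 1" shows "\<exists>k\<in>Basis. 1 / DIM('a) \<le> (x \<bullet> k)\<^sup>2"
proof (rule ccontr)
  assume "\<not> ?thesis"
  then have "(\<Sum>k\<in>(Basis::'a set). (x \<bullet> k)\<^sup>2) < (\<Sum>k\<in>(Basis::'a set). 1 / DIM('a))"
    by (intro sum_strict_mono) auto
  moreover have "(\<Sum>k\<in>Basis. (x \<bullet> k)\<^sup>2) = (norm x)\<^sup>2"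
    unfolding power2_norm_eq_inner euclidean_inner[of x x] by (simp add: power2_eq_square)
  ultimately show False using assms by simp
qed

text \<open>Once all other coordinates agree, the unit norm gives agreement of coordinate
  \<open>k\<close> up to sign. The sign is right because both \<open>R x\<close> and
  \<open>z\<close> have there the sign of \<open>x\<close>: the rotations keep it, and
  \<open>z\<close> is closer to \<open>x\<close> than |x . k|.\<close>

lemma small_rotations_reach:
  fixes x z :: "'a::euclidean_space"
  defines "a \<equiv> 1 / (2 * real DIM('a))"
  assumes k: "k \<in> Basis" "1 / DIM('a) \<le> (x \<bullet> k)\<^sup>2" and xz: "norm x = 1" "norm z = 1"
    and \<eta>: "0 \<le> \<eta>" "\<eta> \<le> a / 2" and close: "norm (z - x) \<le> a * \<eta> / 4"
    and bs: "distinct bs" "set bs = Basis - {k}"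
  shows "\<exists>R. small_rotations \<eta> k bs R \<and> R x = z"
proof -
  let ?n = "real DIM('a)"
  have n: "1 \<le> ?n" using DIM_positive[where 'a='a] by linarith
  have n2: "0 < 2 * ?n" using n by linarith
  have a: "0 < a" "a \<le> 1"
    unfolding a_def divide_le_eq_1_pos[OF n2] using n by (simp, linarith)
  have len: "real (length bs) \<le> ?n"
    using bs card_mono[of "Basis :: 'a set" "Basis - {k}"] by (simp add: distinct_card[symmetric])
  have a\<eta>: "a * \<eta> \<le> a * (a / 2)" using \<eta> a by (intro mult_left_mono) auto
  have nearb: "\<bar>z \<bullet> b - x \<bullet> b\<bar> \<le> a * \<eta> / 4" if "b \<in> Basis" for b
    using Basis_le_norm[OF that, of "z - x"] close by (simp add: inner_diff_left)
  \<comment> \<open>With n the dimension, a^2 is at most 1/(4n) and the losses of all rotations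
    together at most 1/(16n), well within 1/n.\<close>
  have large: "a\<^sup>2 + 2 * (a * \<eta> / 4) * length bs \<le> (x \<bullet> k)\<^sup>2"
  proof -
    have "2 * (a * \<eta> / 4) * length bs \<le> (a * (a / 2) / 2) * ?n"
      using a\<eta> len a \<eta> by (intro mult_mono) auto
    also have "\<dots> = 1 / (16 * ?n)" using n by (simp add: a_def field_simps)
    finally have 1: "2 * (a * \<eta> / 4) * length bs \<le> 1 / (16 * ?n)" .
    have "a\<^sup>2 \<le> 1 / (4 * ?n)" using n by (simp add: a_def power2_eq_square field_simps)
    with 1 have "a\<^sup>2 + 2 * (a * \<eta> / 4) * length bs \<le> 1 / (4 * ?n) + 1 / (16 * ?n)" by linarith
    also have "\<dots> \<le> 1 / ?n" using n by (simp add: field_simps)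
    finally show ?thesis using k(2) by linarith
  qed
  have sub: "set bs \<subseteq> Basis - {k}" and nb: "\<And>b. b \<in> set bs \<Longrightarrow> \<bar>z \<bullet> b - x \<bullet> b\<bar> \<le> a * \<eta> / 4"
    using bs(2) nearb by simp_all
  from small_rotations_match_coordinates[OF k(1) a \<eta> xz(2) bs(1) sub xz(1) nb large]
  obtain R where R: "small_rotations \<eta> k bs R" "norm (R x) = 1" "\<forall>b\<in>set bs. R x \<bullet> b = z \<bullet> b"
    "0 < (x \<bullet> k) * (R x \<bullet> k)"
    by blast
  have "(R x \<bullet> k)\<^sup>2 = (z \<bullet> k)\<^sup>2"
    unfolding coordinate_power2_eq[OF k(1) R(2)] coordinate_power2_eq[OF k(1) xz(2)] using R(3) bs(2) by simp
  then have abs: "\<bar>R x \<bullet> k\<bar> = \<bar>z \<bullet> k\<bar>" by (simp add: abs_eq_iff power2_eq_iff)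
  have "a < \<bar>x \<bullet> k\<bar>"
  proof -
    have "a\<^sup>2 \<le> 1 / (4 * ?n)" using n by (simp add: a_def power2_eq_square field_simps)
    also have "\<dots> < 1 / ?n" using n2 by (simp add: field_simps)
    finally have "a\<^sup>2 < 1 / ?n" .
    then have "a\<^sup>2 < \<bar>x \<bullet> k\<bar>\<^sup>2" using k(2) by simp
    then show ?thesis by (rule power2_less_imp_less) simp
  qed
  moreover have "a * \<eta> / 4 \<le> a"
    using \<eta> a mult_left_mono[of \<eta> 1 a] by simp
  ultimately have "\<bar>z \<bullet> k - x \<bullet> k\<bar> < \<bar>x \<bullet> k\<bar>" using nearb[OF k(1)] by linarith
  then have "R x \<bullet> k = z \<bullet> k"
    using abs R(4) by (auto simp: abs_if zero_less_mult_iff split: if_splits)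
  then have "R x \<bullet> b = z \<bullet> b" if "b \<in> Basis" for b
    using R(3) bs(2) that by (cases "b = k") auto
  then have "R x = z" by (rule euclidean_eqI)
  then show ?thesis using R(1) by blast
qed

definition other_basis :: "'a::euclidean_space \<Rightarrow> 'a list" where
  "other_basis k = (SOME bs. distinct bs \<and> set bs = Basis - {k})"

lemma other_basis: "distinct (other_basis k)" "set (other_basis k) = Basis - {k}"
proof -
  have "\<exists>bs. distinct bs \<and> set bs = Basis - {k}"
    using finite_distinct_list[of "Basis - {k}"] by auto
  then have "distinct (other_basis k) \<and> set (other_basis k) = Basis - {k}"
    unfolding other_basis_def by (rule someI_ex)
  then show "distinct (other_basis k)" "set (other_basis k) = Basis - {k}" by auto
qed

lemma length_other_basis: "k \<in> Basis \<Longrightarrow> length (other_basis (k :: 'a::euclidean_space)) = DIM('a) - 1"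
  using other_basis[of k] distinct_card[of "other_basis k"] by simp

text \<open>
  The coordinate that is large at \<open>y\<close> depends on \<open>y\<close>, so the averages for all coordinates are added.
\<close>

definition local_average :: "nat \<Rightarrow> ('a::euclidean_space \<Rightarrow> ennreal) \<Rightarrow> 'a \<Rightarrow> ennreal" where
  "local_average L G y = (\<Sum>k\<in>Basis. averages L k (other_basis k) G y)"

lemma powr_norm_le_local_average:
  fixes y z :: "'a::euclidean_space"
  assumes p: "1 \<le> p" and f: "poly_le L f" and L: "1 \<le> L" and yz: "norm y = 1" "norm z = 1"
    and close: "dist z y \<le> 1 / (32 * (real DIM('a))\<^sup>2 * real L)"
  shows "powr_norm p f z \<le> ennreal (9 powr p) ^ (DIM('a) - 1) * local_average L (powr_norm p f) y"
proof -
  let ?n = "real DIM('a)"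
  \<comment> \<open>With a = 1/(2n) this is a / (2L): small enough for
    \<open>small_rotations_reach\<close> and at most pi/(4L+1), as the node estimate requires; a eta
    / 4 is the radius in the hypothesis.\<close>
  define \<eta> where "\<eta> = 1 / (4 * ?n * real L)"
  have n: "1 \<le> ?n" using DIM_positive[where 'a='a] by linarith
  have L': "1 \<le> real L" using L by simp
  obtain k :: 'a where k: "k \<in> Basis" "1 / DIM('a) \<le> (y \<bullet> k)\<^sup>2"
    using exists_large_coordinate[OF yz(1)] by blast
  have \<eta>: "0 \<le> \<eta>" "\<eta> \<le> 1 / (2 * ?n) / 2" using n L' by (auto simp: \<eta>_def field_simps)
  have "norm (z - y) \<le> 1 / (2 * ?n) * \<eta> / 4"
    using close by (simp add: \<eta>_def dist_norm power2_eq_square mult_ac)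
  from small_rotations_reach[OF k yz \<eta> this other_basis]
  obtain R where R: "small_rotations \<eta> k (other_basis k) R" "R y = z" by blast
  have "4 * real L + 1 \<le> 4 * ?n * real L * pi"
  proof -
    have "4 * real L + 1 \<le> 8 * real L" using L' by simp
    also have "\<dots> \<le> 4 * pi * real L" using L' pi_gt3 by (intro mult_right_mono) auto
    also have "\<dots> \<le> ?n * (4 * pi * real L)" using n L' mult_right_mono[of 1 ?n "4 * pi * real L"] by simp
    finally show ?thesis by (simp add: mult_ac)
  qed
  then have "\<eta> \<le> pi / (4 * real L + 1)" using n L' by (simp add: \<eta>_def field_simps)
  from powr_norm_le_averages[OF R(1) p f this, of y]
  have "powr_norm p f z \<le> ennreal (9 powr p) ^ (DIM('a) - 1) * averages L k (other_basis k) (powr_norm p f) y"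
    by (simp add: R(2) length_other_basis k)
  also have "\<dots> \<le> ennreal (9 powr p) ^ (DIM('a) - 1) * local_average L (powr_norm p f) y"
    unfolding local_average_def using k by (intro mult_left_mono member_le_sum) auto
  finally show ?thesis .
qed

lemma local_average_measurable_nn_integral:
  fixes G :: "'a::euclidean_space \<Rightarrow> ennreal"
  assumes "G \<in> borel_measurable surface_measure"
  shows "local_average L G \<in> borel_measurable surface_measure"
    and "(\<integral>\<^sup>+x. local_average L G x \<partial>surface_measure) \<le> of_nat DIM('a) * 9 ^ (DIM('a) - 1) * (\<integral>\<^sup>+x. G x \<partial>surface_measure)"
proof -
  have a: "averages L k (other_basis k) G \<in> borel_measurable surface_measure"
    "(\<integral>\<^sup>+x. averages L k (other_basis k) G x \<partial>surface_measure) \<le> 9 ^ (DIM('a) - 1) * (\<integral>\<^sup>+x. G x \<partial>surface_measure)"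
    if "k \<in> Basis" for k :: 'a
    using averages_measurable_nn_integral[OF that _ assms, of "other_basis k" L] that other_basis(2)[of k] length_other_basis[OF that] by auto
  show "local_average L G \<in> borel_measurable surface_measure"
    unfolding local_average_def[abs_def] using a(1) by (intro borel_measurable_sum)
  have "(\<integral>\<^sup>+x. local_average L G x \<partial>surface_measure) = (\<Sum>k\<in>Basis. \<integral>\<^sup>+x. averages L k (other_basis k) G x \<partial>surface_measure)"
    unfolding local_average_def using a(1) by (intro nn_integral_sum)
  also have "\<dots> \<le> (\<Sum>k\<in>(Basis::'a set). 9 ^ (DIM('a) - 1) * (\<integral>\<^sup>+x. G x \<partial>surface_measure))"
    by (intro sum_mono a(2))
  finally show "(\<integral>\<^sup>+x. local_average L G x \<partial>surface_measure) \<le> of_nat DIM('a) * 9 ^ (DIM('a) - 1) * (\<integral>\<^sup>+x. G x \<partial>surface_measure)"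
    by (simp add: mult.assoc)
qed

section \<open>Sufficiency of the cap condition\<close>

lemma space_eq_unit_sphere:
  assumes "sets M = sets sphere_borel" shows "space M = unit_sphere"
  using sets_eq_imp_space_eq[OF assms] by (simp add: space_restrict_space)

lemma id_measurable_sphere_borel:
  assumes "sets M = sets sphere_borel" shows "(\<lambda>x. x) \<in> M \<rightarrow>\<^sub>M borel"
  using measurable_restrict_space1[OF measurable_ident, of borel unit_sphere]
  by (subst measurable_cong_sets[OF assms refl]) (simp add: id_def)

text \<open>Double counting: the integral of H(y) over pairs (z, y) at distance below r is at least
  \<open>c\<close> times the integral of G (fix z) and at most \<open>m\<close> times the integral
  of H (fix y). Finiteness of both measures justifies the exchange of integrals.\<close>

lemma nn_integral_le_by_local_bound:
  fixes \<mu> :: "'a::euclidean_space measure" and G H :: "'a \<Rightarrow> ennreal"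
  assumes sets: "sets \<mu> = sets sphere_borel" and fin: "finite_measure \<mu>"
    and G: "G \<in> borel_measurable surface_measure" and H: "H \<in> borel_measurable surface_measure"
    and le: "\<And>y z. y \<in> unit_sphere \<Longrightarrow> z \<in> unit_sphere \<Longrightarrow> dist z y < r \<Longrightarrow> G z \<le> H y"
    and c: "\<And>z::'a. z \<in> unit_sphere \<Longrightarrow> c \<le> emeasure surface_measure (unit_sphere \<inter> ball z r)"
    and m: "\<And>z. z \<in> unit_sphere \<Longrightarrow> emeasure \<mu> (unit_sphere \<inter> ball z r) \<le> m"
  shows "c * (\<integral>\<^sup>+z. G z \<partial>\<mu>) \<le> m * (\<integral>\<^sup>+y. H y \<partial>surface_measure)"
proof -
  let ?\<sigma> = "surface_measure :: 'a measure"
  interpret mu: finite_measure \<mu> by fact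
  interpret sigma: finite_measure ?\<sigma> by (rule finite_measure_surface_measure)
  interpret pair_sigma_finite \<mu> ?\<sigma> ..
  have sp: "space \<mu> = unit_sphere" "space ?\<sigma> = unit_sphere"
    using space_eq_unit_sphere[OF sets] space_surface_measure by auto
  have [measurable]: "G \<in> borel_measurable \<mu>"
    using G measurable_cong_sets[OF trans[OF sets sets_surface_measure[symmetric]] refl] by blast
  note [measurable] = H id_measurable_sphere_borel[OF sets] id_measurable_sphere_borel[OF sets_surface_measure[where 'a='a]]
  have fs[measurable]: "fst \<in> \<mu> \<Otimes>\<^sub>M ?\<sigma> \<rightarrow>\<^sub>M borel" "snd \<in> \<mu> \<Otimes>\<^sub>M ?\<sigma> \<rightarrow>\<^sub>M borel"
    using measurable_compose[OF measurable_fst id_measurable_sphere_borel[OF sets], of ?\<sigma>]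
      measurable_compose[OF measurable_snd id_measurable_sphere_borel[OF sets_surface_measure[where 'a='a]], of \<mu>] by auto
  have pred: "Measurable.pred (\<mu> \<Otimes>\<^sub>M ?\<sigma>) (\<lambda>w. dist (fst w) (snd w) < r)" by measurable
  have meas: "(\<lambda>(z, y). H y * indicator {w. dist (fst w) (snd w) < r} (z, y)) \<in> borel_measurable (\<mu> \<Otimes>\<^sub>M ?\<sigma>)"
  proof -
    have "(\<lambda>w. H (snd w) * indicator {w \<in> space (\<mu> \<Otimes>\<^sub>M ?\<sigma>). dist (fst w) (snd w) < r} w) \<in> borel_measurable (\<mu> \<Otimes>\<^sub>M ?\<sigma>)"
      using pred measurable_compose[OF measurable_snd H, of \<mu>] unfolding pred_def
      by (intro borel_measurable_times_ennreal borel_measurable_indicator)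
    then show ?thesis
      by (rule measurable_cong[THEN iffD1, rotated]) (auto simp: indicator_def)
  qed
  have "c * (\<integral>\<^sup>+z. G z \<partial>\<mu>) = (\<integral>\<^sup>+z. c * G z \<partial>\<mu>)" by (simp add: nn_integral_cmult)
  also have "\<dots> \<le> (\<integral>\<^sup>+z. \<integral>\<^sup>+y. H y * indicator {w. dist (fst w) (snd w) < r} (z, y) \<partial>?\<sigma> \<partial>\<mu>)"
  proof (rule nn_integral_mono)
    fix z assume "z \<in> space \<mu>"
    then have z: "z \<in> unit_sphere" by (simp add: sp)
    have "c * G z \<le> G z * emeasure ?\<sigma> (unit_sphere \<inter> ball z r)"
      using c[OF z] by (subst mult.commute) (intro mult_left_mono, auto)
    also have "\<dots> = (\<integral>\<^sup>+y. G z * indicator (unit_sphere \<inter> ball z r) y \<partial>?\<sigma>)"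
      by (subst nn_integral_cmult_indicator) (auto simp: sets_surface_measure sets_sphere_borel)
    also have "\<dots> \<le> (\<integral>\<^sup>+y. H y * indicator {w. dist (fst w) (snd w) < r} (z, y) \<partial>?\<sigma>)"
      using le z by (intro nn_integral_mono) (auto simp: indicator_def sp)
    finally show "c * G z \<le> (\<integral>\<^sup>+y. H y * indicator {w. dist (fst w) (snd w) < r} (z, y) \<partial>?\<sigma>)" .
  qed
  also have "\<dots> = (\<integral>\<^sup>+y. \<integral>\<^sup>+z. H y * indicator {w. dist (fst w) (snd w) < r} (z, y) \<partial>\<mu> \<partial>?\<sigma>)"
    by (rule Fubini'[symmetric]) (use meas in simp)
  also have "\<dots> \<le> (\<integral>\<^sup>+y. m * H y \<partial>?\<sigma>)"
  proof (rule nn_integral_mono)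
    fix y assume "y \<in> space ?\<sigma>"
    then have y: "y \<in> unit_sphere" by (simp add: sp)
    have "(\<integral>\<^sup>+z. H y * indicator {w. dist (fst w) (snd w) < r} (z, y) \<partial>\<mu>) =
        (\<integral>\<^sup>+z. H y * indicator (unit_sphere \<inter> ball y r) z \<partial>\<mu>)"
      by (intro nn_integral_cong) (auto simp: indicator_def sp dist_commute)
    also have "\<dots> = H y * emeasure \<mu> (unit_sphere \<inter> ball y r)"
      by (subst nn_integral_cmult_indicator) (auto simp: sets sets_sphere_borel)
    also have "\<dots> \<le> m * H y" using m[OF y] by (subst mult.commute) (intro mult_right_mono, auto)
    finally show "(\<integral>\<^sup>+z. H y * indicator {w. dist (fst w) (snd w) < r} (z, y) \<partial>\<mu>) \<le> m * H y" .
  qed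
  also have "\<dots> = m * (\<integral>\<^sup>+y. H y \<partial>?\<sigma>)" by (simp add: nn_integral_cmult)
  finally show ?thesis .
qed

lemma dist_sphere:
  fixes y z :: "'a::euclidean_space"
  assumes "norm y = 1" "norm z = 1" shows "(dist y z)\<^sup>2 = 2 - 2 * (y \<bullet> z)"
proof -
  have "y \<bullet> y = 1" "z \<bullet> z = 1" using assms by (simp_all add: dot_square_norm)
  then show ?thesis
    unfolding dist_norm power2_norm_eq_inner by (simp add: inner_diff inner_commute)
qed

lemma geodesic_ball_eq:
  fixes z :: "'a::euclidean_space"
  assumes "norm z = 1" "0 \<le> \<theta>" "\<theta> \<le> pi"
  shows "geodesic_ball z \<theta> = {u \<in> unit_sphere. cos \<theta> < z \<bullet> u}"
proof -
  have "arccos (z \<bullet> u) < \<theta> \<longleftrightarrow> cos \<theta> < z \<bullet> u" if "norm u = 1" for u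
  proof -
    have "\<bar>z \<bullet> u\<bar> \<le> 1" using Cauchy_Schwarz_ineq2[of z u] assms that by simp
    then show ?thesis using arccos_less_mono[of "z \<bullet> u" "cos \<theta>"] assms by (simp add: arccos_cos)
  qed
  then show ?thesis by (auto simp: geodesic_ball_def)
qed

lemma geodesic_ball_measurable:
  fixes z :: "'a::euclidean_space"
  assumes "norm z = 1" "0 \<le> \<theta>" "\<theta> \<le> pi"
  shows "geodesic_ball z \<theta> \<in> sets sphere_borel"
proof -
  have "open {u. cos \<theta> < z \<bullet> u}" by (intro open_Collect_less continuous_intros)
  moreover have "geodesic_ball z \<theta> = unit_sphere \<inter> {u. cos \<theta> < z \<bullet> u}"
    unfolding geodesic_ball_eq[OF assms] by blast
  ultimately show ?thesis by (auto simp: sets_sphere_borel)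
qed

text \<open>A geodesic distance theta corresponds to the chord 2 sin(theta/2), which is at least 2
  theta / pi by Jordan's inequality.\<close>

lemma sphere_ball_subset_geodesic_ball:
  fixes z :: "'a::euclidean_space"
  assumes z: "norm z = 1" and \<theta>: "0 < \<theta>" "\<theta> \<le> pi" and r: "r \<le> 2 * \<theta> / pi"
  shows "unit_sphere \<inter> ball z r \<subseteq> geodesic_ball z \<theta>"
proof
  fix u assume "u \<in> unit_sphere \<inter> ball z r"
  then have u: "norm u = 1" "dist z u < r" by auto
  have "2 * \<theta> / pi \<le> 2 * \<bar>sin (\<theta> / 2)\<bar>" using abs_sin_half_ge[of \<theta>] \<theta> by simp
  then have "dist z u < 2 * \<bar>sin (\<theta> / 2)\<bar>" using u r by linarith
  then have "(dist z u)\<^sup>2 < (2 * \<bar>sin (\<theta> / 2)\<bar>)\<^sup>2" by (intro power_strict_mono) auto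
  also have "\<dots> = 2 - 2 * cos \<theta>" using cos_double_sin[of "\<theta> / 2"] by (simp add: power_mult_distrib)
  finally have "cos \<theta> < z \<bullet> u" using dist_sphere[OF z u(1)] by simp
  then show "u \<in> geodesic_ball z \<theta>" using geodesic_ball_eq[OF z] \<theta> u by auto
qed

text \<open>Finitely many caps cover the compact sphere. This supplies the finiteness behind the
  exchange of integrals.\<close>

lemma finite_measure_of_cap_bound:
  fixes \<mu> :: "'a::euclidean_space measure"
  assumes sets: "sets \<mu> = sets sphere_borel" and "0 < r"
    and "\<And>z. z \<in> unit_sphere \<Longrightarrow> emeasure \<mu> (unit_sphere \<inter> ball z r) < \<infinity>"
  shows "finite_measure \<mu>"
proof -
  obtain F where F: "finite F" "F \<subseteq> unit_sphere" "(unit_sphere :: 'a set) \<subseteq> (\<Union>z\<in>F. ball z r)"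
  proof (rule compactE_image[OF compact_sphere[of "0::'a" 1], of unit_sphere "\<lambda>z. ball z r"])
    show "unit_sphere \<subseteq> (\<Union>z\<in>unit_sphere. ball z r)"
      using \<open>0 < r\<close> by (intro subsetI UN_I) auto
  qed auto
  have meas: "unit_sphere \<inter> ball z r \<in> sets \<mu>" for z by (auto simp: sets sets_sphere_borel)
  have "emeasure \<mu> (space \<mu>) \<le> emeasure \<mu> (\<Union>z\<in>F. unit_sphere \<inter> ball z r)"
    using F(3) space_eq_unit_sphere[OF sets] by (intro emeasure_mono sets.finite_UN F(1) meas) auto
  also have "\<dots> \<le> (\<Sum>z\<in>F. emeasure \<mu> (unit_sphere \<inter> ball z r))"
    using F meas by (intro emeasure_subadditive_finite) auto
  also have "\<dots> < \<infinity>"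
  proof -
    have "emeasure \<mu> (unit_sphere \<inter> ball z r) < top" if "z \<in> F" for z
      using assms(3)[of z] F(2) that by auto
    then show ?thesis using F(1) by simp
  qed
  finally show ?thesis by (intro finite_measureI) auto
qed

lemma powr_norm_measurable:
  assumes "poly_le L f" shows "powr_norm p f \<in> borel_measurable surface_measure"
proof -
  have "f \<in> borel_measurable borel"
    using poly_le_continuous[OF assms] by (rule borel_measurable_continuous_onI)
  from measurable_compose[OF id_measurable_sphere_borel[OF sets_surface_measure] this]
  show ?thesis unfolding powr_norm_def[abs_def] by simp
qed

lemma Lp_Carleson_of_cap_bound:
  fixes \<mu> :: "nat \<Rightarrow> 'a::euclidean_space measure"
  assumes dim: "DIM('a) = d + 1" and d: "d \<ge> 1" and p: "1 \<le> p"
    and sets: "\<And>L. L \<ge> 1 \<Longrightarrow> sets (\<mu> L) = sets sphere_borel"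
    and C: "C > 0" and bound: "\<And>L z. L \<ge> 1 \<Longrightarrow> z \<in> unit_sphere \<Longrightarrow>
      emeasure (\<mu> L) (geodesic_ball z (1 / real L)) \<le> ennreal (C / real (pi_dim TYPE('a) L))"
  shows "Lp_Carleson p \<mu>"
proof -
  let ?n = "real DIM('a)"
  define c0 where "c0 = ?n * unit_ball_vol ?n / (2 * 8 ^ DIM('a))"
  define q where "q = 1 / (32 * ?n\<^sup>2)"
  define K where "K = (9 powr p) ^ d"
  \<comment> \<open>The factor C d^d comes from the cap bound and pi_L >= (L/d)^d, c0 q^d from the
    caps of radius q/L, K from the d rotations at cost 9^p each, and the rest from integrating the
    averages. The powers of L cancel.\<close>
  define B where "B = C * real d ^ d / (c0 * q ^ d) * K * (?n * 9 ^ d)"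
  have n: "1 \<le> ?n" using dim by simp
  have c0: "0 < c0" using n by (simp add: c0_def)
  have q: "0 < q" "q \<le> 1 / 32" using n by (auto simp: q_def field_simps)
  have K: "0 < K" by (simp add: K_def)
  have B: "0 < B" using C c0 q K d n by (simp add: B_def)
  show ?thesis unfolding Lp_Carleson_def
  proof (intro exI[of _ B] conjI allI impI ballI)
    fix L :: nat and Q :: "'a \<Rightarrow> complex" assume L: "1 \<le> L" and "Q \<in> Pi_space L"
    then obtain f where f: "poly_le L f" "Q = sphere_restrict f" using Pi_space_poly_le by metis
    define r where "r = q / real L"
    have L': "1 \<le> real L" using L by simp
    have "q * pi \<le> 1 / 32 * 4" using q pi_less_4 by (intro mult_mono) auto
    then have "q * pi \<le> 2" by simp
    then have r: "0 < r" "r \<le> 1" "r \<le> 2 * (1 / real L) / pi"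
      using q L' by (simp_all add: r_def field_simps)
    have pidim: "(real L / real d) ^ d \<le> real (pi_dim TYPE('a) L)"
    proof -
      have "L \<le> (L div d + 1) * d"
        using d div_mult_mod_eq[of L d] mod_less_divisor[of d L] by (simp only: distrib_right) linarith
      then have "real L \<le> real (L div d + 1) * real d" by (metis of_nat_mono of_nat_mult)
      then have "real L / real d \<le> real (L div d + 1)"
        using d by (simp add: divide_le_eq)
      then have "(real L / real d) ^ d \<le> real (L div d + 1) ^ d" by (intro power_mono) auto
      also have "\<dots> \<le> real (pi_dim TYPE('a) L)"
        using of_nat_mono[OF pi_dim_ge[OF dim d, of L], where 'a=real] by simp
      finally show ?thesis .
    qed
    have pos: "0 < (real L / real d) ^ d" using L d by simp
    define m where "m = C / (real L / real d) ^ d"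
    have m: "emeasure (\<mu> L) (unit_sphere \<inter> ball z r) \<le> ennreal m" if z: "z \<in> unit_sphere" for z
    proof -
      have "1 / real L \<le> 1" using L' by simp
      then have "1 / real L \<le> pi" using pi_gt3 by linarith
      then have "emeasure (\<mu> L) (unit_sphere \<inter> ball z r) \<le> emeasure (\<mu> L) (geodesic_ball z (1 / real L))"
        using z L' r geodesic_ball_measurable[of z "1 / real L"]
        by (intro emeasure_mono sphere_ball_subset_geodesic_ball) (auto simp: sets[OF L])
      also have "\<dots> \<le> ennreal (C / real (pi_dim TYPE('a) L))" by (rule bound[OF L z])
      also have "\<dots> \<le> ennreal m"
        unfolding m_def using pos pidim C by (intro ennreal_leI divide_left_mono) auto
      finally show ?thesis .
    qed
    have fin: "finite_measure (\<mu> L)"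
      using finite_measure_of_cap_bound[OF sets[OF L] r(1)] m
      by (metis ennreal_less_top infinity_ennreal_def order_le_less_trans)
    let ?G = "powr_norm p f"
    have "ennreal (c0 * r ^ d) * (\<integral>\<^sup>+z. ?G z \<partial>\<mu> L) \<le>
      ennreal m * (\<integral>\<^sup>+y. ennreal K * local_average L ?G y \<partial>surface_measure)"
    proof (rule nn_integral_le_by_local_bound[OF sets[OF L] fin, where r = r])
      show "?G \<in> borel_measurable surface_measure" by (rule powr_norm_measurable[OF f(1)])
      then show "(\<lambda>y. ennreal K * local_average L ?G y) \<in> borel_measurable surface_measure"
        using local_average_measurable_nn_integral(1) by (intro borel_measurable_times_ennreal) auto
      show "?G z \<le> ennreal K * local_average L ?G y"
        if "y \<in> unit_sphere" "z \<in> unit_sphere" "dist z y < r" for y z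
        using powr_norm_le_local_average[OF p f(1) L, of y z] that
        by (simp add: K_def dim ennreal_power r_def q_def)
      show "ennreal (c0 * r ^ d) \<le> emeasure surface_measure (unit_sphere \<inter> ball z r)" if "z \<in> unit_sphere" for z :: 'a
        using emeasure_surface_measure_cap_ge[OF that r(1,2)] by (simp add: c0_def dim)
    qed (rule m)
    also have "(\<integral>\<^sup>+y. ennreal K * local_average L ?G y \<partial>surface_measure) \<le>
        ennreal K * (ennreal (?n * 9 ^ d) * (\<integral>\<^sup>+y. ?G y \<partial>surface_measure))"
    proof -
      have "ennreal (?n * 9 ^ d) = of_nat DIM('a) * 9 ^ (DIM('a) - 1)"
        by (simp add: dim ennreal_mult ennreal_of_nat_eq_real_of_nat flip: ennreal_power)
      then show ?thesis
        using local_average_measurable_nn_integral[OF powr_norm_measurable[OF f(1), of p], of L]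
        by (subst nn_integral_cmult) (auto intro: mult_left_mono)
    qed
    finally have main: "ennreal (c0 * r ^ d) * (\<integral>\<^sup>+z. ?G z \<partial>\<mu> L) \<le>
        ennreal m * (ennreal K * (ennreal (?n * 9 ^ d) * (\<integral>\<^sup>+y. ?G y \<partial>surface_measure)))"
      by (simp add: mult_left_mono)
    have inv: "ennreal (1 / w) * (ennreal w * X) = X" if "0 < w" for w X
      using that by (simp add: mult.assoc[symmetric] ennreal_mult[symmetric])
    have cr: "0 < c0 * r ^ d" using c0 r by simp
    have Beq: "1 / (c0 * r ^ d) * (m * (K * (?n * 9 ^ d))) = B"
      using c0 q L' d by (simp add: B_def m_def r_def power_divide field_simps)
    have "(\<integral>\<^sup>+z. ?G z \<partial>\<mu> L) = ennreal (1 / (c0 * r ^ d)) * (ennreal (c0 * r ^ d) * (\<integral>\<^sup>+z. ?G z \<partial>\<mu> L))"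
      by (rule inv[OF cr, symmetric])
    also have "\<dots> \<le> ennreal (1 / (c0 * r ^ d)) * (ennreal m * (ennreal K * (ennreal (?n * 9 ^ d) * (\<integral>\<^sup>+y. ?G y \<partial>surface_measure))))"
      using main by (intro mult_left_mono) auto
    also have "\<dots> = ennreal B * (\<integral>\<^sup>+y. ?G y \<partial>surface_measure)"
    proof -
      have "ennreal u * (ennreal v * (ennreal w * (ennreal x * X))) = ennreal (u * (v * (w * x))) * X"
        if "0 \<le> u" "0 \<le> v" "0 \<le> w" "0 \<le> x" for u v w x X
        using that by (simp add: ennreal_mult mult.assoc)
      moreover have "0 \<le> 1 / (c0 * r ^ d)" "0 \<le> m" "0 \<le> K" "0 \<le> ?n * 9 ^ d"
        using cr K C pos by (simp_all add: m_def)
      ultimately show ?thesis unfolding Beq[symmetric] by blast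
    qed
    finally have fin: "(\<integral>\<^sup>+z. ?G z \<partial>\<mu> L) \<le> ennreal B * (\<integral>\<^sup>+y. ?G y \<partial>surface_measure)" .
    have QG: "ennreal (norm (Q z) powr p) = ?G z" if "z \<in> unit_sphere" for z
      using that by (simp add: f(2) sphere_restrict_def powr_norm_def)
    have "(\<integral>\<^sup>+z. ennreal (norm (Q z) powr p) \<partial>\<mu> L) = (\<integral>\<^sup>+z. ?G z \<partial>\<mu> L)"
      by (rule nn_integral_cong, rule QG) (simp add: space_eq_unit_sphere[OF sets[OF L]])
    moreover have "(\<integral>\<^sup>+z. ennreal (norm (Q z) powr p) \<partial>surface_measure) = (\<integral>\<^sup>+z. ?G z \<partial>surface_measure)"
      by (rule nn_integral_cong, rule QG) (simp add: space_surface_measure)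
    ultimately show "(\<integral>\<^sup>+z. ennreal (norm (Q z) powr p) \<partial>\<mu> L) \<le>
        ennreal B * (\<integral>\<^sup>+z. ennreal (norm (Q z) powr p) \<partial>surface_measure)"
      using fin by simp
  qed (rule B)
qed

section \<open>Necessity of the cap condition\<close>

text \<open>These are the Chebyshev polynomials in \<open>z \<bullet> x\<close>, built by their
  three-term recursion.\<close>

lemma cos_multiple_poly_le:
  fixes z :: "'a::euclidean_space"
  assumes z: "norm z = 1"
  shows "\<exists>f. poly_le k f \<and> (\<forall>x. norm x = 1 \<longrightarrow> f x = of_real (cos (real k * arccos (z \<bullet> x))))"
proof (induction k rule: less_induct)
  case (less k)
  have carc: "cos (arccos (z \<bullet> x)) = z \<bullet> x" if "norm x = 1" for x
    using Cauchy_Schwarz_ineq2[of z x] z that by (intro cos_arccos_abs) simp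
  consider "k = 0" | "k = 1" | m where "k = Suc (Suc m)" by (metis One_nat_def not0_implies_Suc)
  then show ?case
  proof cases
    case 1
    then show ?thesis by (intro exI[of _ "\<lambda>x. 1"]) (simp add: poly_le_const)
  next
    case 2
    then show ?thesis
      using poly_le_inner_const[of z] carc by (intro exI[of _ "\<lambda>x. of_real (x \<bullet> z)"]) (simp add: inner_commute)
  next
    case (3 m)
    obtain f g where f: "poly_le (Suc m) f" "\<And>x. norm x = 1 \<Longrightarrow> f x = of_real (cos (real (Suc m) * arccos (z \<bullet> x)))"
      and g: "poly_le m g" "\<And>x. norm x = 1 \<Longrightarrow> g x = of_real (cos (real m * arccos (z \<bullet> x)))"
      using less.IH[of "Suc m"] less.IH[of m] 3 by (metis lessI less_SucI)
    have rec: "cos (real (Suc (Suc m)) * t) = 2 * (cos t * cos (real (Suc m) * t)) - cos (real m * t)" for t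
    proof -
      have "cos (real (Suc (Suc m)) * t) = cos (real (Suc m) * t + t)" "cos (real m * t) = cos (real (Suc m) * t - t)"
        by (simp_all add: algebra_simps)
      then show ?thesis by (simp only: cos_add cos_diff) simp
    qed
    have "poly_le k (\<lambda>x. 2 * (of_real (x \<bullet> z) * f x) + (-1) * g x)"
      using f(1) g(1) unfolding 3 by (intro poly_le_add poly_le_cmult poly_le_inner) (auto intro: poly_le_Suc)
    moreover have "2 * (of_real (x \<bullet> z) * f x) + (-1) * g x = of_real (cos (real k * arccos (z \<bullet> x)))" if "norm x = 1" for x
      using carc[OF that] unfolding f(2)[OF that] g(2)[OF that] 3 rec by (simp add: inner_commute)
    ultimately show ?thesis by blast
  qed
qed

text \<open>Each increase of N adds a pair of opposite frequencies, that is twice a cosine.\<close>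

lemma dirichlet_poly_le:
  fixes z :: "'a::euclidean_space"
  assumes z: "norm z = 1"
  shows "\<exists>f. poly_le N f \<and> (\<forall>x. norm x = 1 \<longrightarrow> f x = dirichlet N (arccos (z \<bullet> x)))"
proof (induction N)
  case 0
  show ?case by (intro exI[of _ "\<lambda>x. 1"]) (simp add: poly_le_const dirichlet_def)
next
  case (Suc N)
  then obtain f where f: "poly_le N f" "\<And>x. norm x = 1 \<Longrightarrow> f x = dirichlet N (arccos (z \<bullet> x))" by blast
  obtain g where g: "poly_le (Suc N) g" "\<And>x. norm x = 1 \<Longrightarrow> g x = of_real (cos (real (Suc N) * arccos (z \<bullet> x)))"
    using cos_multiple_poly_le[OF z, of "Suc N"] by blast
  have rec: "dirichlet (Suc N) u = dirichlet N u + 2 * of_real (cos (real (Suc N) * u))" for u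
  proof -
    have "dirichlet (Suc N) u = cis (real (Suc N) * u) + (cis (- (real (Suc N) * u)) + dirichlet N u)"
      unfolding dirichlet_def symmetric_int_interval_Suc by (simp add: algebra_simps)
    then show ?thesis by (simp add: complex_eq_iff)
  qed
  have "poly_le (Suc N) (\<lambda>x. f x + 2 * g x)"
    by (intro poly_le_add poly_le_cmult poly_le_Suc f g)
  moreover have "f x + 2 * g x = dirichlet (Suc N) (arccos (z \<bullet> x))" if "norm x = 1" for x
    unfolding rec f(2)[OF that] g(2)[OF that] ..
  ultimately show ?case by blast
qed

text \<open>All arguments k u lie in [-1, 1], where the cosine is at least 1/2, so no cancellation
  occurs in the real part.\<close>

lemma norm_dirichlet_ge:
  assumes "real N * \<bar>u\<bar> \<le> 1" shows "(2 * real N + 1) / 2 \<le> norm (dirichlet N u)"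
proof -
  have "(2 * real N + 1) / 2 = (\<Sum>k\<in>{-int N..int N}. 1 / 2)" by simp
  also have "\<dots> \<le> (\<Sum>k\<in>{-int N..int N}. cos (of_int k * u))"
  proof (rule sum_mono)
    fix k assume "k \<in> {-int N..int N}"
    then have "\<bar>of_int k :: real\<bar> \<le> real N"
      using of_int_le_iff[of "\<bar>k\<bar>" "int N", where 'a=real] by auto
    then have "\<bar>of_int k * u\<bar> \<le> real N * \<bar>u\<bar>" unfolding abs_mult by (intro mult_right_mono) auto
    then have "\<bar>of_int k * u\<bar> \<le> 1" using assms by linarith
    then have "(of_int k * u)\<^sup>2 \<le> 1" by (simp add: abs_square_le_1)
    then show "1 / 2 \<le> cos (of_int k * u)" using one_minus_cos_le[of "of_int k * u"] by linarith
  qed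
  also have "\<dots> = Re (dirichlet N u)" by (simp add: dirichlet_def)
  also have "\<dots> \<le> norm (dirichlet N u)" by (rule complex_Re_le_cmod)
  finally show ?thesis .
qed

text \<open>Dyadic decomposition around \<open>z\<close>: at distance about 2^k rho the function
  \<open>h\<close> is at most of order 2^(-k), and its power d + 1 decays faster than the measure
  2^(kd) rho^d of the ball grows.\<close>

lemma nn_integral_decay_le:
  fixes z :: "'a::euclidean_space" and h :: "'a \<Rightarrow> real"
  assumes dim: "DIM('a) = d + 1" and z: "z \<in> unit_sphere" and \<rho>: "0 < \<rho>"
    and h: "\<And>x. x \<in> unit_sphere \<Longrightarrow> 0 \<le> h x" "\<And>x. x \<in> unit_sphere \<Longrightarrow> h x \<le> 1"
      "\<And>x. x \<in> unit_sphere \<Longrightarrow> h x * dist z x \<le> \<rho>"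
  shows "(\<integral>\<^sup>+x. ennreal (h x ^ (d + 1)) \<partial>surface_measure)
    \<le> ennreal (real (d + 1) * unit_ball_vol (real (d + 1)) * 2 ^ (2 * d + 4) * \<rho> ^ d)"
proof -
  let ?c = "real (d + 1) * unit_ball_vol (real (d + 1)) * 2 ^ (d + 2)"
  define a :: "nat \<Rightarrow> real" where "a k = 2 ^ (d + 1) * ((1 / 2) ^ k) ^ (d + 1)" for k
  let ?B = "\<lambda>k. unit_sphere \<inter> ball z (2 ^ k * \<rho>)"
  have B: "?B k \<in> sets surface_measure" for k
    by (auto simp: sets_surface_measure sets_sphere_borel)
  have "(\<integral>\<^sup>+x. ennreal (h x ^ (d + 1)) \<partial>surface_measure) \<le>
      (\<integral>\<^sup>+x. (\<Sum>k. ennreal (a k) * indicator (?B k) x) \<partial>surface_measure)"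
  proof (rule nn_integral_mono)
    fix x :: 'a assume "x \<in> space surface_measure"
    then have x: "x \<in> unit_sphere" by (simp add: space_surface_measure)
    let ?P = "\<lambda>k::nat. dist z x < 2 ^ k * \<rho>"
    \<comment> \<open>The smallest ball containing x: for k > 0 the distance is at least 2^(k-1)
      rho, which yields h x <= 2 / 2^k; for k = 0 the bound h x <= 1 is enough.\<close>
    define k where "k = (LEAST k. ?P k)"
    obtain k0 :: nat where "dist z x / \<rho> < 2 ^ k0" using real_arch_pow[of 2] by auto
    then have "?P k0" using \<rho> by (simp add: divide_less_eq)
    then have Pk: "?P k" unfolding k_def by (rule LeastI)
    have "h x \<le> 2 * (1 / 2) ^ k"
    proof (cases k)
      case 0
      then show ?thesis using h(2)[OF x] by simp
    next
      case (Suc j)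
      then have "\<not> ?P j" unfolding k_def using not_less_Least[of j ?P] by simp
      then have "h x * (2 ^ j * \<rho>) \<le> h x * dist z x" using h(1)[OF x] by (intro mult_left_mono) auto
      then have "(h x * 2 ^ j) * \<rho> \<le> 1 * \<rho>" using h(3)[OF x] by simp
      then have "h x * 2 ^ j \<le> 1" using \<rho> by (simp only: mult_le_cancel_right_pos)
      then show ?thesis using Suc by (simp add: field_simps)
    qed
    then have "h x ^ (d + 1) \<le> (2 * (1 / 2) ^ k) ^ (d + 1)" using h(1)[OF x] by (intro power_mono)
    also have "\<dots> = a k" by (simp only: a_def power_mult_distrib)
    finally have "ennreal (h x ^ (d + 1)) \<le> ennreal (a k) * indicator (?B k) x"
      using x Pk by (simp add: ennreal_leI)
    also have "\<dots> \<le> (\<Sum>k. ennreal (a k) * indicator (?B k) x)"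
    proof -
      have "g k \<le> suminf g" for g :: "nat \<Rightarrow> ennreal"
        using sum_le_suminf[OF summableI, of "{k}" g] by simp
      then show ?thesis .
    qed
    finally show "ennreal (h x ^ (d + 1)) \<le> (\<Sum>k. ennreal (a k) * indicator (?B k) x)" .
  qed
  also have "\<dots> = (\<Sum>k. ennreal (a k) * emeasure surface_measure (?B k))"
    using B by (subst nn_integral_suminf) (simp_all add: nn_integral_cmult_indicator)
  \<comment> \<open>Here 2^(-k(d+1)) from \<open>a k\<close> meets 2^(kd) from the ball, and a
    geometric series with ratio 1/2 remains.\<close>
  also have "\<dots> \<le> (\<Sum>k. ennreal (?c * 2 ^ (d + 1) * \<rho> ^ d * (1 / 2) ^ k))"
  proof (intro suminf_le summableI)
    fix k
    have "ennreal (a k) * emeasure surface_measure (?B k) \<le> ennreal (a k) * ennreal (?c * (2 ^ k * \<rho>) ^ d)"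
      using emeasure_surface_measure_cap_le[OF z, of "2 ^ k * \<rho>"] \<rho> by (intro mult_left_mono) (auto simp: dim)
    also have "\<dots> = ennreal (a k * (?c * (2 ^ k * \<rho>) ^ d))"
      using \<rho> by (intro ennreal_mult[symmetric]) (auto simp: a_def)
    also have "a k * (?c * (2 ^ k * \<rho>) ^ d) = ?c * 2 ^ (d + 1) * \<rho> ^ d * (1 / 2) ^ k"
      by (simp add: a_def power_mult_distrib power_one_over field_simps)
    finally show "ennreal (a k) * emeasure surface_measure (?B k) \<le> ennreal (?c * 2 ^ (d + 1) * \<rho> ^ d * (1 / 2) ^ k)" .
  qed
  also have "\<dots> = ennreal (?c * 2 ^ (d + 1) * \<rho> ^ d * 2)"
    using \<rho> sums_mult[OF geometric_sums[of "1 / 2 :: real"], of "?c * 2 ^ (d + 1) * \<rho> ^ d"]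
    by (intro suminf_ennreal_eq) auto
  also have "?c * 2 ^ (d + 1) * \<rho> ^ d * 2 = real (d + 1) * unit_ball_vol (real (d + 1)) * 2 ^ (2 * d + 4) * \<rho> ^ d"
    by (simp add: power_add power_mult power2_eq_square field_simps flip: power_mult_distrib)
  finally show ?thesis .
qed

lemma peaked_polynomial:
  fixes z :: "'a::euclidean_space"
  assumes dim: "DIM('a) = d + 1" and p: "1 \<le> p" and L: "1 \<le> L" and z: "norm z = 1"
  obtains Q where "Q \<in> Pi_space L"
    "\<And>x. x \<in> geodesic_ball z (1 / real L) \<Longrightarrow> ((1 / 2) ^ (d + 1)) powr p \<le> norm (Q x) powr p"
    "(\<integral>\<^sup>+x. ennreal (norm (Q x) powr p) \<partial>surface_measure)
      \<le> ennreal (real (d + 1) * unit_ball_vol (real (d + 1)) * 2 ^ (2 * d + 4) * (2 * real (d + 1) / real L) ^ d)"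
proof -
  \<comment> \<open>Rounding down keeps the degree of the power d + 1 of the kernel within
    L.\<close>
  define N where "N = L div (d + 1)"
  let ?M = "2 * real N + 1"
  obtain f where f: "poly_le N f" "\<And>x. norm x = 1 \<Longrightarrow> f x = dirichlet N (arccos (z \<bullet> x))"
    using dirichlet_poly_le[OF z, of N] by blast
  define g where "g x = (inverse (of_real ?M) * f x) ^ (d + 1)" for x
  define h where "h x = norm (f x) / ?M" for x
  have ng: "norm (g x) = h x ^ (d + 1)" for x
    by (simp only: g_def h_def norm_power norm_mult norm_inverse norm_of_real) (simp add: field_simps)
  have "poly_le ((d + 1) * N) g"
    unfolding g_def by (intro poly_le_power poly_le_cmult f)
  moreover have "(d + 1) * N \<le> L" by (simp only: N_def times_div_less_eq_dividend)
  ultimately have "poly_le L g" by (rule poly_le_mono)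
  then have Q: "sphere_restrict g \<in> Pi_space L" by (rule poly_le_in_Pi_space)
  have h0: "0 \<le> h x" for x by (simp add: h_def)
  have h1: "h x \<le> 1" if "norm x = 1" for x
    using norm_dirichlet_le[of N] by (simp add: h_def f(2)[OF that] divide_le_eq)
  have ratio: "real L / real (d + 1) \<le> ?M"
  proof -
    have "l \<le> (q + 1) * e" if "q * e + r = l" "r < e" for q e r l :: nat
      using that by simp
    from this[OF div_mult_mod_eq[of L "d + 1"]] have "L \<le> (N + 1) * (d + 1)" by (simp add: N_def)
    then have "real L \<le> real (N + 1) * real (d + 1)" by (metis of_nat_mono of_nat_mult)
    then have "real L / real (d + 1) \<le> real (N + 1)" by (simp only: divide_le_eq) simp
    then show ?thesis by simp
  qed
  have carc: "cos (arccos (z \<bullet> x)) = z \<bullet> x" if "norm x = 1" for x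
    using Cauchy_Schwarz_ineq2[of z x] z that by (intro cos_arccos_abs) simp
  have h2: "h x * dist z x \<le> 2 * real (d + 1) / real L" if x: "norm x = 1" for x
  proof -
    let ?t = "arccos (z \<bullet> x)"
    have "(dist z x)\<^sup>2 = (2 * \<bar>sin (?t / 2)\<bar>)\<^sup>2"
      using dist_sphere[OF z x] carc[OF x] cos_double_sin[of "?t / 2"] by (simp add: power_mult_distrib)
    then have ds: "dist z x = 2 * \<bar>sin (?t / 2)\<bar>" by (rule power2_eq_imp_eq) auto
    have "h x * dist z x = 2 / ?M * (norm (dirichlet N ?t) * \<bar>sin (?t / 2)\<bar>)"
      by (simp add: ds h_def f(2)[OF x])
    also have "\<dots> \<le> 2 / ?M * 1" using norm_dirichlet_sin_le by (intro mult_left_mono) auto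
    also have "\<dots> \<le> 2 / (real L / real (d + 1)) * 1"
      using ratio L by (intro mult_right_mono divide_left_mono) auto
    finally show ?thesis by simp
  qed
  show thesis
  proof (rule that[OF Q])
    fix x assume xB: "x \<in> geodesic_ball z (1 / real L)"
    then have x: "norm x = 1" "arccos (z \<bullet> x) < 1 / real L" by (auto simp: geodesic_ball_def)
    have "0 \<le> arccos (z \<bullet> x)"
      using Cauchy_Schwarz_ineq2[of z x] z x(1) by (intro arccos_lbound) (auto simp: abs_le_iff)
    then have "real N * \<bar>arccos (z \<bullet> x)\<bar> \<le> real L * (1 / real L)"
      using x(2) by (intro mult_mono) (auto simp: N_def)
    then have "real N * \<bar>arccos (z \<bullet> x)\<bar> \<le> 1" using L by simp
    from norm_dirichlet_ge[OF this] have "1 / 2 \<le> h x"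
      by (simp add: h_def f(2)[OF x(1)] field_simps)
    then have "(1 / 2) ^ (d + 1) \<le> norm (g x)" unfolding ng by (intro power_mono) auto
    then show "((1 / 2) ^ (d + 1)) powr p \<le> norm (sphere_restrict g x) powr p"
      using x(1) p by (intro powr_mono2) (auto simp: sphere_restrict_def)
  next
    have "(\<integral>\<^sup>+x. ennreal (norm (sphere_restrict g x) powr p) \<partial>surface_measure) \<le>
        (\<integral>\<^sup>+x. ennreal (h x ^ (d + 1)) \<partial>surface_measure)"
    proof (intro nn_integral_mono ennreal_leI)
      fix x :: 'a assume "x \<in> space surface_measure"
      then have x: "norm x = 1" by (simp add: space_surface_measure)
      have "h x ^ (d + 1) \<le> 1" using h0 h1[OF x] by (intro power_le_one) auto
      \<comment> \<open>Values in [0, 1] only decrease under powers p >= 1, so the estimate for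
        exponent 1 serves all p.\<close>
      then have "(h x ^ (d + 1)) powr p \<le> (h x ^ (d + 1)) powr 1" using p h0 by (intro powr_mono') auto
      then show "norm (sphere_restrict g x) powr p \<le> h x ^ (d + 1)"
        using x h0[of x] by (simp add: sphere_restrict_def ng)
    qed
    also have "\<dots> \<le> ennreal (real (d + 1) * unit_ball_vol (real (d + 1)) * 2 ^ (2 * d + 4) * (2 * real (d + 1) / real L) ^ d)"
      using z L h0 h1 h2 by (intro nn_integral_decay_le[OF dim]) auto
    finally show "(\<integral>\<^sup>+x. ennreal (norm (sphere_restrict g x) powr p) \<partial>surface_measure)
      \<le> ennreal (real (d + 1) * unit_ball_vol (real (d + 1)) * 2 ^ (2 * d + 4) * (2 * real (d + 1) / real L) ^ d)" .
  qed
qed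

lemma cap_bound_of_Lp_Carleson:
  fixes \<mu> :: "nat \<Rightarrow> 'a::euclidean_space measure"
  assumes dim: "DIM('a) = d + 1" and d: "d \<ge> 1" and p: "1 \<le> p"
    and sets: "\<And>L. L \<ge> 1 \<Longrightarrow> sets (\<mu> L) = sets sphere_borel"
    and carleson: "Lp_Carleson p \<mu>"
  shows "\<exists>C>0. \<forall>L\<ge>1. \<forall>z\<in>unit_sphere.
    emeasure (\<mu> L) (geodesic_ball z (1 / real L)) \<le> ennreal (C / real (pi_dim TYPE('a) L))"
proof -
  obtain C where C: "C > 0" and carl: "\<And>L Q. 1 \<le> L \<Longrightarrow> Q \<in> Pi_space L \<Longrightarrow>
      (\<integral>\<^sup>+z. ennreal (norm (Q z) powr p) \<partial>\<mu> L) \<le> ennreal C * (\<integral>\<^sup>+z. ennreal (norm (Q z) powr p) \<partial>surface_measure)"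
    using carleson unfolding Lp_Carleson_def by blast
  define \<kappa> where "\<kappa> = ((1 / 2 :: real) ^ (d + 1)) powr p"
  define A where "A = real (d + 1) * unit_ball_vol (real (d + 1)) * 2 ^ (2 * d + 4) * (2 * real (d + 1)) ^ d"
  have \<kappa>: "0 < \<kappa>" by (simp add: \<kappa>_def)
  have A: "0 < A" by (simp add: A_def)
  \<comment> \<open>The factor 2 * 2^d comes from pi_L <= 2 (L+1)^d <= 2 (2L)^d.\<close>
  define C' where "C' = C * A / \<kappa> * (2 * 2 ^ d)"
  have "0 < C'" using C \<kappa> A by (simp add: C'_def)
  moreover have "emeasure (\<mu> L) (geodesic_ball z (1 / real L)) \<le> ennreal (C' / real (pi_dim TYPE('a) L))"
    if L: "1 \<le> L" and z: "z \<in> unit_sphere" for L z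
  proof -
    have L': "1 \<le> real L" using L by simp
    let ?B = "geodesic_ball z (1 / real L)"
    obtain Q where Q: "Q \<in> Pi_space L" "\<And>x. x \<in> ?B \<Longrightarrow> \<kappa> \<le> norm (Q x) powr p"
      "(\<integral>\<^sup>+x. ennreal (norm (Q x) powr p) \<partial>surface_measure) \<le> ennreal (A / real L ^ d)"
      using peaked_polynomial[OF dim p L, of z] z by (auto simp: \<kappa>_def A_def power_divide)
    have "1 / real L \<le> 1" using L' by simp
    then have "1 / real L \<le> pi" using pi_gt3 by linarith
    then have B: "?B \<in> sets (\<mu> L)" using geodesic_ball_measurable[of z "1 / real L"] z by (simp add: sets[OF L])
    have "ennreal \<kappa> * emeasure (\<mu> L) ?B = (\<integral>\<^sup>+x. ennreal \<kappa> * indicator ?B x \<partial>\<mu> L)"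
      using B by (simp add: nn_integral_cmult_indicator)
    also have "\<dots> \<le> (\<integral>\<^sup>+x. ennreal (norm (Q x) powr p) \<partial>\<mu> L)"
      using Q(2) by (intro nn_integral_mono) (auto simp: indicator_def intro: ennreal_leI)
    also have "\<dots> \<le> ennreal C * (\<integral>\<^sup>+x. ennreal (norm (Q x) powr p) \<partial>surface_measure)"
      by (rule carl[OF L Q(1)])
    also have "\<dots> \<le> ennreal C * ennreal (A / real L ^ d)" by (intro mult_left_mono Q(3)) auto
    finally have 1: "ennreal \<kappa> * emeasure (\<mu> L) ?B \<le> ennreal C * ennreal (A / real L ^ d)" .
    have "emeasure (\<mu> L) ?B = ennreal (1 / \<kappa>) * (ennreal \<kappa> * emeasure (\<mu> L) ?B)"
      using \<kappa> by (simp add: mult.assoc[symmetric] ennreal_mult[symmetric])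
    also have "\<dots> \<le> ennreal (1 / \<kappa>) * (ennreal C * ennreal (A / real L ^ d))"
      by (intro mult_left_mono 1) auto
    also have "\<dots> = ennreal (C * A / \<kappa> / real L ^ d)"
      using C \<kappa> A by (simp add: ennreal_mult[symmetric] mult_ac)
    also have "\<dots> \<le> ennreal (C' / real (pi_dim TYPE('a) L))"
    proof (rule ennreal_leI)
      have "pi_dim TYPE('a) L \<le> 2 * (L + 1) ^ d" by (rule pi_dim_le[OF dim])
      also have "\<dots> \<le> 2 * (2 * L) ^ d" using L by (intro mult_left_mono power_mono) auto
      finally have "real (pi_dim TYPE('a) L) \<le> 2 * 2 ^ d * real L ^ d"
        by (simp add: power_mult_distrib flip: of_nat_le_iff[where 'a=real])
      \<comment> \<open>Positivity matters: division by zero would make the right-hand side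
        0.\<close>
      moreover have "0 < pi_dim TYPE('a) L"
        using pi_dim_ge[OF dim d, of L] by (metis gr0I le_zero_eq power_not_zero Suc_eq_plus1 Zero_not_Suc)
      ultimately have "C' / (2 * 2 ^ d * real L ^ d) \<le> C' / real (pi_dim TYPE('a) L)"
        using \<open>0 < C'\<close> L' by (intro divide_left_mono mult_pos_pos) auto
      then show "C * A / \<kappa> / real L ^ d \<le> C' / real (pi_dim TYPE('a) L)"
        by (simp add: C'_def)
    qed
    finally show ?thesis .
  qed
  ultimately show ?thesis by blast
qed

theorem theorem4p5:
  fixes d :: nat and p :: real and \<mu> :: "nat \<Rightarrow> 'a::euclidean_space measure"
  assumes dim: "DIM('a) = d + 1" and d: "d \<ge> 2" and p: "1 \<le> p"
    and borel: "\<And>L. L \<ge> 1 \<Longrightarrow> sets (\<mu> L) = sets sphere_borel"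
  shows "Lp_Carleson p \<mu> \<longleftrightarrow>
    (\<exists>C::real. C > 0 \<and> (\<forall>L\<ge>1.
      (SUP z\<in>unit_sphere. emeasure (\<mu> L) (geodesic_ball z (1 / real L)))
        \<le> ennreal (C / real (pi_dim TYPE('a) L))))"
proof -
  have d1: "d \<ge> 1" using d by simp
  show ?thesis
  proof
    assume "Lp_Carleson p \<mu>"
    from cap_bound_of_Lp_Carleson[OF dim d1 p borel this]
    show "\<exists>C::real. C > 0 \<and> (\<forall>L\<ge>1.
        (SUP z\<in>unit_sphere. emeasure (\<mu> L) (geodesic_ball z (1 / real L)))
          \<le> ennreal (C / real (pi_dim TYPE('a) L)))"
      by (auto simp: SUP_le_iff)
  next
    assume "\<exists>C::real. C > 0 \<and> (\<forall>L\<ge>1.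
        (SUP z\<in>unit_sphere. emeasure (\<mu> L) (geodesic_ball z (1 / real L)))
          \<le> ennreal (C / real (pi_dim TYPE('a) L)))"
    then obtain C where "C > 0" and C: "\<And>L. L \<ge> 1 \<Longrightarrow>
        (SUP z\<in>unit_sphere. emeasure (\<mu> L) (geodesic_ball z (1 / real L)))
          \<le> ennreal (C / real (pi_dim TYPE('a) L))"
      by blast
    show "Lp_Carleson p \<mu>"
      by (rule Lp_Carleson_of_cap_bound[OF dim d1 p borel \<open>C > 0\<close> order_trans[OF SUP_upper C]])
  qed
qed

end
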